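(* Let $\Delta$ be a complete simplicial multi-fan in a lattice $L$ of rank $n$ and $\mathcal V=\{v_i\}_{i\in\Sigma^{(1)}}$ a set of generating edge vectors. If $c_1(\Delta,\mathcal V)=0$, then the orbifold elliptic genus $\hat\varphi(\Delta,\mathcal V;\tau,\sigma)$ vanishes identically.
   Context: Multi-fans. Let $L$ be a lattice of rank $n$, $L_{\mathbb R}=L\otimes\mathbb R$, $L^*=\mathrm{Hom}(L,\mathbb Z)$, and $\langle\cdot,\cdot\rangle$ the dual pairing. An $n$-dimensional simplicial multi-fan in $L$ is a triple $\Delta=(\Sigma,C,w^\pm)$, where: $\Sigma$ is a finite abstract simplicial complex with the empty simplex included; $\Sigma^{(k)}$ is the set of simplices with exactly $k$ elements (so $\Sigma^{(0)}=\{\emptyset\}$, and a vertex $i$ is identified with $\{i\}\in\Sigma^{(1)}$); $\Sigma=\bigsqcup_{k=0}^n\Sigma^{(k)}$, $\Sigma^{(n)}\neq\emptyset$, and every simplex is contained in an element of $\Sigma^{(n)}$; $C$ assigns to each $I\in\Sigma^{(k)}$ a $k$-dimensional strongly convex rational polyhedral cone $C(I)\subset L_{\mathbb R}$ such that $C(J)$ is a face of $C(I)$ whenever $J$ is a face of $I$ (so $C(I)$ is spanned by the rays $C(i)$, $i\in I$); and $w^\pm:\Sigma^{(n)}\to\mathbb Z_{\ge0}$ are functions, with $w=w^+-w^-$. A vector $v\in L_{\mathbb R}$ is generic if it lies on no linear subspace spanned by a cone $C(J)$ of dimension less than $n$. $\Delta$ is pre-complete if $d_v=\sum_{I\in\Sigma^{(n)},\,v\in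 C(I)}w(I)$ is independent of the generic vector $v$; this integer is $\deg(\Delta)$. For $K\in\Sigma$, let $\Sigma_K=\{J\in\Sigma: K\subset J\}$, let $L^K$ be the image of $L$ in $L_{\mathbb R}/\mathrm{span}\,C(K)$, let $C_K(J)$ be the projection of $C(J)$, and let $w_K^\pm$ be the restriction of $w^\pm$ to $\Sigma_K^{(n-|K|)}=\{I\in\Sigma^{(n)}:K\subset I\}$; then $\Delta_K=(\Sigma_K,C_K,w_K^\pm)$ is the projected multi-fan in $L^K$. $\Delta$ is complete if $\Delta_K$ is pre-complete for all $K\in\Sigma$. Edge vectors. $\mathcal V=\{v_i\}_{i\in\Sigma^{(1)}}$ with $v_i\in L$ generating the ray $C(i)$, not necessarily primitive (but if $\Delta$ is non-singular, i.e. the primitive generators of the rays $C(i)$, $i\in I$, form a basis of $L$ for every $I\in\Sigma^{(n)}$, the $v_i$ are assumed primitive). For $I\in\Sigma^{(n)}$, $L_{I,\mathcal V}$ is the sublattice of $L$ generated by $\{v_i\}_{i\in I}$, $H_I=L/L_{I,\mathcal V}$, and $\{u_i^I\}_{i\in I}\subset L_{\mathbb R}^*$ is the basis dual to $\{v_i\}_{i\in I}$. $L_{\mathcal V}=\bigcap_{I\in\Sigma^{(n)}}L_{I,\mathcal V}$. Chern class. $H_T^2(\Delta)$ is the free abelian group on symbols $x_i$, $i\in\Sigma^{(1)}$ (degree-two part of the face ring of $\Sigma$), and $L^*=H^2(BT)$ is embedded in it by $u\mapsto\sum_i\langle u,v_i\rangle x_i$. $c_1^T(\Delta,\mathcal V)=\sum_{i\in\Sigma^{(1)}}x_i$,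 and $c_1(\Delta,\mathcal V)$ is its image in $H_T^2(\Delta)/L^*$. Orbifold elliptic genus. For $z,\sigma\in\mathbb C$ and $\tau$ in the upper half plane put $t=e^{2\pi\sqrt{-1}z}$, $q=e^{2\pi\sqrt{-1}\tau}$, $\zeta=e^{2\pi\sqrt{-1}\sigma}$ (with $\zeta^{a}=e^{2\pi\sqrt{-1}a\sigma}$ for $a\in\mathbb Q$) and $$\phi(z,\tau,\sigma)=\zeta^{-\frac12}\frac{1-\zeta t}{1-t}\prod_{m=1}^\infty\frac{(1-\zeta tq^m)(1-\zeta^{-1}t^{-1}q^m)}{(1-tq^m)(1-t^{-1}q^m)}.$$ For generic $v\in L_{\mathcal V}$, $$\hat\varphi^v(\Delta,\mathcal V;z,\tau,\sigma)=\sum_{I\in\Sigma^{(n)}}\frac{w(I)}{|H_I|}\sum_{(h_1,h_2)\in H_I\times H_I}\prod_{i\in I}\zeta^{\langle u_i^I,v(h_1)\rangle}\,\phi(-\langle u_i^I,zv-\tau v(h_1)+v(h_2)\rangle,\tau,\sigma),$$ where $v(h)\in L$ denotes a representative of $h$ (the result is independent of representatives). The orbifold elliptic genus $\hat\varphi(\Delta,\mathcal V;\tau,\sigma)$ is the formal power series in $q$ whose coefficients are (up to the factor $\zeta^{-n/2}$) finite linear combinations, with coefficients in $\mathbb Z[\zeta^{1/r},\zeta^{-1/r}]$ ($r$ the least common multiple of the $|H_I|$), of characters $t^u$, $u\in L^*$, of the torus $T=L_{\mathbb R}/L$, determined by $v^*(\hat\varphi(\Delta,\mathcal V))=\hat\varphi^v(\Delta,\mathcal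 V)$ for all generic $v\in L_{\mathcal V}$, where $v^*(t^u)=t^{\langle u,v\rangle}$. It vanishes identically if and only if $\hat\varphi^v(\Delta,\mathcal V;z,\tau,\sigma)\equiv0$ (as a function of $z,\tau,\sigma$) for all generic $v\in L_{\mathcal V}$.
   Formalization: The rank n is assumed to be at least 1; for n = 0 the claim fails, since with Σ = {∅} and w(∅) = 1 the class c_1 is zero in the trivial group while the genus equals w(∅) = 1. *)

theory Defs
  imports
    "HOL-Analysis.Analysis"
    "HOL-Computational_Algebra.Formal_Power_Series"
    "HOL-Algebra.Free_Abelian_Groups"
begin

section \<open>Lattices\<close>

definition int_span :: "'v::real_vector set \<Rightarrow> 'v set" where
  "int_span B = range (\<lambda>c :: 'v \<Rightarrow> int. \<Sum>b\<in>B. of_int (c b) *\<^sub>R b)"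

text \<open>A lattice \<open>L\<close> of rank \<open>dim L\<close> is realised inside a Euclidean space, which may be larger
  than \<open>L\<^sub>\<real> = span L\<close>. The inner product is used only to realise quotient spaces (see
  \<open>quotient_map\<close> below).\<close>

definition is_lattice :: "'v::euclidean_space set \<Rightarrow> bool" where
  "is_lattice L \<longleftrightarrow> (\<exists>B. finite B \<and> independent B \<and> L = int_span B)"

definition additive_group :: "'v::ab_group_add set \<Rightarrow> 'v monoid" where
  "additive_group A = \<lparr>carrier = A, monoid.mult = (+), one = 0\<rparr>"

text \<open>\<open>L\<^sup>* = Hom(L, \<int>)\<close>; extensionality makes each homomorphism a unique HOL function.\<close>

definition dual_lattice :: "'v::euclidean_space set \<Rightarrow> ('v \<Rightarrow> int) set" where
  "dual_lattice L = hom (additive_group L) integer_group \<inter> extensional L"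

definition primitive_in :: "'v::euclidean_space set \<Rightarrow> 'v \<Rightarrow> bool" where
  "primitive_in L p \<longleftrightarrow>
     p \<in> L \<and> p \<noteq> 0 \<and> (\<forall>x\<in>L. \<forall>k::int. p = of_int k *\<^sub>R x \<longrightarrow> \<bar>k\<bar> = 1)"

section \<open>Multi-fans\<close>

record ('i, 'v) multifan =
  lat :: "'v set"
  simplices :: "'i set set"
  cone_of :: "'i set \<Rightarrow> 'v set"
  wplus :: "'i set \<Rightarrow> nat"
  wminus :: "'i set \<Rightarrow> nat"

definition mf_rank :: "('i, 'v::euclidean_space) multifan \<Rightarrow> nat" where
  "mf_rank \<Delta> = dim (lat \<Delta>)"

text \<open>\<open>\<Sigma>\<^sup>(\<^sup>k\<^sup>)\<close>. In a projected multi-fan \<open>\<Delta>\<^sub>K\<close> the simplices are the \<open>J \<supseteq> K\<close>, and the minimal one, \<open>K\<close>,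
  plays the role of the empty simplex; so sizes are counted relative to the minimal simplex
  \<open>\<Inter>\<Sigma>\<close>, which is empty for \<open>\<Delta>\<close> itself.\<close>

definition layer :: "('i, 'v) multifan \<Rightarrow> nat \<Rightarrow> 'i set set" where
  "layer \<Delta> k = {J \<in> simplices \<Delta>. card J = card (\<Inter>(simplices \<Delta>)) + k}"

definition facets :: "('i, 'v::euclidean_space) multifan \<Rightarrow> 'i set set" where
  "facets \<Delta> = layer \<Delta> (mf_rank \<Delta>)"

definition vertices :: "('i, 'v) multifan \<Rightarrow> 'i set" where
  "vertices \<Delta> = {i. {i} \<in> layer \<Delta> 1}"

text \<open>The functions \<open>w\<^sup>\<plusminus>\<close> matter only on \<open>facets\<close>; their values elsewhere are never used.\<close>

definition weight :: "('i, 'v) multifan \<Rightarrow> 'i set \<Rightarrow> int" where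
  "weight \<Delta> I = int (wplus \<Delta> I) - int (wminus \<Delta> I)"

definition strongly_convex_rational_cone :: "'v::euclidean_space set \<Rightarrow> 'v set \<Rightarrow> bool" where
  "strongly_convex_rational_cone L S \<longleftrightarrow>
     (\<exists>A. finite A \<and> A \<subseteq> L \<and> S = convex_cone hull A) \<and> S \<inter> uminus ` S = {0}"

text \<open>That \<open>C I\<close> is spanned by the rays of its vertices is listed explicitly, since the face
  condition alone would allow two vertices of a simplex to have the same ray.\<close>

definition simplicial_multifan :: "('i, 'v::euclidean_space) multifan \<Rightarrow> bool" where
  "simplicial_multifan \<Delta> \<longleftrightarrow>
     is_lattice (lat \<Delta>) \<and>
     finite (simplices \<Delta>) \<and> {} \<in> simplices \<Delta> \<and>
     (\<forall>I \<in> simplices \<Delta>. finite I \<and> (\<forall>J \<subseteq> I. J \<in> simplices \<Delta>)) \<and>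
     simplices \<Delta> = (\<Union>k \<le> mf_rank \<Delta>. layer \<Delta> k) \<and>
     facets \<Delta> \<noteq> {} \<and> (\<forall>J \<in> simplices \<Delta>. \<exists>I \<in> facets \<Delta>. J \<subseteq> I) \<and>
     (\<forall>I \<in> simplices \<Delta>.
        strongly_convex_rational_cone (lat \<Delta>) (cone_of \<Delta> I) \<and>
        dim (cone_of \<Delta> I) = card I \<and>
        (\<forall>J \<subseteq> I. cone_of \<Delta> J face_of cone_of \<Delta> I) \<and>
        cone_of \<Delta> I = convex_cone hull (\<Union>i\<in>I. cone_of \<Delta> {i}))"

definition generic :: "('i, 'v::euclidean_space) multifan \<Rightarrow> 'v \<Rightarrow> bool" where
  "generic \<Delta> v \<longleftrightarrow>
     v \<in> span (lat \<Delta>) \<and>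
     (\<forall>J \<in> simplices \<Delta>. dim (cone_of \<Delta> J) < mf_rank \<Delta> \<longrightarrow> v \<notin> span (cone_of \<Delta> J))"

definition pre_complete :: "('i, 'v::euclidean_space) multifan \<Rightarrow> bool" where
  "pre_complete \<Delta> \<longleftrightarrow>
     (\<exists>d. \<forall>v. generic \<Delta> v \<longrightarrow> (\<Sum>I | I \<in> facets \<Delta> \<and> v \<in> cone_of \<Delta> I. weight \<Delta> I) = d)"

text \<open>The quotient by a linear subspace \<open>W\<close>, realised as the orthogonal projection to the orthogonal
  complement of \<open>W\<close>, which is a linear map with kernel \<open>W\<close>.\<close>

definition quotient_map :: "'v::euclidean_space set \<Rightarrow> 'v \<Rightarrow> 'v" where
  "quotient_map W x = (THE y. x - y \<in> W \<and> (\<forall>w\<in>W. orthogonal w y))"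

definition projected :: "('i, 'v::euclidean_space) multifan \<Rightarrow> 'i set \<Rightarrow> ('i, 'v) multifan" where
  "projected \<Delta> K = \<lparr>
     lat = quotient_map (span (cone_of \<Delta> K)) ` lat \<Delta>,
     simplices = {J \<in> simplices \<Delta>. K \<subseteq> J},
     cone_of = (\<lambda>J. quotient_map (span (cone_of \<Delta> K)) ` cone_of \<Delta> J),
     wplus = wplus \<Delta>,
     wminus = wminus \<Delta>\<rparr>"

definition complete_multifan :: "('i, 'v::euclidean_space) multifan \<Rightarrow> bool" where
  "complete_multifan \<Delta> \<longleftrightarrow> (\<forall>K \<in> simplices \<Delta>. pre_complete (projected \<Delta> K))"

section \<open>Edge vectors\<close>

definition nonsingular :: "('i, 'v::euclidean_space) multifan \<Rightarrow> bool" where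
  "nonsingular \<Delta> \<longleftrightarrow>
     (\<forall>I \<in> facets \<Delta>. \<exists>p. (\<forall>i\<in>I. primitive_in (lat \<Delta>) (p i) \<and> p i \<in> cone_of \<Delta> {i}) \<and>
        inj_on p I \<and> independent (p ` I) \<and> lat \<Delta> = int_span (p ` I))"

definition edge_vectors :: "('i, 'v::euclidean_space) multifan \<Rightarrow> ('i \<Rightarrow> 'v) \<Rightarrow> bool" where
  "edge_vectors \<Delta> V \<longleftrightarrow>
     (\<forall>i \<in> vertices \<Delta>. V i \<in> lat \<Delta> \<and> cone_of \<Delta> {i} = {c *\<^sub>R V i | c. 0 \<le> c}) \<and>
     (nonsingular \<Delta> \<longrightarrow> (\<forall>i \<in> vertices \<Delta>. primitive_in (lat \<Delta>) (V i)))"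

definition lat_I :: "('i \<Rightarrow> 'v::euclidean_space) \<Rightarrow> 'i set \<Rightarrow> 'v set" where
  "lat_I V I = int_span (V ` I)"

definition H_I :: "('i, 'v::euclidean_space) multifan \<Rightarrow> ('i \<Rightarrow> 'v) \<Rightarrow> 'i set \<Rightarrow> 'v set monoid" where
  "H_I \<Delta> V I = additive_group (lat \<Delta>) Mod lat_I V I"

text \<open>The pairing \<open>\<langle>u\<^sub>i\<^sup>I, x\<rangle>\<close> with the dual basis: the \<open>V i\<close>-coordinate of \<open>x\<close> in the basis \<open>V ` I\<close>.\<close>

definition dual_basis :: "('i \<Rightarrow> 'v::euclidean_space) \<Rightarrow> 'i set \<Rightarrow> 'i \<Rightarrow> 'v \<Rightarrow> real" where
  "dual_basis V I i x = representation (V ` I) x (V i)"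

definition lat_V :: "('i, 'v::euclidean_space) multifan \<Rightarrow> ('i \<Rightarrow> 'v) \<Rightarrow> 'v set" where
  "lat_V \<Delta> V = (\<Inter>I \<in> facets \<Delta>. lat_I V I)"

section \<open>First Chern class\<close>

definition H2T :: "('i, 'v) multifan \<Rightarrow> ('i \<Rightarrow>\<^sub>0 int) monoid" where
  "H2T \<Delta> = free_Abelian_group (vertices \<Delta>)"

definition dual_embedding ::
    "('i, 'v::euclidean_space) multifan \<Rightarrow> ('i \<Rightarrow> 'v) \<Rightarrow> ('v \<Rightarrow> int) \<Rightarrow> ('i \<Rightarrow>\<^sub>0 int)" where
  "dual_embedding \<Delta> V u = (\<Sum>i \<in> vertices \<Delta>. frag_cmul (u (V i)) (frag_of i))"

definition c1T :: "('i, 'v) multifan \<Rightarrow> ('i \<Rightarrow>\<^sub>0 int)" where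
  "c1T \<Delta> = (\<Sum>i \<in> vertices \<Delta>. frag_of i)"

definition H2_quotient ::
    "('i, 'v::euclidean_space) multifan \<Rightarrow> ('i \<Rightarrow> 'v) \<Rightarrow> ('i \<Rightarrow>\<^sub>0 int) set monoid" where
  "H2_quotient \<Delta> V = H2T \<Delta> Mod (dual_embedding \<Delta> V ` dual_lattice (lat \<Delta>))"

definition c1 :: "('i, 'v::euclidean_space) multifan \<Rightarrow> ('i \<Rightarrow> 'v) \<Rightarrow> ('i \<Rightarrow>\<^sub>0 int) set" where
  "c1 \<Delta> V = (dual_embedding \<Delta> V ` dual_lattice (lat \<Delta>)) #>\<^bsub>H2T \<Delta>\<^esub> c1T \<Delta>"

section \<open>Orbifold elliptic genus\<close>

definition cis2pi :: "complex \<Rightarrow> complex" where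
  "cis2pi x = exp (2 * of_real pi * \<i> * x)"

definition phi :: "complex \<Rightarrow> complex \<Rightarrow> complex \<Rightarrow> complex" where
  "phi z \<tau> \<sigma> =
     (let t = cis2pi z; q = cis2pi \<tau>; \<zeta> = cis2pi \<sigma> in
      cis2pi (- \<sigma> / 2) * ((1 - \<zeta> * t) / (1 - t)) *
      prodinf (\<lambda>m. ((1 - \<zeta> * t * q ^ Suc m) * (1 - inverse \<zeta> * inverse t * q ^ Suc m)) /
            ((1 - t * q ^ Suc m) * (1 - inverse t * q ^ Suc m))))"

text \<open>A representative in \<open>L\<close> of an element of \<open>L / L\<^sub>I\<close>.\<close>

definition rep :: "'v set \<Rightarrow> 'v" where
  "rep h = (SOME x. x \<in> h)"

text \<open>\<open>- \<langle>u\<^sub>i\<^sup>I, z v - \<tau> v(h\<^sub>1) + v(h\<^sub>2)\<rangle>\<close>, with the pairing extended complex-linearly.\<close>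

definition phi_arg ::
    "('i \<Rightarrow> 'v::euclidean_space) \<Rightarrow> 'i set \<Rightarrow> 'i \<Rightarrow> 'v set \<Rightarrow> 'v set \<Rightarrow> 'v \<Rightarrow> complex \<Rightarrow> complex \<Rightarrow> complex" where
  "phi_arg V I i h1 h2 v z \<tau> =
     - (z * of_real (dual_basis V I i v) - \<tau> * of_real (dual_basis V I i (rep h1))
        + of_real (dual_basis V I i (rep h2)))"

definition genus_at ::
    "('i, 'v::euclidean_space) multifan \<Rightarrow> ('i \<Rightarrow> 'v) \<Rightarrow> 'v \<Rightarrow> complex \<Rightarrow> complex \<Rightarrow> complex \<Rightarrow> complex" where
  "genus_at \<Delta> V v z \<tau> \<sigma> =
     (\<Sum>I \<in> facets \<Delta>. of_int (weight \<Delta> I) / of_nat (order (H_I \<Delta> V I)) *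
        (\<Sum>(h1, h2) \<in> carrier (H_I \<Delta> V I) \<times> carrier (H_I \<Delta> V I).
           \<Prod>i\<in>I. cis2pi (of_real (dual_basis V I i (rep h1)) * \<sigma>) *
                  phi (phi_arg V I i h1 h2 v z \<tau>) \<tau> \<sigma>))"

text \<open>No factor \<open>phi\<close> in \<open>genus_at\<close> is evaluated on its polar lattice \<open>\<int> + \<int>\<tau>\<close>, where HOL's
  convention for division by zero would give meaningless values.\<close>

definition regular_point ::
    "('i, 'v::euclidean_space) multifan \<Rightarrow> ('i \<Rightarrow> 'v) \<Rightarrow> 'v \<Rightarrow> complex \<Rightarrow> complex \<Rightarrow> bool" where
  "regular_point \<Delta> V v z \<tau> \<longleftrightarrow>
     (\<forall>I \<in> facets \<Delta>. \<forall>h1 \<in> carrier (H_I \<Delta> V I). \<forall>h2 \<in> carrier (H_I \<Delta> V I). \<forall>i\<in>I. \<forall>a b :: int.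
        phi_arg V I i h1 h2 v z \<tau> \<noteq> of_int a + of_int b * \<tau>)"

definition root_denom :: "('i, 'v::euclidean_space) multifan \<Rightarrow> ('i \<Rightarrow> 'v) \<Rightarrow> nat" where
  "root_denom \<Delta> V = Lcm ((\<lambda>I. order (H_I \<Delta> V I)) ` facets \<Delta>)"

text \<open>An element of type \<^typ>\<open>int \<Rightarrow>\<^sub>0 int\<close> encodes the Laurent polynomial
  \<open>\<Sum>\<^sub>k p\<^sub>k \<zeta>\<^bsup>k/r\<^esup> \<in> \<int>[\<zeta>\<^bsup>1/r\<^esup>, \<zeta>\<^bsup>-1/r\<^esup>]\<close>, and an element of type \<^typ>\<open>('v \<Rightarrow> int) \<Rightarrow>\<^sub>0 (int \<Rightarrow>\<^sub>0 int)\<close>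
  supported on \<open>L\<^sup>*\<close> encodes a finite linear combination of characters \<open>t\<^sup>u\<close> with such
  coefficients.\<close>

definition laurent_value :: "nat \<Rightarrow> (int \<Rightarrow>\<^sub>0 int) \<Rightarrow> complex \<Rightarrow> complex" where
  "laurent_value r p \<sigma> =
     (\<Sum>k \<in> Poly_Mapping.keys p. of_int (Poly_Mapping.lookup p k) * cis2pi (of_int k * \<sigma> / of_nat r))"

definition character_value ::
    "nat \<Rightarrow> (('v \<Rightarrow> int) \<Rightarrow>\<^sub>0 (int \<Rightarrow>\<^sub>0 int)) \<Rightarrow> 'v \<Rightarrow> complex \<Rightarrow> complex \<Rightarrow> complex" where
  "character_value r c v z \<sigma> =
     (\<Sum>u \<in> Poly_Mapping.keys c. laurent_value r (Poly_Mapping.lookup c u) \<sigma> * cis2pi (of_int (u v) * z))"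

text \<open>\<open>\<zeta>\<^bsup>-n/2\<^esup> \<Phi>\<close> restricts along every generic \<open>v \<in> L\<^sub>\<V>\<close> to \<open>genus_at\<close>. The factors \<open>phi\<close> have poles with
  \<open>\<bar>t\<bar>\<close> a nonzero power of \<open>\<bar>q\<bar>\<close>, so \<open>\<bar>t\<bar> = 1\<close>, i.e. \<open>z\<close> real, is where the expansion in \<open>q\<close> converges on
  the whole unit disc. These values of \<open>z\<close> determine \<open>\<Phi>\<close>, and also the meromorphic function
  \<open>genus_at\<close> by analytic continuation.\<close>

definition is_orbifold_elliptic_genus ::
    "('i, 'v::euclidean_space) multifan \<Rightarrow> ('i \<Rightarrow> 'v) \<Rightarrow> (('v \<Rightarrow> int) \<Rightarrow>\<^sub>0 (int \<Rightarrow>\<^sub>0 int)) fps \<Rightarrow> bool" where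
  "is_orbifold_elliptic_genus \<Delta> V \<Phi> \<longleftrightarrow>
     (\<forall>m. Poly_Mapping.keys (fps_nth \<Phi> m) \<subseteq> dual_lattice (lat \<Delta>)) \<and>
     (\<forall>v \<in> lat_V \<Delta> V. generic \<Delta> v \<longrightarrow>
        (\<forall>(z::real) \<tau> \<sigma>. Im \<tau> > 0 \<and> regular_point \<Delta> V v (of_real z) \<tau> \<longrightarrow>
           (\<lambda>m. cis2pi (- of_nat (mf_rank \<Delta>) * \<sigma> / 2) *
                character_value (root_denom \<Delta> V) (fps_nth \<Phi> m) v (of_real z) \<sigma> * cis2pi \<tau> ^ m)
             sums genus_at \<Delta> V v (of_real z) \<tau> \<sigma>))"

text \<open>The genus up to the unit \<open>\<zeta>\<^bsup>-n/2\<^esup>\<close>, as a power series in \<open>q\<close>.\<close>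

definition orbifold_elliptic_genus ::
    "('i, 'v::euclidean_space) multifan \<Rightarrow> ('i \<Rightarrow> 'v) \<Rightarrow> (('v \<Rightarrow> int) \<Rightarrow>\<^sub>0 (int \<Rightarrow>\<^sub>0 int)) fps" where
  "orbifold_elliptic_genus \<Delta> V = (THE \<Phi>. is_orbifold_elliptic_genus \<Delta> V \<Phi>)"

end

theory Submission
  imports Defs "HOL-Complex_Analysis.Complex_Analysis"
begin

text \<open>Write \<open>phi\<close> as a quotient of theta functions; it is elliptic up to the factor \<open>\<zeta>\<^sup>-\<^sup>1\<close> under
  \<open>z \<mapsto> z + \<tau>\<close> and has simple poles on \<open>\<int> + \<int>\<tau>\<close>. If \<open>c\<^sub>1 = 0\<close>, there is \<open>u \<in> L\<^sup>*\<close> with \<open>\<langle>u, v\<^sub>i\<rangle> = 1\<close> for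
  all \<open>i\<close>, so \<open>\<Sum>\<^bsub>i\<in>I\<^esub> u\<^sub>i\<^sup>I = u\<close> for every facet \<open>I\<close>. Restrict the genus, as a function of a point of
  \<open>L \<otimes> \<complex>\<close>, to a complex line \<open>r + x v\<^sub>0\<close> with \<open>v\<^sub>0 \<in> L\<^sub>\<V>\<close> and \<open>N = \<langle>u, v\<^sub>0\<rangle> > 0\<close>. The result has period \<open>1\<close> and
  is multiplied by \<open>\<zeta>\<^sup>N\<close> under \<open>x \<mapsto> x + \<tau>\<close>. For generic \<open>r\<close> each pole on this line is simple and belongs to
  a single ridge \<open>J\<close> in each facet; the residues of the facets containing \<open>J\<close> agree up to the factor
  \<open>w(I)\<close> and the side of \<open>J\<close> on which \<open>I\<close> lies, so they cancel because \<open>\<Delta>\<^sub>J\<close> is pre-complete. By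
  Liouville's theorem the function vanishes unless \<open>\<zeta>\<^sup>N\<close> is special, and by continuity in \<open>r\<close> and \<open>\<sigma>\<close> it
  vanishes at all regular points. Finally, a power series in \<open>q\<close> that represents \<open>0\<close> is \<open>0\<close>, because
  characters separated by some generic \<open>v \<in> L\<^sub>\<V>\<close> are linearly independent.\<close>

section \<open>The theta quotient\<close>

text \<open>The direction \<open>v0\<close> is a positive multiple of an edge vector and unrelated
  to the vector \<open>v\<close> at which the genus is evaluated: \<open>u\<close> may vanish on
  \<open>v\<close>, and then the multiplier would be trivial and Liouville would leave a constant.
  The obstacle on such a line is that several factors of one summand may become singular together,
  giving poles of higher order. Lattice vectors have rational coordinates, so a factor is singular
  only where its coordinate of the point lies in \<open>\<rat> + \<rat> \<tau>\<close>;
  irrationality conditions on \<open>r\<close> keep two coordinates from doing so at once. The Chern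
  class condition enters twice: the multiplier under \<open>\<tau>\<close> becomes the same for all
  facets, and the product of the powers of \<open>\<zeta>\<close> in a summand depends only on
  \<open>u\<close> and the lattice vector, hence is shared by all facets at a ridge. What remains
  different is the quotient of \<open>m\<close> by the order of \<open>L / L_I\<close>, where
  \<open>m\<close> is the height of the extra edge vector over the ridge. This order is
  \<open>\<bar>m\<bar>\<close> times a number belonging to the ridge, so only the sign of
  \<open>m\<close> survives, and that sign is what pre-completeness balances.\<close>

definition euler_prod :: "complex \<Rightarrow> complex \<Rightarrow> complex" where
  "euler_prod q y = prodinf (\<lambda>m. 1 - y * q ^ Suc m)"

lemma convergent_euler_prod:
  fixes q y :: complex
  assumes "norm q < 1"
  shows "convergent_prod (\<lambda>m. 1 - y * q ^ Suc m)"
proof -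
  have "summable (\<lambda>m. norm (1 - y * q ^ Suc m - 1))"
    using assms by (auto simp: norm_mult norm_power intro!: summable_mult summable_geometric)
  then show ?thesis
    by (intro abs_convergent_prod_imp_convergent_prod summable_imp_abs_convergent_prod)
qed

lemma euler_prod_LIMSEQ:
  assumes "norm q < 1"
  shows "(\<lambda>n. \<Prod>m<n. 1 - y * q ^ Suc m) \<longlonglongrightarrow> euler_prod q y"
  using convergent_prod_LIMSEQ[OF convergent_euler_prod[OF assms, of y]]
  by (simp add: euler_prod_def LIMSEQ_lessThan_iff_atMost)

lemma euler_prod_shift:
  assumes "norm q < 1"
  shows "euler_prod q y = (1 - y * q) * euler_prod q (y * q)"
proof -
  have "(\<lambda>n. (1 - y * q) * (\<Prod>m<n. 1 - (y * q) * q ^ Suc m)) \<longlonglongrightarrow> (1 - y * q) * euler_prod q (y * q)"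
    by (intro tendsto_intros euler_prod_LIMSEQ assms)
  moreover have "(\<lambda>n. \<Prod>m<Suc n. 1 - y * q ^ Suc m) \<longlonglongrightarrow> euler_prod q y"
    using euler_prod_LIMSEQ[OF assms] by (rule LIMSEQ_Suc)
  moreover have "(\<Prod>m<Suc n. 1 - y * q ^ Suc m) = (1 - y * q) * (\<Prod>m<n. 1 - (y * q) * q ^ Suc m)" for n
    by (subst prod.lessThan_Suc_shift) (simp add: mult.assoc)
  ultimately show ?thesis
    by (simp add: LIMSEQ_unique)
qed

lemma euler_prod_eq_0_iff:
  assumes "norm q < 1"
  shows "euler_prod q y = 0 \<longleftrightarrow> (\<exists>m. y * q ^ Suc m = 1)"
  using has_prod_eq_0_iff[OF convergent_prod_has_prod[OF convergent_euler_prod[OF assms, of y]]]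
  by (simp only: euler_prod_def image_iff bex_UNIV eq_commute[of 0] right_minus_eq eq_commute[of 1])

text \<open>The partial products converge uniformly on every closed unit ball, by the M-test with
  majorant \<open>(norm x + 1) * norm q ^ Suc m\<close>.\<close>

lemma euler_prod_holomorphic:
  assumes "norm q < 1"
  shows "euler_prod q holomorphic_on UNIV"
proof (rule holomorphic_uniform_sequence)
  show "(\<lambda>y. \<Prod>m<n. 1 - y * q ^ Suc m) holomorphic_on UNIV" for n
    by (intro holomorphic_intros)
  fix x :: complex
  let ?X = "cball x 1"
  have "uniformly_convergent_on ?X (\<lambda>N y. \<Prod>m<N. 1 + (- y * q ^ Suc m))"
  proof (rule uniformly_convergent_on_prod)
    show "uniformly_convergent_on ?X (\<lambda>N y. \<Sum>m<N. norm (- y * q ^ Suc m))"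
    proof (rule Weierstrass_m_test'_ev[OF always_eventually])
      show "\<forall>m. \<forall>y\<in>?X. norm (norm (- y * q ^ Suc m)) \<le> (norm x + 1) * norm q ^ Suc m"
      proof (intro allI ballI)
        fix m y assume y: "y \<in> ?X"
        have "norm y \<le> norm x + 1"
          using y norm_triangle_ineq2[of y x] by (simp add: dist_norm norm_minus_commute)
        then show "norm (norm (- y * q ^ Suc m)) \<le> (norm x + 1) * norm q ^ Suc m"
          by (simp add: norm_mult norm_power mult_right_mono del: power_Suc)
      qed
      show "summable (\<lambda>m. (norm x + 1) * norm q ^ Suc m)"
        using assms by (auto intro!: summable_mult summable_geometric)
    qed
  qed (auto intro!: continuous_intros)
  then obtain l where l: "uniform_limit ?X (\<lambda>N y. \<Prod>m<N. 1 + (- y * q ^ Suc m)) l sequentially"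
    by (auto simp: uniformly_convergent_on_def)
  have "l y = euler_prod q y" if "y \<in> ?X" for y
    using LIMSEQ_unique[OF tendsto_uniform_limitI[OF l that]] euler_prod_LIMSEQ[OF assms, of y] by simp
  then have "uniform_limit ?X (\<lambda>N y. \<Prod>m<N. 1 - y * q ^ Suc m) (euler_prod q) sequentially"
    using l by (subst uniform_limit_cong'[of ?X _ "\<lambda>N y. \<Prod>m<N. 1 + (- y * q ^ Suc m)" _ l]) auto
  then show "\<exists>d>0. cball x d \<subseteq> UNIV \<and>
      uniform_limit (cball x d) (\<lambda>n y. \<Prod>m<n. 1 - y * q ^ Suc m) (euler_prod q) sequentially"
    by (intro exI[of _ 1]) auto
qed auto

text \<open>Jacobi's theta function in product form, without the factor \<open>t^(-1/2)\<close> and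
  without factors depending on \<open>q\<close> only. The latter cancel in a quotient, the former
  contributes the \<open>\<zeta>^(-1/2)\<close> of \<open>theta_quot\<close>.\<close>

definition theta :: "complex \<Rightarrow> complex \<Rightarrow> complex" where
  "theta q t = (1 - t) * euler_prod q t * euler_prod q (inverse t)"

text \<open>One factor moves across: \<open>euler_prod q t\<close> gives up
  \<open>1 - q * t\<close>, which is the new front factor, while the product in
  \<open>inverse t\<close> gains \<open>1 - inverse t\<close>, which is \<open>-1 / t\<close> times
  the old front factor.\<close>

lemma theta_q_shift:
  assumes "norm q < 1" "t \<noteq> 0" "q \<noteq> 0"
  shows "theta q (q * t) = - theta q t / t"
proof -
  have 1: "euler_prod q t = (1 - q * t) * euler_prod q (q * t)"
    using euler_prod_shift[OF assms(1), of t] by (simp only: mult.commute)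
  have 2: "euler_prod q (inverse (q * t)) = (1 - inverse t) * euler_prod q (inverse t)"
  proof -
    have "inverse (q * t) * q = inverse t" using assms by (simp add: field_simps)
    then show ?thesis using euler_prod_shift[OF assms(1), of "inverse (q * t)"] by (simp only:)
  qed
  have "theta q (q * t) = euler_prod q t * ((1 - inverse t) * euler_prod q (inverse t))"
    by (simp only: theta_def 1 2)
  also have "1 - inverse t = - ((1 - t) * inverse t)"
    using assms by (simp add: algebra_simps)
  finally have "theta q (q * t) = euler_prod q t * (- ((1 - t) * inverse t) * euler_prod q (inverse t))" .
  also have "\<dots> = - theta q t / t"
    by (simp add: theta_def divide_inverse mult_ac)
  finally show ?thesis .
qed

section \<open>The exponential \<open>cis2pi\<close>\<close>

lemma cis2pi_add: "cis2pi (x + y) = cis2pi x * cis2pi y"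
  by (simp add: cis2pi_def distrib_left exp_add)

lemma cis2pi_0 [simp]: "cis2pi 0 = 1"
  by (simp add: cis2pi_def)

lemma cis2pi_nonzero [simp]: "cis2pi x \<noteq> 0"
  by (simp add: cis2pi_def)

lemma cis2pi_minus: "cis2pi (- x) = inverse (cis2pi x)"
  by (simp add: cis2pi_def exp_minus)

lemma cis2pi_diff: "cis2pi (x - y) = cis2pi x / cis2pi y"
  by (simp add: cis2pi_def right_diff_distrib exp_diff)

lemma cis2pi_sum: "finite A \<Longrightarrow> cis2pi (sum f A) = (\<Prod>a\<in>A. cis2pi (f a))"
  by (induction A rule: finite_induct) (auto simp: cis2pi_add)

lemma cis2pi_of_int_mult: "cis2pi (of_int k * x) = cis2pi x powi k"
  by (simp add: cis2pi_def exp_power_int mult_ac)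

lemma cis2pi_of_nat_mult: "cis2pi (of_nat k * x) = cis2pi x ^ k"
  using cis2pi_of_int_mult[of "int k" x] by simp

lemma norm_cis2pi: "norm (cis2pi x) = exp (- 2 * pi * Im x)"
  by (simp add: cis2pi_def)

lemma norm_cis2pi_less_1: "Im \<tau> > 0 \<Longrightarrow> norm (cis2pi \<tau>) < 1"
  by (simp add: norm_cis2pi)

lemma cis2pi_eq_1_iff: "cis2pi x = 1 \<longleftrightarrow> (\<exists>k::int. x = of_int k)"
proof -
  have "cis2pi x = 1 \<longleftrightarrow> Im x = 0 \<and> (\<exists>k::int. Re x = of_int k)"
    unfolding cis2pi_def exp_eq_1 by simp
  also have "\<dots> \<longleftrightarrow> (\<exists>k::int. x = of_int k)"
    by (auto simp: complex_eq_iff)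
  finally show ?thesis .
qed

lemma cis2pi_of_int [simp]: "cis2pi (of_int k) = 1"
  by (auto simp: cis2pi_eq_1_iff)

lemma cis2pi_eq_iff: "cis2pi x = cis2pi y \<longleftrightarrow> (\<exists>k::int. x = y + of_int k)"
proof -
  have "cis2pi x = cis2pi y \<longleftrightarrow> cis2pi (x - y) = 1"
    by (simp add: cis2pi_diff)
  then show ?thesis
    by (simp add: cis2pi_eq_1_iff algebra_simps)
qed

lemma cis2pi_holomorphic [holomorphic_intros]:
  "f holomorphic_on A \<Longrightarrow> (\<lambda>x. cis2pi (f x)) holomorphic_on A"
  unfolding cis2pi_def by (intro holomorphic_intros)

lemma surj_cis2pi:
  assumes "w \<noteq> 0" obtains x where "cis2pi x = w"
proof
  show "cis2pi (Ln w / (2 * of_real pi * \<i>)) = w"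
    using assms by (simp add: cis2pi_def)
qed

section \<open>Zeros of theta and the transformation laws of the theta quotient\<close>

definition poles :: "complex \<Rightarrow> complex set" where
  "poles \<tau> = {of_int a + of_int b * \<tau> | a b :: int. True}"

lemma poles_iff: "z \<in> poles \<tau> \<longleftrightarrow> (\<exists>a b :: int. z = of_int a + of_int b * \<tau>)"
  by (auto simp: poles_def)

text \<open>The three factors of \<open>theta\<close> vanish at the points
  \<open>a + b \<tau>\<close> with \<open>b = 0\<close>, \<open>b < 0\<close> and
  \<open>b > 0\<close> respectively.\<close>

lemma theta_cis2pi_eq_0_iff:
  assumes "Im \<tau> > 0"
  shows "theta (cis2pi \<tau>) (cis2pi z) = 0 \<longleftrightarrow> z \<in> poles \<tau>"
proof -
  have q: "norm (cis2pi \<tau>) < 1" by (rule norm_cis2pi_less_1) fact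
  have 1: "cis2pi z = 1 \<longleftrightarrow> (\<exists>a::int. z = of_int a + of_int 0 * \<tau>)"
    by (simp add: cis2pi_eq_1_iff)
  have "cis2pi z * cis2pi \<tau> ^ Suc m = 1 \<longleftrightarrow> (\<exists>a::int. z = of_int a + of_int (- int (Suc m)) * \<tau>)" for m
  proof -
    have "cis2pi z * cis2pi \<tau> ^ Suc m = cis2pi (z + of_nat (Suc m) * \<tau>)"
      by (simp only: cis2pi_add cis2pi_of_nat_mult)
    then show ?thesis by (simp add: cis2pi_eq_1_iff algebra_simps)
  qed
  then have 2: "euler_prod (cis2pi \<tau>) (cis2pi z) = 0 \<longleftrightarrow> (\<exists>m. \<exists>a::int. z = of_int a + of_int (- int (Suc m)) * \<tau>)"
    by (simp only: euler_prod_eq_0_iff[OF q])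
  have "inverse (cis2pi z) * cis2pi \<tau> ^ Suc m = 1 \<longleftrightarrow> (\<exists>a::int. z = of_int a + of_int (int (Suc m)) * \<tau>)" for m
  proof -
    have "inverse (cis2pi z) * cis2pi \<tau> ^ Suc m = cis2pi (of_nat (Suc m) * \<tau> - z)"
      by (simp only: cis2pi_diff cis2pi_of_nat_mult) (simp add: field_simps)
    then have "inverse (cis2pi z) * cis2pi \<tau> ^ Suc m = 1 \<longleftrightarrow> (\<exists>a::int. of_nat (Suc m) * \<tau> - z = of_int a)"
      by (simp only: cis2pi_eq_1_iff)
    also have "\<dots> \<longleftrightarrow> (\<exists>a::int. z = of_int a + of_int (int (Suc m)) * \<tau>)"
    proof safe
      fix a :: int assume "of_nat (Suc m) * \<tau> - z = of_int a"
      then show "\<exists>a::int. z = of_int a + of_int (int (Suc m)) * \<tau>"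
        by (intro exI[of _ "-a"]) (auto simp: algebra_simps)
    next
      fix a :: int assume "z = of_int a + of_int (int (Suc m)) * \<tau>"
      then show "\<exists>b::int. of_nat (Suc m) * \<tau> - (of_int a + of_int (int (Suc m)) * \<tau>) = of_int b"
        by (intro exI[of _ "-a"]) (auto simp: algebra_simps)
    qed
    finally show ?thesis .
  qed
  then have 3: "euler_prod (cis2pi \<tau>) (inverse (cis2pi z)) = 0 \<longleftrightarrow> (\<exists>m. \<exists>a::int. z = of_int a + of_int (int (Suc m)) * \<tau>)"
    by (simp only: euler_prod_eq_0_iff[OF q])
  have "theta (cis2pi \<tau>) (cis2pi z) = 0 \<longleftrightarrow> (\<exists>a::int. z = of_int a + of_int 0 * \<tau>) \<or>
     (\<exists>m. \<exists>a::int. z = of_int a + of_int (- int (Suc m)) * \<tau>) \<or> (\<exists>m. \<exists>a::int. z = of_int a + of_int (int (Suc m)) * \<tau>)"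
    unfolding theta_def using 1 2 3 by auto
  also have "\<dots> \<longleftrightarrow> z \<in> poles \<tau>"
  proof
    assume "z \<in> poles \<tau>"
    then obtain a b :: int where ab: "z = of_int a + of_int b * \<tau>" by (auto simp: poles_iff)
    consider "b = 0" | m where "b = int (Suc m)" | m where "b = - int (Suc m)"
      by (metis Suc_pred int_cases3 of_nat_0_less_iff)
    then show "(\<exists>a::int. z = of_int a + of_int 0 * \<tau>) \<or>
     (\<exists>m. \<exists>a::int. z = of_int a + of_int (- int (Suc m)) * \<tau>) \<or> (\<exists>m. \<exists>a::int. z = of_int a + of_int (int (Suc m)) * \<tau>)"
      using ab by cases blast+
  qed (auto simp only: poles_iff)
  finally show ?thesis .
qed

lemma theta_cis2pi_holomorphic [holomorphic_intros]:
  assumes "Im \<tau> > 0" "f holomorphic_on A"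
  shows "(\<lambda>z. theta (cis2pi \<tau>) (cis2pi (f z))) holomorphic_on A"
proof -
  have "(euler_prod (cis2pi \<tau>) \<circ> (\<lambda>z. cis2pi (f z))) holomorphic_on A"
    "(euler_prod (cis2pi \<tau>) \<circ> (\<lambda>z. cis2pi (- f z))) holomorphic_on A"
    by (rule holomorphic_on_compose_gen[OF _ euler_prod_holomorphic];
        use assms norm_cis2pi_less_1 in \<open>auto intro!: holomorphic_intros\<close>)+
  then show ?thesis
    unfolding theta_def using assms by (auto intro!: holomorphic_intros simp: o_def cis2pi_minus)
qed

definition theta_quot :: "complex \<Rightarrow> complex \<Rightarrow> complex \<Rightarrow> complex" where
  "theta_quot \<tau> \<sigma> z = cis2pi (- \<sigma> / 2) * (theta (cis2pi \<tau>) (cis2pi (z + \<sigma>)) / theta (cis2pi \<tau>) (cis2pi z))"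

lemma phi_eq_theta_quot:
  assumes "Im \<tau> > 0"
  shows "phi z \<tau> \<sigma> = theta_quot \<tau> \<sigma> z"
proof -
  let ?q = "cis2pi \<tau>" and ?t = "cis2pi z" and ?\<zeta> = "cis2pi \<sigma>"
  have q: "norm ?q < 1" by (rule norm_cis2pi_less_1) fact
  note c = convergent_euler_prod[OF q]
  have "prodinf (\<lambda>m. ((1 - ?\<zeta> * ?t * ?q ^ Suc m) * (1 - inverse ?\<zeta> * inverse ?t * ?q ^ Suc m)) /
            ((1 - ?t * ?q ^ Suc m) * (1 - inverse ?t * ?q ^ Suc m))) =
     (euler_prod ?q (?\<zeta> * ?t) * euler_prod ?q (inverse ?\<zeta> * inverse ?t)) / (euler_prod ?q ?t * euler_prod ?q (inverse ?t))"
    unfolding euler_prod_def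
    by (simp only: prodinf_divide[symmetric] prodinf_mult[symmetric] convergent_prod_mult c)
  then show ?thesis
    by (simp add: phi_def Let_def theta_quot_def theta_def cis2pi_add mult_ac del: power_Suc)
qed

text \<open>Numerator and denominator acquire \<open>-1 / (\<zeta> t)\<close> and
  \<open>-1 / t\<close>; only \<open>1 / \<zeta>\<close> is left.\<close>

lemma theta_quot_shift:
  assumes "Im \<tau> > 0"
  shows "theta_quot \<tau> \<sigma> (z + \<tau>) = theta_quot \<tau> \<sigma> z / cis2pi \<sigma>"
proof -
  have *: "theta (cis2pi \<tau>) (cis2pi (w + \<tau>)) = - theta (cis2pi \<tau>) (cis2pi w) / cis2pi w" for w
    using theta_q_shift[of "cis2pi \<tau>" "cis2pi w"] assms
    by (simp add: cis2pi_add norm_cis2pi_less_1 mult.commute)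
  have "z + \<tau> + \<sigma> = z + \<sigma> + \<tau>" by simp
  then show ?thesis
    unfolding theta_quot_def by (simp only: *) (simp add: cis2pi_add divide_simps)
qed

lemma theta_quot_periodic: "theta_quot \<tau> \<sigma> (z + of_int a) = theta_quot \<tau> \<sigma> z"
  unfolding theta_quot_def by (simp add: cis2pi_add)

lemma theta_quot_shift_of_int:
  assumes "Im \<tau> > 0"
  shows "theta_quot \<tau> \<sigma> (z + of_int b * \<tau>) = theta_quot \<tau> \<sigma> z * cis2pi (- of_int b * \<sigma>)"
proof (induction b rule: int_induct[of _ 0])
  case (step1 i)
  have "z + of_int (i + 1) * \<tau> = (z + of_int i * \<tau>) + \<tau>" by (simp add: algebra_simps)
  then have "theta_quot \<tau> \<sigma> (z + of_int (i + 1) * \<tau>) = theta_quot \<tau> \<sigma> (z + of_int i * \<tau>) / cis2pi \<sigma>"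
    by (simp only: theta_quot_shift[OF assms])
  also have "\<dots> = theta_quot \<tau> \<sigma> z * (cis2pi (- of_int i * \<sigma>) / cis2pi \<sigma>)"
    using step1 by simp
  also have "cis2pi (- of_int i * \<sigma>) / cis2pi \<sigma> = cis2pi (- of_int (i + 1) * \<sigma>)"
    by (simp add: cis2pi_add[symmetric] cis2pi_minus[symmetric] divide_inverse distrib_right left_diff_distrib)
  finally show ?case .
next
  case (step2 i)
  have "z + of_int i * \<tau> = (z + of_int (i - 1) * \<tau>) + \<tau>" by (simp add: algebra_simps)
  then have "theta_quot \<tau> \<sigma> (z + of_int (i - 1) * \<tau>) = theta_quot \<tau> \<sigma> (z + of_int i * \<tau>) * cis2pi \<sigma>"
    by (simp only: theta_quot_shift[OF assms]) simp
  also have "\<dots> = theta_quot \<tau> \<sigma> z * (cis2pi (- of_int i * \<sigma>) * cis2pi \<sigma>)"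
    using step2 by simp
  also have "cis2pi (- of_int i * \<sigma>) * cis2pi \<sigma> = cis2pi (- of_int (i - 1) * \<sigma>)"
    by (simp add: cis2pi_add[symmetric] algebra_simps)
  finally show ?case .
qed auto

lemma theta_quot_analytic:
  assumes "Im \<tau> > 0" "f analytic_on {z}" "f z \<notin> poles \<tau>"
  shows "(\<lambda>x. theta_quot \<tau> \<sigma> (f x)) analytic_on {z}"
proof -
  have "(\<lambda>w. theta (cis2pi \<tau>) (cis2pi (w + s))) holomorphic_on UNIV" for s
    by (intro holomorphic_intros assms)
  then have th: "(\<lambda>w. theta (cis2pi \<tau>) (cis2pi (w + s))) analytic_on A" for s A
    using analytic_on_subset[of _ UNIV A] by (simp add: analytic_on_open)
  have "(\<lambda>w. theta_quot \<tau> \<sigma> w) analytic_on {f z}"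
    unfolding theta_quot_def
    using assms(1,3) th[of \<sigma>] th[of 0] by (intro analytic_intros) (auto simp: theta_cis2pi_eq_0_iff)
  then show ?thesis
    using analytic_on_compose[OF assms(2), of "theta_quot \<tau> \<sigma>"] by (simp add: o_def)
qed

lemma theta_quot_meromorphic:
  assumes "Im \<tau> > 0" "f holomorphic_on UNIV"
  shows "(\<lambda>x. theta_quot \<tau> \<sigma> (f x)) meromorphic_on UNIV"
  unfolding theta_quot_def
  by (intro meromorphic_intros analytic_on_imp_meromorphic_on)
     (auto simp: analytic_on_open intro!: holomorphic_intros assms)

text \<open>Only the numerator and the exponential depend on \<open>\<sigma>\<close>, so
  \<open>z\<close> may be arbitrary: where the denominator is zero, the function of
  \<open>\<sigma>\<close> is constantly 0 by the convention for division.\<close>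

lemma isCont_theta_quot_param:
  assumes "Im \<tau> > 0"
  shows "isCont (\<lambda>\<sigma>. theta_quot \<tau> \<sigma> z) \<sigma>"
proof -
  have "(\<lambda>\<sigma>. theta_quot \<tau> \<sigma> z) holomorphic_on UNIV"
    unfolding theta_quot_def divide_inverse by (intro holomorphic_intros assms)
  then show ?thesis
    by (meson UNIV_I continuous_on_eq_continuous_at holomorphic_on_imp_continuous_on open_UNIV)
qed

text \<open>Near 0 the denominator is \<open>(1 - cis2pi s) * E s\<close> with
  \<open>E 0 \<noteq> 0\<close>, so its zero is simple. The value of the residue is left open: it
  suffices that the same number serves every facet.\<close>

lemma theta_quot_residue:
  assumes "Im \<tau> > 0"
  shows "\<exists>R. ((\<lambda>s. s * theta_quot \<tau> \<sigma> s) \<longlongrightarrow> R) (at 0)"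
proof -
  define g where "g s = theta (cis2pi \<tau>) (cis2pi s)" for s
  define E where "E s = euler_prod (cis2pi \<tau>) (cis2pi s) * euler_prod (cis2pi \<tau>) (inverse (cis2pi s))" for s
  have q: "norm (cis2pi \<tau>) < 1" by (rule norm_cis2pi_less_1) fact
  have "(euler_prod (cis2pi \<tau>) \<circ> (\<lambda>z. cis2pi z)) holomorphic_on UNIV"
    "(euler_prod (cis2pi \<tau>) \<circ> (\<lambda>z. cis2pi (- z))) holomorphic_on UNIV"
    by (rule holomorphic_on_compose_gen[OF _ euler_prod_holomorphic];
        use q in \<open>auto intro!: holomorphic_intros\<close>)+
  then have "E holomorphic_on UNIV"
    unfolding E_def by (auto intro!: holomorphic_intros simp: o_def cis2pi_minus)
  then have E: "isCont E 0"
    by (meson UNIV_I continuous_on_eq_continuous_at holomorphic_on_imp_continuous_on open_UNIV)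
  have E0: "E 0 \<noteq> 0"
  proof -
    have "norm (cis2pi \<tau> ^ Suc m) < 1" for m
      using power_Suc_less_one[of "norm (cis2pi \<tau>)" m] q by (simp add: norm_power del: power_Suc)
    then have "cis2pi \<tau> ^ Suc m \<noteq> 1" for m
      by (metis less_irrefl norm_one)
    then show ?thesis
      by (simp add: E_def euler_prod_eq_0_iff[OF q] del: power_Suc)
  qed
  have "(cis2pi has_field_derivative (2 * of_real pi * \<i>)) (at 0)"
    unfolding cis2pi_def by (auto intro!: derivative_eq_intros)
  then have "((\<lambda>s. (cis2pi s - 1) / s) \<longlongrightarrow> 2 * of_real pi * \<i>) (at 0)"
    by (simp add: has_field_derivative_iff)
  then have D: "((\<lambda>s. - inverse ((cis2pi s - 1) / s)) \<longlongrightarrow> - inverse (2 * of_real pi * \<i>)) (at 0)"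
    by (intro tendsto_intros) auto
  have "(\<lambda>s. cis2pi (- \<sigma> / 2) * theta (cis2pi \<tau>) (cis2pi (s + \<sigma>))) holomorphic_on UNIV"
    by (intro holomorphic_intros assms)
  then have "isCont (\<lambda>s. cis2pi (- \<sigma> / 2) * theta (cis2pi \<tau>) (cis2pi (s + \<sigma>))) 0"
    by (meson UNIV_I continuous_on_eq_continuous_at holomorphic_on_imp_continuous_on open_UNIV)
  then have "((\<lambda>s. (- inverse ((cis2pi s - 1) / s)) * ((cis2pi (- \<sigma> / 2) * theta (cis2pi \<tau>) (cis2pi (s + \<sigma>))) / E s))
      \<longlongrightarrow> - inverse (2 * of_real pi * \<i>) * ((cis2pi (- \<sigma> / 2) * theta (cis2pi \<tau>) (cis2pi (0 + \<sigma>))) / E 0)) (at 0)"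
    using E E0 D by (intro tendsto_mult tendsto_divide) (auto simp: isCont_def)
  moreover have "(- inverse ((cis2pi s - 1) / s)) * ((cis2pi (- \<sigma> / 2) * theta (cis2pi \<tau>) (cis2pi (s + \<sigma>))) / E s) = s * theta_quot \<tau> \<sigma> s" for s
  proof -
    have "theta (cis2pi \<tau>) (cis2pi s) = (1 - cis2pi s) * E s"
      by (simp add: theta_def E_def)
    moreover have "- inverse ((cis2pi s - 1) / s) = s / (1 - cis2pi s)"
      using minus_divide_right[of s "cis2pi s - 1"] by (simp add: inverse_divide)
    ultimately show ?thesis
      unfolding theta_quot_def by simp
  qed
  ultimately show ?thesis by (simp only: fun_eq_iff) blast
qed

section \<open>Quasi-periodic functions without poles\<close>

lemma decompose_over_tau:
  assumes "Im \<tau> > 0"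
  obtains s t :: real where "z = of_real s + of_real t * \<tau>"
proof
  show "z = of_real (Re z - Im z / Im \<tau> * Re \<tau>) + of_real (Im z / Im \<tau>) * \<tau>"
    using assms by (simp add: complex_eq_iff)
qed

text \<open>Every point is moved by periods into the compact parallelogram spanned by 1 and
  \<open>\<tau>\<close>.\<close>

lemma norm_periodic_bounded:
  fixes h :: "complex \<Rightarrow> complex"
  assumes "Im \<tau> > 0" "continuous_on UNIV h"
    and 1: "\<And>z. norm (h (z + 1)) = norm (h z)" and 2: "\<And>z. norm (h (z + \<tau>)) = norm (h z)"
  shows "bounded (range h)"
proof -
  have shift1: "norm (h (z + of_int k)) = norm (h z)" for z k
  proof (induction k rule: int_induct[of _ 0])
    case (step1 i) then show ?case using 1[of "z + of_int i"] by (simp add: add.assoc)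
  next
    case (step2 i) then show ?case using 1[of "z + of_int (i - 1)"] by simp
  qed auto
  have shift\<tau>: "norm (h (z + of_int k * \<tau>)) = norm (h z)" for z k
  proof (induction k rule: int_induct[of _ 0])
    case (step1 i) then show ?case using 2[of "z + of_int i * \<tau>"] by (simp add: algebra_simps)
  next
    case (step2 i) then show ?case using 2[of "z + of_int (i - 1) * \<tau>"] by (simp add: algebra_simps)
  qed auto
  define Q where "Q = (\<lambda>(s::real,t::real). of_real s + of_real t * \<tau>) ` ({0..1} \<times> {0..1})"
  have "compact Q"
    unfolding Q_def by (intro compact_continuous_image compact_Times)
      (auto intro!: continuous_intros simp: case_prod_unfold)
  then have "bounded (h ` Q)"
    by (intro compact_imp_bounded compact_continuous_image continuous_on_subset[OF assms(2)]) auto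
  then obtain M where M: "\<And>x. x \<in> Q \<Longrightarrow> norm (h x) \<le> M"
    by (auto simp: bounded_iff)
  have "norm (h z) \<le> M" for z
  proof -
    obtain s t :: real where z: "z = of_real s + of_real t * \<tau>"
      using decompose_over_tau[OF assms(1)] .
    have "z = (of_real (frac s) + of_real (frac t) * \<tau>) + of_int \<lfloor>t\<rfloor> * \<tau> + of_int \<lfloor>s\<rfloor>"
      unfolding z frac_def by (simp add: algebra_simps)
    then have "norm (h z) = norm (h (of_real (frac s) + of_real (frac t) * \<tau>))"
      by (metis shift1 shift\<tau>)
    moreover have "of_real (frac s) + of_real (frac t) * \<tau> \<in> Q"
      unfolding Q_def using frac_ge_0 frac_lt_1 less_imp_le
      by (intro image_eqI[of _ _ "(frac s, frac t)"]) auto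
    ultimately show ?thesis using M by simp
  qed
  then show ?thesis by (auto simp: bounded_iff)
qed

lemma removable_singularity_limit:
  fixes f :: "complex \<Rightarrow> complex"
  assumes "isolated_singularity_at f p" "((\<lambda>z. (z - p) * f z) \<longlongrightarrow> 0) (at p)"
  shows "\<exists>c. f \<midarrow>p\<rightarrow> c"
proof -
  obtain A where A: "open A" "p \<in> A" "f holomorphic_on (A - {p})"
    using assms(1) analytic_imp_holomorphic isolated_singularity_at_iff_analytic_nhd by auto
  obtain g where g: "g holomorphic_on A" "\<And>z. z \<in> A - {p} \<Longrightarrow> g z = f z"
    using holomorphic_on_extend_lim[OF A(3)] A assms(2) by (auto simp: interior_open)
  have "isCont g p"
    using A g(1) continuous_on_eq_continuous_at holomorphic_on_imp_continuous_on by blast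
  moreover have "eventually (\<lambda>z. g z = f z) (at p)"
    using eventually_at_in_open[OF A(1,2)] by eventually_elim (use g(2) in auto)
  ultimately show ?thesis
    by (auto simp: isCont_def tendsto_cong)
qed

text \<open>An exponential factor makes both multipliers unimodular, so Liouville applies. The
  resulting constant is fixed by a multiplier different from 1 and must be 0.\<close>

lemma quasi_periodic_eq_0:
  fixes f :: "complex \<Rightarrow> complex" and N :: real
  assumes \<tau>: "Im \<tau> > 0" and mero: "f meromorphic_on UNIV"
    and no_pole: "\<And>p. ((\<lambda>z. (z - p) * f z) \<longlongrightarrow> 0) (at p)"
    and per1: "\<And>z. f (z + 1) = f z"
    and per\<tau>: "\<And>z. f (z + \<tau>) = cis2pi (of_real N * \<sigma>) * f z"
    and nonint: "N * Im \<sigma> / Im \<tau> \<notin> \<int>" and cont: "isCont f x"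
  shows "f x = 0"
proof -
  \<comment> \<open>The hypothesis controls \<open>f\<close> only near a point, its value there may
    be arbitrary; \<open>g\<close> is the entire function with the same limits.\<close>
  define g where "g = remove_sings f"
  have iso: "isolated_singularity_at f p" for p
    using meromorphic_on_isolated_singularity[OF meromorphic_on_subset[OF mero]] by simp
  have lim: "\<exists>c. f \<midarrow>p\<rightarrow> c" for p
    by (rule removable_singularity_limit[OF iso no_pole])
  have fg: "f \<midarrow>p\<rightarrow> g p" for p
    using lim[of p] remove_sings_eqI unfolding g_def by metis
  have "g analytic_on {p}" for p
    using lim[of p] iso remove_sings_analytic_at unfolding g_def by blast
  then have hol: "g holomorphic_on UNIV"
    by (meson UNIV_I analytic_imp_holomorphic analytic_on_analytic_at)
  have g1: "g (z + 1) = g z" for z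
  proof (rule LIM_unique)
    show "f \<midarrow>z\<rightarrow> g z" by (rule fg)
    show "f \<midarrow>z\<rightarrow> g (z + 1)"
      using LIM_offset[OF fg[of "z + 1"], of 1] by (simp add: per1)
  qed
  have g\<tau>: "g (z + \<tau>) = cis2pi (of_real N * \<sigma>) * g z" for z
  proof (rule LIM_unique)
    show "(\<lambda>w. cis2pi (of_real N * \<sigma>) * f w) \<midarrow>z\<rightarrow> cis2pi (of_real N * \<sigma>) * g z"
      by (intro tendsto_intros fg)
    show "(\<lambda>w. cis2pi (of_real N * \<sigma>) * f w) \<midarrow>z\<rightarrow> g (z + \<tau>)"
      using LIM_offset[OF fg[of "z + \<tau>"], of \<tau>] by (simp add: per\<tau>)
  qed
  \<comment> \<open>This real \<open>b\<close> solves
    \<open>N * Im \<sigma> + b * Im \<tau> = 0\<close>, which gives the multiplier under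
    \<open>\<tau>\<close> norm 1. Being real, \<open>b\<close> also gives a unimodular multiplier
    under 1, and \<open>nonint\<close> makes the latter different from 1.\<close>
  define b where "b = - (N * Im \<sigma> / Im \<tau>)"
  define h where "h z = g z * cis2pi (of_real b * z)" for z
  have hhol: "h holomorphic_on UNIV"
    unfolding h_def by (intro holomorphic_intros hol)
  have h1: "h (z + 1) = h z * cis2pi (of_real b)" for z
    by (simp add: h_def g1 cis2pi_add distrib_left)
  have h\<tau>: "h (z + \<tau>) = h z * (cis2pi (of_real N * \<sigma>) * cis2pi (of_real b * \<tau>))" for z
    by (simp add: h_def g\<tau> cis2pi_add distrib_left)
  have bN: "b * Im \<tau> = - (N * Im \<sigma>)"
    using \<tau> by (simp add: b_def)
  have "norm (cis2pi (of_real N * \<sigma>) * cis2pi (of_real b * \<tau>)) = exp (- 2 * pi * (N * Im \<sigma> + b * Im \<tau>))"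
    by (simp add: norm_mult norm_cis2pi mult_exp_exp algebra_simps)
  then have "norm (cis2pi (of_real N * \<sigma>) * cis2pi (of_real b * \<tau>)) = 1"
    by (simp add: bN)
  then have "bounded (range h)"
    using \<tau> hhol by (intro norm_periodic_bounded[of \<tau>])
      (auto simp: h1 h\<tau> norm_mult norm_cis2pi intro: holomorphic_on_imp_continuous_on)
  then obtain C where C: "\<And>z. h z = C"
    using Liouville_theorem[OF hhol] by (auto simp: constant_on_def)
  have "cis2pi (of_real b) \<noteq> 1"
  proof
    assume "cis2pi (of_real b) = 1"
    then obtain k :: int where "complex_of_real b = of_int k"
      by (auto simp: cis2pi_eq_1_iff)
    then have "b = of_int k" by (metis of_real_eq_iff of_real_of_int_eq)
    then have "b \<in> \<int>" by simp
    then show False using nonint by (simp add: b_def)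
  qed
  moreover have "C = C * cis2pi (of_real b)"
    using h1[of 0] C by simp
  ultimately have "C = 0" by simp
  then have "g x = 0" using C[of x] by (simp add: h_def)
  moreover have "f x = g x"
    using cont fg[of x] LIM_unique unfolding isCont_def by blast
  ultimately show ?thesis by simp
qed

section \<open>Avoiding finitely many subspaces\<close>

text \<open>Induction on the number of subspaces. If \<open>v\<close> avoids the old ones but lies
  in the new \<open>S\<close>, take \<open>w\<close> in \<open>A\<close> outside \<open>S\<close>:
  no \<open>w + t v\<close> lies in \<open>S\<close>, and each old subspace contains at most one of
  these points. Only sums are used, so \<open>A\<close> may be a lattice.\<close>

lemma exists_avoiding_subspaces:
  fixes A :: "'v::real_vector set"
  assumes "finite \<S>" and "\<And>S. S \<in> \<S> \<Longrightarrow> subspace S \<and> \<not> A \<subseteq> S"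
    and "0 \<in> A" and add: "\<And>x y. x \<in> A \<Longrightarrow> y \<in> A \<Longrightarrow> x + y \<in> A"
  shows "\<exists>v\<in>A. \<forall>S\<in>\<S>. v \<notin> S"
  using assms(1,2)
proof (induction \<S> rule: finite_induct)
  case empty
  then show ?case using assms(3) by auto
next
  case (insert S \<S>)
  then obtain v where v: "v \<in> A" "\<forall>S\<in>\<S>. v \<notin> S" by blast
  show ?case
  proof (cases "v \<in> S")
    case True
    obtain w where w: "w \<in> A" "w \<notin> S" using insert.prems by blast
    define B where "B T = {t::nat. w + of_nat t *\<^sub>R v \<in> T}" for T
    have multiple: "of_nat t *\<^sub>R v \<in> A" for t :: nat
      by (induction t) (auto simp: assms(3) scaleR_left_distrib intro: add v)
    have "finite (B T)" if "T \<in> \<S>" for T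
    proof -
      have T: "subspace T" using insert.prems that by blast
      have "s = t" if "s \<in> B T" "t \<in> B T" for s t
      proof (rule ccontr)
        assume "s \<noteq> t"
        have "(w + of_nat s *\<^sub>R v) - (w + of_nat t *\<^sub>R v) \<in> T"
          using that subspace_diff[OF T, of "w + of_nat s *\<^sub>R v" "w + of_nat t *\<^sub>R v"] by (simp add: B_def)
        then have "(real s - real t) *\<^sub>R v \<in> T"
          by (simp add: algebra_simps)
        then have "inverse (real s - real t) *\<^sub>R ((real s - real t) *\<^sub>R v) \<in> T"
          by (rule subspace_scale[OF T])
        then show False using \<open>s \<noteq> t\<close> v(2) \<open>T \<in> \<S>\<close> by simp
      qed
      then have "B T \<subseteq> {SOME t. t \<in> B T}" by (metis someI subsetI singletonI)
      then show ?thesis by (rule finite_subset) simp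
    qed
    then have "finite (\<Union>T\<in>\<S>. B T)" using insert.hyps by blast
    then obtain t where t: "t \<notin> (\<Union>T\<in>\<S>. B T)"
      using ex_new_if_finite[OF infinite_UNIV_nat] by blast
    have "w + of_nat t *\<^sub>R v \<notin> S"
    proof
      assume "w + of_nat t *\<^sub>R v \<in> S"
      moreover have "of_nat t *\<^sub>R v \<in> S" using True insert.prems by (auto intro: subspace_scale)
      ultimately have "w + of_nat t *\<^sub>R v - of_nat t *\<^sub>R v \<in> S"
        using insert.prems by (blast intro: subspace_diff)
      then show False using w by simp
    qed
    moreover have "w + of_nat t *\<^sub>R v \<in> A" using add w multiple by blast
    ultimately show ?thesis using t by (auto simp: B_def)
  qed (use v in auto)
qed

section \<open>Lattices and their cosets\<close>

lemma int_span_0: "0 \<in> int_span B"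
  unfolding int_span_def by (rule image_eqI[of _ _ "\<lambda>_. 0"]) auto

lemma int_span_add: "x \<in> int_span B \<Longrightarrow> y \<in> int_span B \<Longrightarrow> x + y \<in> int_span B"
proof -
  assume "x \<in> int_span B" "y \<in> int_span B"
  then obtain c d where "x = (\<Sum>b\<in>B. of_int (c b) *\<^sub>R b)" "y = (\<Sum>b\<in>B. of_int (d b) *\<^sub>R b)"
    by (auto simp: int_span_def)
  then show ?thesis
    unfolding int_span_def
    by (intro image_eqI[of _ _ "\<lambda>b. c b + d b"]) (auto simp: scaleR_left_distrib sum.distrib)
qed

lemma int_span_scale: "x \<in> int_span B \<Longrightarrow> of_int k *\<^sub>R x \<in> int_span B"
proof -
  assume "x \<in> int_span B"
  then obtain c where "x = (\<Sum>b\<in>B. of_int (c b) *\<^sub>R b)"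
    by (auto simp: int_span_def)
  then show ?thesis
    unfolding int_span_def
    by (intro image_eqI[of _ _ "\<lambda>b. k * c b"]) (auto simp: scaleR_sum_right)
qed

lemma int_span_minus: "x \<in> int_span B \<Longrightarrow> - x \<in> int_span B"
  using int_span_scale[of x B "-1"] by simp

lemma int_span_diff: "x \<in> int_span B \<Longrightarrow> y \<in> int_span B \<Longrightarrow> x - y \<in> int_span B"
  using int_span_add[of x B "-y"] int_span_minus[of y B] by simp

lemma int_span_subset_span: "int_span B \<subseteq> span B"
  unfolding int_span_def by (safe, intro span_sum span_scale span_base)

lemma int_span_base: "finite B \<Longrightarrow> b \<in> B \<Longrightarrow> b \<in> int_span B"
  unfolding int_span_def
  by (rule image_eqI[of _ _ "\<lambda>x. if x = b then 1 else 0"]) (auto simp: if_distrib[of of_int] if_distrib[of "\<lambda>c. c *\<^sub>R _"] cong: if_cong)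

lemma int_span_image:
  assumes "inj_on f I"
  shows "int_span (f ` I) = range (\<lambda>c. \<Sum>i\<in>I. of_int (c i) *\<^sub>R f i)"
proof (intro equalityI subsetI)
  fix x assume "x \<in> int_span (f ` I)"
  then obtain c where "x = (\<Sum>b\<in>f ` I. of_int (c b) *\<^sub>R b)" by (auto simp: int_span_def)
  then have "x = (\<Sum>i\<in>I. of_int ((c \<circ> f) i) *\<^sub>R f i)"
    using assms by (simp add: sum.reindex)
  then show "x \<in> range (\<lambda>c. \<Sum>i\<in>I. of_int (c i) *\<^sub>R f i)" by blast
next
  fix x assume "x \<in> range (\<lambda>c. \<Sum>i\<in>I. of_int (c i) *\<^sub>R f i)"
  then obtain c where "x = (\<Sum>i\<in>I. of_int (c i) *\<^sub>R f i)" by blast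
  also have "\<dots> = (\<Sum>i\<in>I. of_int (c (the_inv_into I f (f i))) *\<^sub>R f i)"
    using assms by (intro sum.cong) (auto simp: the_inv_into_f_f)
  also have "\<dots> = (\<Sum>b\<in>f ` I. of_int (c (the_inv_into I f b)) *\<^sub>R b)"
    using assms by (simp add: sum.reindex)
  finally show "x \<in> int_span (f ` I)" by (auto simp: int_span_def)
qed

text \<open>Each coordinate extends to a linear functional on the whole space and is therefore
  bounded by a multiple of the norm, which leaves finitely many integer coordinate vectors.\<close>

lemma finite_int_span_bounded:
  fixes B :: "'v::euclidean_space set"
  assumes "finite B" "independent B"
  shows "finite {x \<in> int_span B. norm x \<le> r}"
proof -
  have "\<exists>K. \<forall>x \<in> int_span B. norm x \<le> r \<longrightarrow> \<bar>representation B x b\<bar> \<le> K" if b: "b \<in> B" for b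
  proof -
    obtain g :: "'v \<Rightarrow> real" where g: "linear g" "\<forall>x\<in>B. g x = (if x = b then 1 else 0)"
      using linear_independent_extend[OF assms(2), of "\<lambda>x. if x = b then 1 else 0"] by blast
    obtain K where K: "\<And>x. \<bar>g x\<bar> \<le> K * norm x" "K > 0"
      using linear_bounded_pos[OF g(1)] by auto
    have "representation B x b = g x" if "x \<in> int_span B" for x
    proof -
      have x: "x \<in> span B" using that int_span_subset_span by blast
      have "x = (\<Sum>c\<in>B. representation B x c *\<^sub>R c)"
        using sum_representation_eq[OF assms(2) x assms(1)] by simp
      then have "g x = g (\<Sum>c\<in>B. representation B x c *\<^sub>R c)"
        by (rule arg_cong)
      also have "\<dots> = (\<Sum>c\<in>B. representation B x c * g c)"
        by (simp add: linear_sum[OF g(1)] linear_scale[OF g(1)])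
      also have "\<dots> = (\<Sum>c\<in>B. if c = b then representation B x c else 0)"
        using g(2) by (intro sum.cong) auto
      finally show ?thesis using b assms(1) by simp
    qed
    then have "\<bar>representation B x b\<bar> \<le> K * r" if "x \<in> int_span B" "norm x \<le> r" for x
      using K that by (metis less_imp_le mult_left_mono order_trans)
    then show ?thesis by blast
  qed
  then obtain K where K: "\<And>b x. b \<in> B \<Longrightarrow> x \<in> int_span B \<Longrightarrow> norm x \<le> r \<Longrightarrow> \<bar>representation B x b\<bar> \<le> K b"
    by metis
  define F where "F = PiE B (\<lambda>b. {- \<lceil>K b\<rceil> .. \<lceil>K b\<rceil>})"
  have "finite F" unfolding F_def using assms(1) by (intro finite_PiE) auto
  moreover have "{x \<in> int_span B. norm x \<le> r} \<subseteq> (\<lambda>c. \<Sum>b\<in>B. of_int (c b) *\<^sub>R b) ` F"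
  proof safe
    fix x assume x: "x \<in> int_span B" "norm x \<le> r"
    then obtain c where c: "x = (\<Sum>b\<in>B. of_int (c b) *\<^sub>R b)" by (auto simp: int_span_def)
    have "representation B x b = of_int (c b)" if "b \<in> B" for b
    proof -
      have "representation B x b = (\<Sum>d\<in>B. of_int (c d) * representation B d b)"
        unfolding c using assms by (subst representation_sum) (auto simp: representation_scale span_base intro!: span_scale)
      also have "\<dots> = (\<Sum>d\<in>B. if d = b then of_int (c d) else 0)"
        using assms by (intro sum.cong) (auto simp: representation_basis)
      finally show ?thesis using that assms(1) by simp
    qed
    then have "real_of_int (c b) \<le> K b" "real_of_int (- c b) \<le> K b" if "b \<in> B" for b
      using K[OF that x] that by (auto simp: abs_le_iff)
    then have "c b \<le> \<lceil>K b\<rceil>" "- c b \<le> \<lceil>K b\<rceil>" if "b \<in> B" for b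
      using that by (metis ceiling_mono ceiling_of_int)+
    then have "restrict c B \<in> F"
      unfolding F_def by (fastforce simp: minus_le_iff)
    moreover have "x = (\<Sum>b\<in>B. of_int (restrict c B b) *\<^sub>R b)"
      unfolding c by (intro sum.cong) auto
    ultimately show "x \<in> (\<lambda>c. \<Sum>b\<in>B. of_int (c b) *\<^sub>R b) ` F" by blast
  qed
  ultimately show ?thesis by (rule finite_surj)
qed

definition coset :: "'v::ab_group_add set \<Rightarrow> 'v \<Rightarrow> 'v set" where
  "coset A x = (\<lambda>l. x + l) ` A"

lemma mem_coset: "y \<in> coset A x \<longleftrightarrow> y - x \<in> A"
  unfolding coset_def by (auto simp: image_iff intro!: bexI[of _ "y - x"])

lemma coset_int_span_eq: "coset (int_span B) x = coset (int_span B) y \<longleftrightarrow> x - y \<in> int_span B"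
proof
  assume "coset (int_span B) x = coset (int_span B) y"
  moreover have "x \<in> coset (int_span B) x" by (simp add: mem_coset int_span_0)
  ultimately show "x - y \<in> int_span B" by (simp add: mem_coset)
next
  assume *: "x - y \<in> int_span B"
  have "z - x \<in> int_span B \<longleftrightarrow> z - y \<in> int_span B" for z
    using int_span_add[OF _ *, of "z - x"] int_span_diff[OF _ *, of "z - y"] by auto
  then show "coset (int_span B) x = coset (int_span B) y"
    by (simp only: set_eq_iff mem_coset simp_thms)
qed

lemma rep_coset: "rep (coset (int_span B) x) - x \<in> int_span B"
proof -
  have "\<exists>y. y \<in> coset (int_span B) x"
    by (intro exI[of _ x]) (simp add: mem_coset int_span_0)
  then show ?thesis
    unfolding rep_def mem_coset[symmetric] by (rule someI_ex)
qed

lemma coset_rep: "coset (int_span B) (rep (coset (int_span B) x)) = coset (int_span B) x"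
  using rep_coset coset_int_span_eq by blast

section \<open>Facets and dual bases\<close>

lemma span_convex_cone_hull: "span (convex_cone hull S) = span (S :: 'v::euclidean_space set)"
proof
  have "convex_cone hull S \<subseteq> span S"
    by (intro hull_minimal span_superset subspace_imp_convex_cone subspace_span)
  then show "span (convex_cone hull S) \<subseteq> span S"
    by (simp add: span_minimal)
  show "span S \<subseteq> span (convex_cone hull S)"
    by (intro span_mono hull_subset)
qed

locale simplicial_multifan_with_edges =
  fixes \<Delta> :: "('i, 'v::euclidean_space) multifan" and V :: "'i \<Rightarrow> 'v"
  assumes multifan: "simplicial_multifan \<Delta>" and edges: "edge_vectors \<Delta> V"
begin

abbreviation "L \<equiv> lat \<Delta>"
abbreviation "U \<equiv> dual_basis V"
abbreviation "LI \<equiv> lat_I V"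

lemma lattice_basis: obtains B where "finite B" "independent B" "L = int_span B"
  using multifan by (auto simp: simplicial_multifan_def is_lattice_def)

lemma L_0: "0 \<in> L"
  using lattice_basis int_span_0 by metis

lemma L_add: "x \<in> L \<Longrightarrow> y \<in> L \<Longrightarrow> x + y \<in> L"
  using lattice_basis int_span_add by metis

lemma L_diff: "x \<in> L \<Longrightarrow> y \<in> L \<Longrightarrow> x - y \<in> L"
  using lattice_basis int_span_diff by metis

lemma L_minus: "x \<in> L \<Longrightarrow> - x \<in> L"
  using lattice_basis int_span_minus by metis

lemma L_scale: "x \<in> L \<Longrightarrow> of_int k *\<^sub>R x \<in> L"
  using lattice_basis int_span_scale by metis

lemma L_sum: "(\<And>i. i \<in> I \<Longrightarrow> f i \<in> L) \<Longrightarrow> sum f I \<in> L"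
  by (induction I rule: infinite_finite_induct) (auto simp: L_0 L_add)

lemma finite_L_bounded: "finite {x \<in> L. norm x \<le> r}"
  using lattice_basis finite_int_span_bounded by metis

lemma Inter_simplices: "\<Inter>(simplices \<Delta>) = {}"
  using multifan by (auto simp: simplicial_multifan_def)

lemma facets_iff: "I \<in> facets \<Delta> \<longleftrightarrow> I \<in> simplices \<Delta> \<and> card I = mf_rank \<Delta>"
  by (auto simp: facets_def layer_def Inter_simplices)

lemma vertices_iff: "i \<in> vertices \<Delta> \<longleftrightarrow> {i} \<in> simplices \<Delta>"
  by (auto simp: vertices_def layer_def Inter_simplices)

lemma finite_simplices: "finite (simplices \<Delta>)"
  using multifan by (auto simp: simplicial_multifan_def)

lemma finite_facets: "finite (facets \<Delta>)"
  using finite_simplices by (rule rev_finite_subset) (auto simp: facets_iff)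

lemma facets_nonempty: "facets \<Delta> \<noteq> {}"
  using multifan by (auto simp: simplicial_multifan_def)

lemma simplex_subset: "I \<in> simplices \<Delta> \<Longrightarrow> J \<subseteq> I \<Longrightarrow> J \<in> simplices \<Delta>"
  using multifan by (auto simp: simplicial_multifan_def)

lemma finite_simplex: "I \<in> simplices \<Delta> \<Longrightarrow> finite I"
  using multifan by (auto simp: simplicial_multifan_def)

lemma finite_facet: "I \<in> facets \<Delta> \<Longrightarrow> finite I"
  by (simp add: facets_iff finite_simplex)

lemma simplex_vertices: "I \<in> simplices \<Delta> \<Longrightarrow> i \<in> I \<Longrightarrow> i \<in> vertices \<Delta>"
  by (auto simp: vertices_iff intro: simplex_subset)

lemma finite_vertices: "finite (vertices \<Delta>)"
proof -
  have "(\<lambda>i. {i}) ` vertices \<Delta> \<subseteq> simplices \<Delta>" by (auto simp: vertices_iff)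
  then have "finite ((\<lambda>i. {i}) ` vertices \<Delta>)" using finite_simplices finite_subset by blast
  then show ?thesis by (rule finite_imageD) auto
qed

lemma V_in_L: "i \<in> vertices \<Delta> \<Longrightarrow> V i \<in> L"
  using edges by (auto simp: edge_vectors_def)

lemma V_facet_in_L: "I \<in> facets \<Delta> \<Longrightarrow> i \<in> I \<Longrightarrow> V i \<in> L"
  by (intro V_in_L simplex_vertices) (auto simp: facets_iff)

lemma cone_ray: "i \<in> vertices \<Delta> \<Longrightarrow> cone_of \<Delta> {i} = {c *\<^sub>R V i | c. 0 \<le> c}"
  using edges by (auto simp: edge_vectors_def)

lemma cone_hull:
  assumes "I \<in> simplices \<Delta>"
  shows "cone_of \<Delta> I = convex_cone hull (\<Union>i\<in>I. {c *\<^sub>R V i | c. 0 \<le> c})"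
proof -
  have "cone_of \<Delta> I = convex_cone hull (\<Union>i\<in>I. cone_of \<Delta> {i})"
    using assms multifan by (auto simp: simplicial_multifan_def)
  also have "(\<Union>i\<in>I. cone_of \<Delta> {i}) = (\<Union>i\<in>I. {c *\<^sub>R V i | c. 0 \<le> c})"
    using assms by (intro SUP_cong refl cone_ray simplex_vertices)
  finally show ?thesis .
qed

lemma span_cone:
  assumes "I \<in> simplices \<Delta>"
  shows "span (cone_of \<Delta> I) = span (V ` I)"
proof -
  have "span (cone_of \<Delta> I) = span (\<Union>i\<in>I. {c *\<^sub>R V i | c. 0 \<le> c})"
    by (simp only: cone_hull[OF assms] span_convex_cone_hull)
  also have "\<dots> = span (V ` I)"
  proof
    show "span (\<Union>i\<in>I. {c *\<^sub>R V i | c. 0 \<le> c}) \<subseteq> span (V ` I)"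
      by (rule span_minimal) (auto intro: span_scale[OF span_base[OF imageI]])
    show "span (V ` I) \<subseteq> span (\<Union>i\<in>I. {c *\<^sub>R V i | c. 0 \<le> c})"
      by (intro span_mono) (auto intro!: exI[of _ 1])
  qed
  finally show ?thesis .
qed

lemma dim_simplex: "I \<in> simplices \<Delta> \<Longrightarrow> dim (V ` I) = card I"
  using multifan span_cone dim_span by (metis simplicial_multifan_def)

lemma independent_simplex: "I \<in> simplices \<Delta> \<Longrightarrow> independent (V ` I)"
  using dim_simplex[of I] finite_simplex[of I] card_image_le[of I V]
  by (intro card_le_dim_spanning[of _ "span (V ` I)"]) (auto simp: span_superset)

lemma inj_simplex:
  assumes "I \<in> simplices \<Delta>" shows "inj_on V I"
proof -
  have "card I \<le> card (V ` I)"
    using dim_simplex[OF assms] dim_le_card'[of "V ` I"] finite_simplex[OF assms] by simp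
  then show ?thesis
    using finite_simplex[OF assms] by (simp add: eq_card_imp_inj_on card_image_le order_antisym)
qed

lemma span_facet:
  assumes "I \<in> facets \<Delta>"
  shows "span (V ` I) = span L"
proof -
  have I: "I \<in> simplices \<Delta>" "card I = dim L"
    using assms by (auto simp: facets_iff mf_rank_def)
  have sub: "V ` I \<subseteq> L" using V_facet_in_L[OF assms] by blast
  have "L \<subseteq> span (V ` I)"
    using card_ge_dim_independent[OF sub independent_simplex[OF I(1)]] I
    by (simp add: card_image inj_simplex)
  then show ?thesis
    by (meson equalityI span_minimal span_mono sub subspace_span)
qed

text \<open>Linearity is confined to \<open>span L\<close>, because \<open>representation\<close> is
  zero outside the span of its basis.\<close>

lemma U_add: "I \<in> facets \<Delta> \<Longrightarrow> x \<in> span L \<Longrightarrow> y \<in> span L \<Longrightarrow> U I i (x + y) = U I i x + U I i y"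
  by (simp add: dual_basis_def representation_add independent_simplex facets_iff span_facet[symmetric])

lemma U_diff: "I \<in> facets \<Delta> \<Longrightarrow> x \<in> span L \<Longrightarrow> y \<in> span L \<Longrightarrow> U I i (x - y) = U I i x - U I i y"
  by (simp add: dual_basis_def representation_diff independent_simplex facets_iff span_facet[symmetric])

lemma U_scale: "I \<in> facets \<Delta> \<Longrightarrow> x \<in> span L \<Longrightarrow> U I i (c *\<^sub>R x) = c * U I i x"
  by (simp add: dual_basis_def representation_scale independent_simplex facets_iff span_facet[symmetric])

lemma U_0: "I \<in> facets \<Delta> \<Longrightarrow> U I i 0 = 0"
  using U_scale[of I 0 i 0] by (simp add: span_zero)

lemma U_sum:
  "I \<in> facets \<Delta> \<Longrightarrow> (\<And>a. a \<in> A \<Longrightarrow> f a \<in> span L) \<Longrightarrow> U I i (sum f A) = (\<Sum>a\<in>A. U I i (f a))"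
  by (induction A rule: infinite_finite_induct) (auto simp: U_0 U_add span_sum)

lemma U_V:
  assumes "I \<in> facets \<Delta>" "i \<in> I" "j \<in> I"
  shows "U I i (V j) = (if i = j then 1 else 0)"
  using assms inj_onD[OF inj_simplex, of I i j]
  by (auto simp: dual_basis_def representation_basis independent_simplex facets_iff)

lemma U_expansion:
  assumes "I \<in> facets \<Delta>" "x \<in> span L"
  shows "x = (\<Sum>i\<in>I. U I i x *\<^sub>R V i)"
proof -
  have "x = (\<Sum>b\<in>V ` I. representation (V ` I) x b *\<^sub>R b)"
    using assms by (subst sum_representation_eq) (auto simp: independent_simplex facets_iff span_facet finite_simplex)
  then show ?thesis
    using assms by (simp add: sum.reindex inj_simplex facets_iff dual_basis_def)
qed

lemma L_span: "x \<in> L \<Longrightarrow> x \<in> span L"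
  by (rule span_base)

lemma U_lincomb:
  assumes "I \<in> facets \<Delta>" "i \<in> I"
  shows "U I i (\<Sum>j\<in>I. c j *\<^sub>R V j) = c i"
proof -
  have "U I i (\<Sum>j\<in>I. c j *\<^sub>R V j) = (\<Sum>j\<in>I. U I i (c j *\<^sub>R V j))"
    using assms by (intro U_sum span_scale L_span V_facet_in_L)
  also have "\<dots> = (\<Sum>j\<in>I. if i = j then c j else 0)"
    using assms by (intro sum.cong) (auto simp: U_scale L_span V_facet_in_L U_V)
  finally show ?thesis using assms by (simp add: finite_facet)
qed

lemma LI_eq: "J \<in> simplices \<Delta> \<Longrightarrow> LI J = range (\<lambda>c. \<Sum>i\<in>J. of_int (c i) *\<^sub>R V i)"
  unfolding lat_I_def by (intro int_span_image inj_simplex)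

lemma LI_I: "J \<in> simplices \<Delta> \<Longrightarrow> (\<Sum>i\<in>J. of_int (c i) *\<^sub>R V i) \<in> LI J"
  by (auto simp: LI_eq)

lemma LI_subset_L: "J \<in> simplices \<Delta> \<Longrightarrow> LI J \<subseteq> L"
  by (auto simp: LI_eq intro!: L_sum L_scale V_in_L simplex_vertices)

lemma U_LI_Ints:
  assumes "I \<in> facets \<Delta>" "i \<in> I" "x \<in> LI I"
  shows "U I i x \<in> \<int>"
  using assms by (auto simp: LI_eq facets_iff) (metis Ints_of_int U_lincomb assms(1))

section \<open>The finite groups \<open>L / L_I\<close> and rationality of coordinates\<close>

lemma carrier_H_I: "carrier (H_I \<Delta> V I) = coset (LI I) ` L"
proof -
  have "(\<Union>h\<in>LI I. {h + a}) = coset (LI I) a" for a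
    by (auto simp: coset_def add.commute)
  then show ?thesis
    by (auto simp: H_I_def FactGroup_def RCOSETS_def r_coset_def additive_group_def)
qed

lemma coset_LI_eq: "coset (LI J) x = coset (LI J) y \<longleftrightarrow> x - y \<in> LI J"
  unfolding lat_I_def by (rule coset_int_span_eq)

lemma rep_H_I:
  assumes "h \<in> coset (LI J) ` L" "J \<in> simplices \<Delta>"
  shows "rep h \<in> L" "coset (LI J) (rep h) = h"
proof -
  obtain x where x: "x \<in> L" "h = coset (LI J) x" using assms by blast
  have "rep h - x \<in> LI J" unfolding x(2) lat_I_def by (rule rep_coset)
  then show "rep h \<in> L"
    using L_add[of "rep h - x" x] x(1) LI_subset_L[OF assms(2)] by auto
  show "coset (LI J) (rep h) = h"
    unfolding x(2) lat_I_def by (rule coset_rep)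
qed

text \<open>Subtracting the integer parts of the coordinates moves \<open>x\<close> into the
  fundamental parallelepiped of \<open>LI I\<close>. The bound depends on \<open>I\<close> only and
  is the source of all finiteness below.\<close>

lemma reduce_mod_LI:
  assumes "I \<in> facets \<Delta>" "x \<in> L"
  obtains y where "y \<in> L" "x - y \<in> LI I" "norm y \<le> (\<Sum>i\<in>I. norm (V i))"
    "\<And>i. i \<in> I \<Longrightarrow> U I i y = frac (U I i x)"
proof -
  have I: "I \<in> simplices \<Delta>" using assms by (simp add: facets_iff)
  define l where "l = (\<Sum>i\<in>I. of_int \<lfloor>U I i x\<rfloor> *\<^sub>R V i)"
  have l: "l \<in> LI I" unfolding l_def by (rule LI_I[OF I])
  have lL: "l \<in> L" using l LI_subset_L[OF I] by blast
  have y: "x - l \<in> L" using L_diff[OF assms(2) lL] .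
  have U: "U I i (x - l) = frac (U I i x)" if "i \<in> I" for i
    using assms lL that by (subst U_diff) (auto simp: L_span l_def U_lincomb frac_def)
  have "norm (x - l) = norm (\<Sum>i\<in>I. U I i (x - l) *\<^sub>R V i)"
    using U_expansion[OF assms(1) L_span[OF y]] by simp
  also have "\<dots> \<le> (\<Sum>i\<in>I. norm (V i))"
  proof (rule sum_norm_le)
    fix i assume i: "i \<in> I"
    have "norm (U I i (x - l) *\<^sub>R V i) = frac (U I i x) * norm (V i)"
      using U[OF i] by simp
    also have "\<dots> \<le> 1 * norm (V i)"
      using frac_lt_1[of "U I i x"] by (intro mult_right_mono) auto
    finally show "norm (U I i (x - l) *\<^sub>R V i) \<le> norm (V i)" by simp
  qed
  finally show ?thesis using that[of "x - l"] y l U by simp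
qed

lemma finite_H_I:
  assumes "I \<in> facets \<Delta>"
  shows "finite (coset (LI I) ` L)"
proof (rule finite_surj)
  show "finite {x \<in> L. norm x \<le> (\<Sum>i\<in>I. norm (V i))}" by (rule finite_L_bounded)
  show "coset (LI I) ` L \<subseteq> coset (LI I) ` {x \<in> L. norm x \<le> (\<Sum>i\<in>I. norm (V i))}"
  proof safe
    fix x assume "x \<in> L"
    then obtain y where "y \<in> L" "x - y \<in> LI I" "norm y \<le> (\<Sum>i\<in>I. norm (V i))"
      using reduce_mod_LI[OF assms] by blast
    then show "coset (LI I) x \<in> coset (LI I) ` {x \<in> L. norm x \<le> (\<Sum>i\<in>I. norm (V i))}"
      by (intro image_eqI[of _ _ y]) (auto simp: coset_LI_eq)
  qed
qed

lemma order_H_I: "order (H_I \<Delta> V I) = card (coset (LI I) ` L)"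
  by (simp add: order_def carrier_H_I)

lemma order_H_I_pos:
  assumes "I \<in> facets \<Delta>"
  shows "order (H_I \<Delta> V I) > 0"
  using finite_H_I[OF assms] L_0 by (auto simp: order_H_I card_gt_0_iff)

text \<open>Pigeonhole in the finite group \<open>L / L_I\<close>: two natural multiples of
  \<open>x\<close> lie in the same class.\<close>

lemma multiple_in_LI:
  assumes "I \<in> facets \<Delta>" "x \<in> L"
  obtains k :: nat where "k > 0" "real k *\<^sub>R x \<in> LI I"
proof -
  have "\<not> inj (\<lambda>k::nat. coset (LI I) (real k *\<^sub>R x))"
  proof
    assume inj: "inj (\<lambda>k::nat. coset (LI I) (real k *\<^sub>R x))"
    have "range (\<lambda>k::nat. coset (LI I) (real k *\<^sub>R x)) \<subseteq> coset (LI I) ` L"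
      using L_scale[OF assms(2), of "int _"] by auto
    then have "finite (range (\<lambda>k::nat. coset (LI I) (real k *\<^sub>R x)))"
      using finite_H_I[OF assms(1)] finite_subset by blast
    then show False using inj finite_imageD infinite_UNIV_nat by blast
  qed
  then obtain k l :: nat where kl: "k < l" "coset (LI I) (real l *\<^sub>R x) = coset (LI I) (real k *\<^sub>R x)"
  proof -
    obtain a b :: nat where "a \<noteq> b" "coset (LI I) (real a *\<^sub>R x) = coset (LI I) (real b *\<^sub>R x)"
      using \<open>\<not> inj _\<close> unfolding inj_def by blast
    then show thesis using that[of a b] that[of b a] by (cases "a < b") auto
  qed
  then have "real (l - k) *\<^sub>R x \<in> LI I"
    by (simp add: coset_LI_eq of_nat_diff scaleR_left_diff_distrib)
  then show ?thesis using that[of "l - k"] kl by simp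
qed

lemma LI_scale: "x \<in> LI J \<Longrightarrow> real k *\<^sub>R x \<in> LI J"
  using int_span_scale[of x "V ` J" "int k"] by (simp add: lat_I_def)

lemma multiple_in_lat_V:
  assumes "x \<in> L"
  obtains k :: nat where "k > 0" "real k *\<^sub>R x \<in> lat_V \<Delta> V"
proof -
  have "\<exists>k::nat. k > 0 \<and> real k *\<^sub>R x \<in> LI I" if "I \<in> facets \<Delta>" for I
    using multiple_in_LI[OF that assms] by blast
  then obtain k where k: "\<And>I. I \<in> facets \<Delta> \<Longrightarrow> k I > (0::nat)" "\<And>I. I \<in> facets \<Delta> \<Longrightarrow> real (k I) *\<^sub>R x \<in> LI I"
    by metis
  \<comment> \<open>A common multiple of the factors that work for the single facets.\<close>
  define M where "M = (\<Prod>I\<in>facets \<Delta>. k I)"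
  have "real M *\<^sub>R x \<in> LI I" if "I \<in> facets \<Delta>" for I
  proof -
    have "M = (\<Prod>I\<in>facets \<Delta> - {I}. k I) * k I"
      unfolding M_def using that finite_facets by (simp add: prod.remove mult.commute)
    then have "real M *\<^sub>R x = real (\<Prod>I\<in>facets \<Delta> - {I}. k I) *\<^sub>R (real (k I) *\<^sub>R x)"
      by simp
    then show ?thesis using LI_scale[OF k(2)[OF that]] by metis
  qed
  moreover have "M > 0" unfolding M_def using k(1) by (simp add: prod_pos)
  ultimately show ?thesis using that[of M] by (auto simp: lat_V_def)
qed

lemma U_L_Rats:
  assumes "I \<in> facets \<Delta>" "i \<in> I" "x \<in> L"
  shows "U I i x \<in> \<rat>"
proof -
  obtain k where k: "k > 0" "real k *\<^sub>R x \<in> LI I"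
    using multiple_in_LI[OF assms(1,3)] .
  have "real k * U I i x \<in> \<int>"
    using U_LI_Ints[OF assms(1,2) k(2)] U_scale[OF assms(1) L_span[OF assms(3)]] by simp
  then have "real k * U I i x / real k \<in> \<rat>"
    using Ints_subset_Rats by (intro Rats_divide) auto
  then show ?thesis using k by simp
qed

lemma lat_V_subset: "I \<in> facets \<Delta> \<Longrightarrow> lat_V \<Delta> V \<subseteq> LI I"
  by (auto simp: lat_V_def)

lemma lat_V_subset_L: "lat_V \<Delta> V \<subseteq> L"
  using facets_nonempty lat_V_subset LI_subset_L by (metis all_not_in_conv facets_iff order_trans)

end

section \<open>Ridges\<close>

lemma quotient_map_unique:
  fixes W :: "'v::euclidean_space set"
  assumes "subspace W" "x - y \<in> W" "\<forall>w\<in>W. orthogonal w y"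
  shows "quotient_map W x = y"
  unfolding quotient_map_def
proof (rule the_equality)
  fix z assume z: "x - z \<in> W \<and> (\<forall>w\<in>W. orthogonal w z)"
  then have "(x - y) - (x - z) \<in> W" using assms by (blast intro: subspace_diff)
  then have "z - y \<in> W" by simp
  then have "orthogonal (z - y) (z - y)"
    using z assms by (simp add: orthogonal_def inner_diff_right)
  then show "z = y" by (simp add: orthogonal_self)
qed (use assms in auto)

lemma quotient_map_props:
  fixes W :: "'v::euclidean_space set"
  assumes "subspace W"
  shows "x - quotient_map W x \<in> W" "\<And>w. w \<in> W \<Longrightarrow> orthogonal w (quotient_map W x)"
proof -
  obtain y z where yz: "y \<in> span W" "\<And>w. w \<in> span W \<Longrightarrow> orthogonal z w" "x = y + z"
    using orthogonal_subspace_decomp_exists[of W x] by blast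
  have sp: "span W = W" using assms by (simp add: span_eq_iff)
  note yz = yz[unfolded sp]
  have "quotient_map W x = z"
    using yz assms by (intro quotient_map_unique) (auto simp: orthogonal_commute)
  then show "x - quotient_map W x \<in> W" "\<And>w. w \<in> W \<Longrightarrow> orthogonal w (quotient_map W x)"
    using yz by (auto simp: orthogonal_commute)
qed

lemma linear_quotient_map:
  fixes W :: "'v::euclidean_space set"
  assumes W: "subspace W"
  shows "linear (quotient_map W)"
proof (rule linearI)
  fix x y :: 'v and c :: real
  note p = quotient_map_props[OF W]
  have "(x - quotient_map W x) + (y - quotient_map W y) \<in> W"
    by (intro subspace_add[OF W] p)
  then show "quotient_map W (x + y) = quotient_map W x + quotient_map W y"
    using p by (intro quotient_map_unique[OF W]) (auto simp: algebra_simps orthogonal_clauses)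
  have "c *\<^sub>R (x - quotient_map W x) \<in> W"
    by (intro subspace_scale[OF W] p)
  then show "quotient_map W (c *\<^sub>R x) = c *\<^sub>R quotient_map W x"
    using p by (intro quotient_map_unique[OF W]) (auto simp: algebra_simps orthogonal_clauses)
qed

lemma quotient_map_eq_0_iff:
  fixes W :: "'v::euclidean_space set"
  assumes W: "subspace W"
  shows "quotient_map W x = 0 \<longleftrightarrow> x \<in> W"
proof
  assume "quotient_map W x = 0"
  then show "x \<in> W" using quotient_map_props(1)[OF W, of x] by simp
next
  assume "x \<in> W"
  then show "quotient_map W x = 0"
    by (intro quotient_map_unique[OF W]) (auto simp: orthogonal_clauses)
qed

lemma quotient_map_eq_iff:
  fixes W :: "'v::euclidean_space set"
  assumes W: "subspace W"
  shows "quotient_map W x = quotient_map W y \<longleftrightarrow> x - y \<in> W"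
  using quotient_map_eq_0_iff[OF W, of "x - y"] linear_diff[OF linear_quotient_map[OF W], of x y] by auto

context simplicial_multifan_with_edges
begin

definition is_ridge :: "'i set \<Rightarrow> bool" where
  "is_ridge J \<longleftrightarrow> J \<in> simplices \<Delta> \<and> Suc (card J) = mf_rank \<Delta>"

definition star :: "'i set \<Rightarrow> 'i set set" where
  "star J = {I \<in> facets \<Delta>. J \<subseteq> I}"

definition apex :: "'i set \<Rightarrow> 'i set \<Rightarrow> 'i" where
  "apex J I = the_elem (I - J)"

lemma apex:
  assumes "is_ridge J" "I \<in> star J"
  shows "apex J I \<notin> J" "insert (apex J I) J = I" "apex J I \<in> I"
proof -
  have I: "I \<in> facets \<Delta>" "J \<subseteq> I" using assms by (auto simp: star_def)
  then have "card (I - J) = 1"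
    using assms(1) finite_facet[OF I(1)] by (subst card_Diff_subset) (auto simp: is_ridge_def facets_iff intro: finite_subset)
  then obtain i where "I - J = {i}" by (rule card_1_singletonE)
  then show "apex J I \<notin> J" "insert (apex J I) J = I" "apex J I \<in> I"
    using I(2) by (auto simp: apex_def)
qed

lemma ridge_of_facet:
  assumes "I \<in> facets \<Delta>" "i \<in> I"
  shows "is_ridge (I - {i})" "I \<in> star (I - {i})" "apex (I - {i}) I = i"
proof -
  have "card I = Suc (card (I - {i}))"
    using assms finite_facet by (metis card_Suc_Diff1)
  then show "is_ridge (I - {i})"
    using assms by (auto simp: is_ridge_def facets_iff intro: simplex_subset)
  show "I \<in> star (I - {i})" using assms by (auto simp: star_def)
  have "I - (I - {i}) = {i}" using assms by auto
  then show "apex (I - {i}) I = i" by (simp add: apex_def)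
qed

lemma star_facet: "I \<in> star J \<Longrightarrow> I \<in> facets \<Delta>"
  by (simp add: star_def)

lemma finite_star: "finite (star J)"
  using finite_facets by (simp add: star_def)

lemma star_nonempty: "is_ridge J \<Longrightarrow> star J \<noteq> {}"
proof -
  have "\<forall>J \<in> simplices \<Delta>. \<exists>I \<in> facets \<Delta>. J \<subseteq> I"
    using multifan unfolding simplicial_multifan_def by (elim conjE)
  then show "is_ridge J \<Longrightarrow> star J \<noteq> {}" by (auto simp: is_ridge_def star_def)
qed

text \<open>A generator of the group of integral functionals on \<open>L\<close> that vanish on the
  ridge, extended to the ambient space. It is unique on \<open>span L\<close> up to sign; it
  measures the height over the span of the ridge and does not refer to any facet containing
  it.\<close>

definition ridge_functional :: "'i set \<Rightarrow> ('v \<Rightarrow> real) \<Rightarrow> bool" where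
  "ridge_functional J l \<longleftrightarrow> is_ridge J \<and> linear l \<and> (\<forall>j\<in>J. l (V j) = 0) \<and> l ` L = \<int>"

text \<open>For a facet \<open>I\<close> containing \<open>J\<close>, the apex coordinate already
  vanishes on the ridge. Its values on \<open>L\<close> form a discrete group, and division by the
  least positive value normalizes them to the integers.\<close>

lemma ridge_functional_exists:
  assumes J: "is_ridge J"
  shows "\<exists>l. ridge_functional J l"
proof -
  obtain I where I: "I \<in> star J" using star_nonempty[OF J] by blast
  have If: "I \<in> facets \<Delta>" using I by (rule star_facet)
  define i where "i = apex J I"
  have i: "i \<in> I" "i \<notin> J" "insert i J = I" using apex[OF J I] by (auto simp: i_def)
  \<comment> \<open>The cut at 1 makes \<open>G\<close> finite: values below 1 are attained on
    reduced vectors of bounded norm, and 1 is attained at \<open>V i\<close>, which also shows that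
    \<open>G\<close> is not empty.\<close>
  define G where "G = {U I i x | x. x \<in> L} \<inter> {0<..1}"
  have "G \<subseteq> U I i ` {x \<in> L. norm x \<le> (\<Sum>j\<in>I. norm (V j)) + norm (V i)}"
  proof
    fix g assume "g \<in> G"
    then obtain x where x: "x \<in> L" "g = U I i x" "0 < g" "g \<le> 1" by (auto simp: G_def)
    obtain y where y: "y \<in> L" "norm y \<le> (\<Sum>j\<in>I. norm (V j))" "U I i y = frac (U I i x)"
      using reduce_mod_LI[OF If x(1)] i(1) by metis
    show "g \<in> U I i ` {x \<in> L. norm x \<le> (\<Sum>j\<in>I. norm (V j)) + norm (V i)}"
    proof (cases "g = 1")
      case True
      then have "g = U I i (V i)" using U_V[OF If i(1) i(1)] by simp
      moreover have "norm (V i) \<le> (\<Sum>j\<in>I. norm (V j)) + norm (V i)" by (simp add: sum_nonneg)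
      ultimately show ?thesis using V_facet_in_L[OF If i(1)] by blast
    next
      case False
      then have "frac g = g" using x by (simp add: frac_eq)
      then have "g = U I i y" using y x by simp
      moreover have "norm y \<le> (\<Sum>j\<in>I. norm (V j)) + norm (V i)" using y(2) norm_ge_zero[of "V i"] by linarith
      ultimately show ?thesis using y(1) by blast
    qed
  qed
  then have finG: "finite G" using finite_L_bounded finite_surj by metis
  have "1 \<in> G"
    unfolding G_def using U_V[OF If i(1) i(1)] V_facet_in_L[OF If i(1)] by (auto intro!: exI[of _ "V i"])
  define d where "d = Min G"
  have dG: "d \<in> G" unfolding d_def using finG \<open>1 \<in> G\<close> by (intro Min_in) auto
  then obtain e where e: "e \<in> L" "U I i e = d" "d > 0" by (auto simp: G_def)
  have Ud: "U I i x / d \<in> \<int>" if x: "x \<in> L" for x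
  proof -
    \<comment> \<open>Division with remainder by \<open>d\<close>; a nonzero remainder would be an
      element of \<open>G\<close> below its minimum.\<close>
    define y where "y = x - of_int \<lfloor>U I i x / d\<rfloor> *\<^sub>R e"
    have y: "y \<in> L" unfolding y_def by (intro L_diff L_scale x e)
    have Uy: "U I i y = d * frac (U I i x / d)"
      unfolding y_def using x e If
      by (simp add: U_diff U_scale L_span L_scale frac_def right_diff_distrib)
    have "\<not> frac (U I i x / d) > 0"
    proof
      assume *: "frac (U I i x / d) > 0"
      have lt: "U I i y < d" unfolding Uy using mult_strict_left_mono[OF frac_lt_1 e(3)] by simp
      moreover have "U I i y > 0" unfolding Uy using * e(3) by simp
      moreover have "d \<le> 1" using dG by (simp add: G_def)
      ultimately have "U I i y \<in> G" unfolding G_def using y by auto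
      then have "d \<le> U I i y" unfolding d_def using finG by simp
      then show False using lt by simp
    qed
    then have "frac (U I i x / d) = 0" using frac_ge_0[of "U I i x / d"] by linarith
    then show ?thesis by (simp add: frac_eq_0_iff)
  qed
  \<comment> \<open>\<open>U I i\<close> is linear on \<open>span L\<close> only, whereas a ridge
    functional has to be linear on the ambient space.\<close>
  obtain g :: "'v \<Rightarrow> real" where g: "linear g" "\<forall>x\<in>V ` I. g x = (if x = V i then 1 else 0)"
    using linear_independent_extend[OF independent_simplex, of I "\<lambda>x. if x = V i then 1 else 0"] If
    by (auto simp: facets_iff)
  have gU: "g x = U I i x" if "x \<in> span L" for x
  proof -
    have "g x = g (\<Sum>j\<in>I. U I j x *\<^sub>R V j)"
      by (rule arg_cong[OF U_expansion[OF If that]])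
    also have "\<dots> = (\<Sum>j\<in>I. U I j x * g (V j))"
      by (simp add: linear_sum[OF g(1)] linear_scale[OF g(1)])
    also have "\<dots> = (\<Sum>j\<in>I. if j = i then U I j x else 0)"
      using g(2) inj_onD[OF inj_simplex, of I] i If by (intro sum.cong) (auto simp: facets_iff)
    finally show ?thesis using i(1) finite_facet[OF If] by simp
  qed
  define l where "l x = g x / d" for x
  have "linear l"
    by (rule linearI) (simp_all add: l_def linear_add[OF g(1)] linear_scale[OF g(1)] add_divide_distrib)
  moreover have "l (V j) = 0" if "j \<in> J" for j
  proof -
    have "j \<in> I" using that i(3) by blast
    moreover from this have "V j \<noteq> V i"
      using inj_onD[OF inj_simplex, of I j i] If i(1,2) that by (auto simp: facets_iff)
    ultimately show ?thesis using g(2) by (simp add: l_def)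
  qed
  moreover have "l ` L = \<int>"
  proof (intro equalityI subsetI)
    fix r assume "r \<in> l ` L"
    then show "r \<in> \<int>" using Ud by (auto simp: l_def gU L_span)
  next
    fix r :: real assume "r \<in> \<int>"
    then obtain k where "r = of_int k" by (auto elim: Ints_cases)
    then have "r = l (of_int k *\<^sub>R e)"
    proof -
      have "g (of_int k *\<^sub>R e) = of_int k * d"
        using e(1,2) If by (subst gU) (auto simp: L_span L_scale U_scale)
      then show ?thesis using e(3) \<open>r = of_int k\<close> by (simp add: l_def)
    qed
    then show "r \<in> l ` L" using L_scale[OF e(1)] by blast
  qed
  ultimately show ?thesis using J unfolding ridge_functional_def by blast
qed

context
  fixes J l
  assumes l: "ridge_functional J l"
begin

lemma ridge: "is_ridge J" and ridge_linear: "linear l"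
  and ridge_vanish: "j \<in> J \<Longrightarrow> l (V j) = 0"
  and ridge_Ints: "x \<in> L \<Longrightarrow> l x \<in> \<int>"
  using l by (auto simp: ridge_functional_def)

lemma ridge_onto: obtains x where "x \<in> L" "l x = of_int a"
  using l unfolding ridge_functional_def by (metis Ints_of_int imageE)

lemma ridge_functional_eq:
  assumes "I \<in> star J" "x \<in> span L"
  shows "l x = U I (apex J I) x * l (V (apex J I))"
proof -
  note I = star_facet[OF assms(1)] apex[OF ridge assms(1)]
  have "finite J" using finite_facet[OF I(1)] I(3) by (metis finite_insert)
  have "l x = l (\<Sum>j\<in>I. U I j x *\<^sub>R V j)"
    by (rule arg_cong[OF U_expansion[OF I(1) assms(2)]])
  also have "\<dots> = (\<Sum>j\<in>I. U I j x * l (V j))"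
    by (simp add: linear_sum[OF ridge_linear] linear_scale[OF ridge_linear])
  also have "\<dots> = (\<Sum>j\<in>insert (apex J I) J. U I j x * l (V j))"
    by (simp only: I(3))
  also have "\<dots> = U I (apex J I) x * l (V (apex J I))"
    using I(2) \<open>finite J\<close> by (simp add: ridge_vanish)
  finally show ?thesis .
qed

lemma ridge_apex_nonzero:
  assumes "I \<in> star J"
  shows "l (V (apex J I)) \<noteq> 0"
proof
  assume 0: "l (V (apex J I)) = 0"
  obtain e where "e \<in> L" "l e = of_int 1" by (rule ridge_onto)
  then show False using ridge_functional_eq[OF assms L_span, of e] 0 by simp
qed

lemma U_apex:
  assumes "I \<in> star J" "x \<in> span L"
  shows "U I (apex J I) x = l x / l (V (apex J I))"
  using ridge_functional_eq[OF assms] ridge_apex_nonzero[OF assms(1)] by simp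

lemma ridge_kernel:
  assumes "x \<in> span L" "l x = 0"
  shows "x \<in> span (V ` J)"
proof -
  obtain I where I: "I \<in> star J" using star_nonempty[OF ridge] by blast
  note I' = star_facet[OF I] apex[OF ridge I]
  have "finite J" using finite_facet[OF I'(1)] I'(3) by (metis finite_insert)
  have "x = (\<Sum>j\<in>insert (apex J I) J. U I j x *\<^sub>R V j)"
    using U_expansion[OF I'(1) assms(1)] I'(3) by simp
  then have "x = (\<Sum>j\<in>J. U I j x *\<^sub>R V j)"
    using I'(2) \<open>finite J\<close> U_apex[OF I assms(1)] assms(2) by simp
  also have "\<dots> \<in> span (V ` J)" by (intro span_sum span_scale span_base imageI)
  finally show ?thesis .
qed

text \<open>The expansion in \<open>V\<close> J\<open>is also the expansion in\<close>V
  \<open>I\<close>. Since the right side does not mention \<open>I\<close>, the regular factors at a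
  pole will agree for all facets at the ridge.\<close>

lemma U_ridge:
  assumes "I \<in> star J" "j \<in> J" "x \<in> span (V ` J)"
  shows "U I j x = representation (V ` J) x (V j)"
proof -
  note I = star_facet[OF assms(1)]
  show ?thesis unfolding dual_basis_def
    using assms I by (subst representation_extend[of "V ` I" x "V ` J"])
      (auto simp: star_def facets_iff independent_simplex)
qed

text \<open>For a vector in \<open>LI I\<close> of height 0 the integer coefficient at the apex
  vanishes, which leaves an integer combination of the edge vectors of \<open>J\<close>.\<close>

lemma ridge_kernel_lattice:
  assumes "I \<in> star J" "x \<in> span L" "l x = 0"
  shows "x \<in> LI I \<longleftrightarrow> x \<in> LI J"
proof
  note I = star_facet[OF assms(1)] apex[OF ridge assms(1)]
  have J: "finite J" "J \<in> simplices \<Delta>"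
    using ridge finite_simplex by (auto simp: is_ridge_def)
  {
    assume "x \<in> LI J"
    then obtain c where "x = (\<Sum>i\<in>J. of_int (c i) *\<^sub>R V i)" by (auto simp: LI_eq[OF J(2)])
    also have "\<dots> = (\<Sum>i\<in>insert (apex J I) J. of_int (if i \<in> J then c i else 0) *\<^sub>R V i)"
      using J I(2) by (simp cong: sum.cong)
    also have "\<dots> = (\<Sum>i\<in>I. of_int (if i \<in> J then c i else 0) *\<^sub>R V i)"
      by (simp only: I(3))
    also have "\<dots> \<in> LI I" using I(1) by (intro LI_I) (simp add: facets_iff)
    finally show "x \<in> LI I" .
  next
    assume "x \<in> LI I"
    then obtain c where c: "x = (\<Sum>i\<in>I. of_int (c i) *\<^sub>R V i)"
      using I(1) by (auto simp: LI_eq facets_iff)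
    have "U I (apex J I) x = of_int (c (apex J I))"
      unfolding c by (rule U_lincomb[OF I(1,4)])
    then have "c (apex J I) = 0" using U_apex[OF assms(1,2)] assms(3) by simp
    then have "x = (\<Sum>i\<in>J. of_int (c i) *\<^sub>R V i)"
      using c J I(2) by (subst (asm) I(3)[symmetric]) simp
    then show "x \<in> LI J" using LI_I[OF J(2)] by simp
  }
qed

text \<open>The classes in \<open>L / L\<^sub>J\<close> over \<open>a \<in> \<int>\<close>, where \<open>l\<close> identifies \<open>L / (L \<inter> span (V ` J))\<close> with \<open>\<int>\<close>.\<close>

definition fibre :: "int \<Rightarrow> 'v set set" where
  "fibre a = coset (LI J) ` {x \<in> L. l x = of_int a}"

lemma rep_fibre:
  assumes "c \<in> fibre a"
  shows "rep c \<in> L" "l (rep c) = of_int a" "coset (LI J) (rep c) = c"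
proof -
  have J: "J \<in> simplices \<Delta>" using ridge by (auto simp: is_ridge_def)
  obtain x where x: "x \<in> L" "l x = of_int a" "c = coset (LI J) x"
    using assms by (auto simp: fibre_def)
  then have "c \<in> coset (LI J) ` L" by blast
  from rep_H_I[OF this J] show r: "rep c \<in> L" "coset (LI J) (rep c) = c" .
  then have "rep c - x \<in> LI J" using x(3) by (simp add: coset_LI_eq[symmetric])
  then obtain k where "rep c - x = (\<Sum>i\<in>J. of_int (k i) *\<^sub>R V i)" by (auto simp: LI_eq[OF J])
  then have "l (rep c - x) = 0"
    by (simp add: linear_sum[OF ridge_linear] linear_scale[OF ridge_linear] ridge_vanish)
  then show "l (rep c) = of_int a" using x(2) by (simp add: linear_diff[OF ridge_linear])
qed

lemma coset_star_eq_iff: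
  assumes "I \<in> star J" "x \<in> L" "y \<in> L" "l x = l y"
  shows "coset (LI I) x = coset (LI I) y \<longleftrightarrow> coset (LI J) x = coset (LI J) y"
  using ridge_kernel_lattice[OF assms(1) L_span[OF L_diff[OF assms(2,3)]]] assms(4)
  by (simp add: coset_LI_eq linear_diff[OF ridge_linear])

lemma LI_star_functional:
  assumes "I \<in> star J" "x \<in> LI I"
  obtains k :: int where "l x = of_int k * l (V (apex J I))"
proof -
  note I = star_facet[OF assms(1)] apex[OF ridge assms(1)]
  have x: "x \<in> span L" using assms(2) LI_subset_L[of I] I(1) by (auto simp: facets_iff intro: L_span)
  obtain k :: int where "U I (apex J I) x = of_int k"
    using U_LI_Ints[OF I(1,4) assms(2)] by (auto elim: Ints_cases)
  then show ?thesis using that ridge_functional_eq[OF assms(1) x] by auto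
qed

text \<open>Two classes over the same height that merge modulo \<open>LI I\<close> already agree
  modulo \<open>LI J\<close>. This allows the polar terms of every facet at the ridge to be indexed
  by one and the same set.\<close>

lemma bij_betw_fibre:
  assumes "I \<in> star J"
  shows "bij_betw (\<lambda>c. coset (LI I) (rep c)) (fibre a) {h \<in> coset (LI I) ` L. \<exists>x\<in>L. h = coset (LI I) x \<and> l x = of_int a}"
  unfolding bij_betw_def
proof (intro conjI equalityI subsetI)
  show "inj_on (\<lambda>c. coset (LI I) (rep c)) (fibre a)"
    by (rule inj_onI) (metis assms coset_star_eq_iff rep_fibre)
  fix h assume "h \<in> {h \<in> coset (LI I) ` L. \<exists>x\<in>L. h = coset (LI I) x \<and> l x = of_int a}"
  then obtain x where x: "x \<in> L" "h = coset (LI I) x" "l x = of_int a" by blast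
  then have c: "coset (LI J) x \<in> fibre a" by (auto simp: fibre_def)
  from rep_fibre[OF c] have "coset (LI I) (rep (coset (LI J) x)) = h"
    unfolding x(2) using x by (subst coset_star_eq_iff[OF assms]) auto
  then show "h \<in> (\<lambda>c. coset (LI I) (rep c)) ` fibre a" using c by blast
qed (use rep_fibre in blast)

text \<open>With \<open>m\<close> the height of the apex edge vector, \<open>l\<close> induces a
  surjection of \<open>L / L_I\<close> onto the integers modulo \<open>m\<close>, whose kernel is
  identified with \<open>fibre 0\<close>. The map \<open>f\<close> lists the classes by residue and
  kernel element.\<close>

lemma order_H_I_star:
  assumes "I \<in> star J"
  shows "real (order (H_I \<Delta> V I)) = \<bar>l (V (apex J I))\<bar> * real (card (fibre 0))"
proof -
  note I = star_facet[OF assms] apex[OF ridge assms]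
  define i where "i = apex J I"
  have Vi: "V i \<in> L" unfolding i_def using V_facet_in_L[OF I(1,4)] .
  obtain m :: int where m: "l (V i) = of_int m" using ridge_Ints[OF Vi] by (auto elim: Ints_cases)
  have m0: "m \<noteq> 0" using ridge_apex_nonzero[OF assms] m by (auto simp: i_def)
  obtain e where e: "e \<in> L" "l e = of_int 1" by (rule ridge_onto)
  note lin = linear_diff[OF ridge_linear] linear_add[OF ridge_linear] linear_scale[OF ridge_linear]
  define f where "f = (\<lambda>(a::int, c). coset (LI I) (of_int a *\<^sub>R e + rep c))"
  have inj: "inj_on f ({0..<\<bar>m\<bar>} \<times> fibre 0)"
  proof (rule inj_onI)
    fix p p' assume p: "p \<in> {0..<\<bar>m\<bar>} \<times> fibre 0" "p' \<in> {0..<\<bar>m\<bar>} \<times> fibre 0" and "f p = f p'"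
    then obtain a b c d where pp: "p = (a, c)" "p' = (b, d)"
      and a: "a \<in> {0..<\<bar>m\<bar>}" "b \<in> {0..<\<bar>m\<bar>}" and c: "c \<in> fibre 0" "d \<in> fibre 0"
      and eq: "f (a, c) = f (b, d)"
      by blast
    define x where "x = (of_int a *\<^sub>R e + rep c) - (of_int b *\<^sub>R e + rep d)"
    have x: "x \<in> LI I" using eq by (simp add: f_def coset_LI_eq x_def)
    obtain k :: int where "l x = of_int k * l (V (apex J I))" using LI_star_functional[OF assms x] .
    then have "of_int (a - b) = (of_int (k * m) :: real)"
      using m rep_fibre(2)[OF c(1)] rep_fibre(2)[OF c(2)] e by (simp add: x_def lin i_def)
    then have "a - b = k * m" by (simp only: of_int_eq_iff)
    then have "m dvd a - b" by simp
    then have "\<bar>m\<bar> dvd a - b" by simp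
    then have "a mod \<bar>m\<bar> = b mod \<bar>m\<bar>" by (simp add: mod_eq_dvd_iff)
    then have ab: "a = b" using a by simp
    have "coset (LI I) (rep c) = coset (LI I) (rep d)"
      using x by (simp add: coset_LI_eq x_def ab)
    then have "coset (LI J) (rep c) = coset (LI J) (rep d)"
      using rep_fibre[OF c(1)] rep_fibre[OF c(2)] by (subst (asm) coset_star_eq_iff[OF assms]) auto
    then have "c = d" using rep_fibre(3)[OF c(1)] rep_fibre(3)[OF c(2)] by simp
    then show "p = p'" using ab pp by simp
  qed
  have "f ` ({0..<\<bar>m\<bar>} \<times> fibre 0) = coset (LI I) ` L"
  proof (intro equalityI subsetI)
    fix h assume "h \<in> f ` ({0..<\<bar>m\<bar>} \<times> fibre 0)"
    then show "h \<in> coset (LI I) ` L"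
      by (auto simp: f_def intro!: imageI L_add L_scale e rep_fibre)
  next
    fix h assume "h \<in> coset (LI I) ` L"
    then obtain y where y: "y \<in> L" "h = coset (LI I) y" by blast
    obtain k :: int where k: "l y = of_int k" using ridge_Ints[OF y(1)] by (auto elim: Ints_cases)
    \<comment> \<open>\<open>m\<close> may be negative: the residue is taken modulo
      \<open>\<bar>m\<bar>\<close> and the sign of \<open>m\<close> is moved into the quotient
      \<open>b\<close>.\<close>
    define a where "a = k mod \<bar>m\<bar>"
    define b where "b = sgn m * (k div \<bar>m\<bar>)"
    have kab: "k = b * m + a"
    proof -
      have "b * m = (sgn m * m) * (k div \<bar>m\<bar>)" by (simp add: b_def)
      then have "b * m = \<bar>m\<bar> * (k div \<bar>m\<bar>)" by (simp only: abs_sgn mult.commute)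
      then show ?thesis by (simp add: a_def)
    qed
    define y0 where "y0 = y - of_int b *\<^sub>R V i - of_int a *\<^sub>R e"
    have y0: "y0 \<in> L" "l y0 = 0"
      using kab by (auto simp: y0_def lin k e m intro!: L_diff L_scale y e Vi)
    then have c: "coset (LI J) y0 \<in> fibre 0" by (auto simp: fibre_def)
    have "V i \<in> LI I"
      unfolding lat_I_def i_def using I finite_facet by (intro int_span_base) auto
    then have bV: "of_int b *\<^sub>R V i \<in> LI I" unfolding lat_I_def by (rule int_span_scale)
    have "coset (LI I) (rep (coset (LI J) y0)) = coset (LI I) y0"
      using rep_fibre[OF c] y0 by (subst coset_star_eq_iff[OF assms]) auto
    then have "rep (coset (LI J) y0) - y0 \<in> LI I" by (simp add: coset_LI_eq)
    then have "(rep (coset (LI J) y0) - y0) - of_int b *\<^sub>R V i \<in> LI I"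
      using bV unfolding lat_I_def by (rule int_span_diff)
    then have "of_int a *\<^sub>R e + rep (coset (LI J) y0) - y \<in> LI I"
      by (simp add: y0_def algebra_simps)
    then have "f (a, coset (LI J) y0) = h"
      by (simp add: f_def y(2) coset_LI_eq)
    moreover have "a \<in> {0..<\<bar>m\<bar>}" using m0 by (simp add: a_def)
    ultimately show "h \<in> f ` ({0..<\<bar>m\<bar>} \<times> fibre 0)" using c by blast
  qed
  then have "card (coset (LI I) ` L) = card ({0..<\<bar>m\<bar>} \<times> fibre 0)"
    using card_image[OF inj] by simp
  then have "order (H_I \<Delta> V I) = nat \<bar>m\<bar> * card (fibre 0)"
    by (simp add: order_H_I card_cartesian_product)
  then show ?thesis using m by (simp add: i_def)
qed

section \<open>The projected multi-fan at a ridge and the balancing of weights\<close>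

lemma cone_functional:
  assumes "I \<in> star J" "x \<in> cone_of \<Delta> I"
  shows "l x * l (V (apex J I)) \<ge> 0"
proof -
  note I = star_facet[OF assms(1)] apex[OF ridge assms(1)]
  let ?H = "{x. l x * l (V (apex J I)) \<ge> 0}"
  have "convex_cone hull (\<Union>i\<in>I. {c *\<^sub>R V i | c. 0 \<le> c}) \<subseteq> ?H"
  proof (rule hull_minimal)
    have "l (V i) * l (V (apex J I)) \<ge> 0" if "i \<in> I" for i
    proof (cases "i \<in> J")
      case False
      then have "i = apex J I" using that I(3) by blast
      then show ?thesis by simp
    qed (simp add: ridge_vanish)
    then show "(\<Union>i\<in>I. {c *\<^sub>R V i | c. 0 \<le> c}) \<subseteq> ?H"
      by (auto simp: linear_scale[OF ridge_linear] mult.assoc)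
    show "convex_cone ?H"
      unfolding convex_cone_def
    proof (intro conjI)
      show "?H \<noteq> {}" using linear_0[OF ridge_linear] by (auto intro!: exI[of _ 0])
      show "convex ?H"
        by (rule convexI) (simp add: linear_add[OF ridge_linear] linear_scale[OF ridge_linear] distrib_right mult.assoc)
      show "conic ?H"
        by (simp add: conic_def linear_scale[OF ridge_linear] mult.assoc)
    qed
  qed
  then show ?thesis using assms(2) cone_hull[of I] I(1) by (auto simp: facets_iff)
qed

text \<open>Modulo the span of the ridge the space is a line with coordinate \<open>l\<close>, and
  the cone of \<open>I\<close> becomes the ray through the image of its apex edge vector.\<close>

lemma projected_cone_iff:
  assumes I: "I \<in> star J" and y: "y \<in> span L" "l y \<noteq> 0"
  shows "quotient_map (span (cone_of \<Delta> J)) y \<in> quotient_map (span (cone_of \<Delta> J)) ` cone_of \<Delta> I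
     \<longleftrightarrow> sgn (l y) = sgn (l (V (apex J I)))"
proof -
  note I' = star_facet[OF I] apex[OF ridge I]
  define i where "i = apex J I"
  have J: "J \<in> simplices \<Delta>" using ridge by (auto simp: is_ridge_def)
  have W: "span (cone_of \<Delta> J) = span (V ` J)" by (rule span_cone[OF J])
  have li: "l (V i) \<noteq> 0" unfolding i_def by (rule ridge_apex_nonzero[OF I])
  show ?thesis
    unfolding i_def[symmetric]
  proof
    assume "quotient_map (span (cone_of \<Delta> J)) y \<in> quotient_map (span (cone_of \<Delta> J)) ` cone_of \<Delta> I"
    then obtain x where x: "x \<in> cone_of \<Delta> I" "y - x \<in> span (V ` J)"
      by (auto simp: quotient_map_eq_iff W)
    have "l z = 0" if "z \<in> span (V ` J)" for z
      using that by (induction rule: span_induct_alt)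
        (auto simp: linear_0[OF ridge_linear] linear_add[OF ridge_linear] linear_scale[OF ridge_linear] ridge_vanish)
    then have "l y = l x" using x(2) linear_diff[OF ridge_linear, of y x] by simp
    then have "l y * l (V i) > 0"
      using cone_functional[OF I x(1)] y(2) li by (simp add: i_def less_le)
    then show "sgn (l y) = sgn (l (V i))" by (auto simp: sgn_if zero_less_mult_iff)
  next
    assume *: "sgn (l y) = sgn (l (V i))"
    define c where "c = l y / l (V i)"
    have "c \<ge> 0" using * by (auto simp: c_def sgn_if zero_le_divide_iff split: if_splits)
    then have "c *\<^sub>R V i \<in> cone_of \<Delta> I"
      using I' by (subst cone_hull) (auto simp: facets_iff i_def intro!: hull_inc)
    moreover have "y - c *\<^sub>R V i \<in> span (V ` J)"
    proof (rule ridge_kernel)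
      show "y - c *\<^sub>R V i \<in> span L"
        unfolding i_def by (intro span_diff span_scale y(1) L_span V_facet_in_L[OF I'(1,4)])
      show "l (y - c *\<^sub>R V i) = 0"
        using li by (simp add: linear_diff[OF ridge_linear] linear_scale[OF ridge_linear] c_def)
    qed
    ultimately show "quotient_map (span (cone_of \<Delta> J)) y \<in> quotient_map (span (cone_of \<Delta> J)) ` cone_of \<Delta> I"
      by (intro image_eqI[of _ _ "c *\<^sub>R V i"]) (auto simp: quotient_map_eq_iff W)
  qed
qed

text \<open>The projected multi-fan is one-dimensional, so its generic vectors are the nonzero ones.
  Pre-completeness then equates the total weights of the facets on the two sides of the
  ridge.\<close>

lemma ridge_weights_balanced:
  assumes "pre_complete (projected \<Delta> J)"
  shows "(\<Sum>I\<in>star J. of_int (weight \<Delta> I) * sgn (l (V (apex J I)))) = 0"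
proof -
  define W where "W = span (cone_of \<Delta> J)"
  define q where "q = quotient_map W"
  define P where "P = projected \<Delta> J"
  have J: "J \<in> simplices \<Delta>" using ridge by (auto simp: is_ridge_def)
  have WJ: "W = span (V ` J)" unfolding W_def by (rule span_cone[OF J])
  have sW: "subspace W" by (simp add: W_def)
  have lq: "linear q" unfolding q_def by (rule linear_quotient_map[OF sW])
  obtain I0 where I0: "I0 \<in> star J" using star_nonempty[OF ridge] by blast
  define v0 where "v0 = V (apex J I0)"
  have v0: "v0 \<in> L" unfolding v0_def using V_facet_in_L[OF star_facet[OF I0]] apex[OF ridge I0] by blast
  have lv0: "l v0 \<noteq> 0" unfolding v0_def by (rule ridge_apex_nonzero[OF I0])
  have q0: "q y = 0 \<longleftrightarrow> l y = 0" if "y \<in> span L" for y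
  proof -
    have "l z = 0" if "z \<in> W" for z
      using that unfolding WJ by (induction rule: span_induct_alt)
        (auto simp: linear_0[OF ridge_linear] linear_add[OF ridge_linear] linear_scale[OF ridge_linear] ridge_vanish)
    then show ?thesis
      using ridge_kernel[OF that, folded WJ] unfolding q_def quotient_map_eq_0_iff[OF sW] by blast
  qed
  have "q ` L \<subseteq> span {q v0}"
  proof safe
    fix x assume x: "x \<in> L"
    have "q (x - (l x / l v0) *\<^sub>R v0) = 0"
    proof (subst q0)
      show "x - (l x / l v0) *\<^sub>R v0 \<in> span L" by (intro span_diff span_scale L_span x v0)
    qed (use lv0 in \<open>simp add: linear_diff[OF ridge_linear] linear_scale[OF ridge_linear]\<close>)
    then have "q x = (l x / l v0) *\<^sub>R q v0"
      by (simp add: linear_diff[OF lq] linear_scale[OF lq])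
    then show "q x \<in> span {q v0}" by (simp add: span_scale span_base)
  qed
  moreover have "{q v0} \<subseteq> span (q ` L)" using v0 by (auto intro: span_base)
  ultimately have "span (q ` L) = span {q v0}"
    by (metis equalityI span_minimal subspace_span)
  then have "dim (q ` L) = dim {q v0}" by (rule span_eq_dim)
  moreover have "q v0 \<noteq> 0" using q0[OF L_span[OF v0]] lv0 by simp
  ultimately have rankP: "mf_rank P = 1"
    by (simp add: mf_rank_def P_def projected_def q_def W_def)
  \<comment> \<open>\<open>J\<close> is the least simplex of the projection, so \<open>layer\<close>
    counts from \<open>card J\<close> and rank 1 selects exactly the facets in
    \<open>star J\<close>.\<close>
  have "J \<in> {J' \<in> simplices \<Delta>. J \<subseteq> J'}" using J by simp
  then have "\<Inter>(simplices P) = J" by (auto simp: P_def projected_def)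
  then have facetsP: "facets P = star J"
    unfolding facets_def rankP layer_def using ridge
    by (auto simp: P_def projected_def is_ridge_def star_def facets_iff)
  have gen: "generic P (q y)" if y: "y \<in> span L" "l y \<noteq> 0" for y
    unfolding generic_def rankP
  proof (intro conjI ballI impI)
    show "q y \<in> span (lat P)"
      using y linear_span_image[OF lq, of L] by (simp add: P_def projected_def q_def W_def)
    fix K assume "dim (cone_of P K) < 1"
    then have "cone_of P K \<subseteq> {0}" by (simp add: dim_eq_0)
    then have "span (cone_of P K) \<subseteq> {0}" by (rule span_minimal) (rule subspace_single_0)
    then show "q y \<notin> span (cone_of P K)" using q0[OF y(1)] y(2) by blast
  qed
  obtain d where d: "\<And>v. generic P v \<Longrightarrow> (\<Sum>I | I \<in> facets P \<and> v \<in> cone_of P I. weight P I) = d"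
    using assms by (auto simp: pre_complete_def P_def)
  have sum_d: "(\<Sum>I | I \<in> star J \<and> sgn (l (V (apex J I))) = sgn (l y). weight \<Delta> I) = d"
    if y: "y \<in> span L" "l y \<noteq> 0" for y
  proof -
    have "{I. I \<in> facets P \<and> q y \<in> cone_of P I} = {I \<in> star J. sgn (l (V (apex J I))) = sgn (l y)}"
    proof -
      have "cone_of P I = q ` cone_of \<Delta> I" for I
        by (simp add: P_def projected_def q_def W_def)
      then have "I \<in> facets P \<and> q y \<in> cone_of P I \<longleftrightarrow> I \<in> star J \<and> sgn (l (V (apex J I))) = sgn (l y)" for I
        using projected_cone_iff[OF _ y, of I] unfolding facetsP q_def W_def by metis
      then show ?thesis by blast
    qed
    moreover have "weight P = weight \<Delta>"
      by (auto simp: weight_def P_def projected_def)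
    ultimately show ?thesis using d[OF gen[OF y]] by simp
  qed
  \<comment> \<open>The vectors \<open>e\<close> and \<open>- e\<close> test one side of the ridge
    each.\<close>
  obtain e where e: "e \<in> L" "l e = of_int 1" by (rule ridge_onto)
  have 1: "(\<Sum>I | I \<in> star J \<and> sgn (l (V (apex J I))) = 1. weight \<Delta> I) = d"
    using sum_d[of e] e by (simp add: L_span)
  have 2: "(\<Sum>I | I \<in> star J \<and> sgn (l (V (apex J I))) = -1. weight \<Delta> I) = d"
    using sum_d[of "- e"] e by (simp add: L_span L_minus linear_neg[OF ridge_linear])
  have "(\<Sum>I\<in>star J. of_int (weight \<Delta> I) * sgn (l (V (apex J I)))) =
     (\<Sum>I\<in>star J. (if sgn (l (V (apex J I))) = 1 then of_int (weight \<Delta> I) else 0) -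
         (if sgn (l (V (apex J I))) = -1 then of_int (weight \<Delta> I) else 0))"
    using ridge_apex_nonzero by (intro sum.cong) (auto simp: sgn_if)
  also have "\<dots> = of_int (\<Sum>I | I \<in> star J \<and> sgn (l (V (apex J I))) = 1. weight \<Delta> I)
      - of_int (\<Sum>I | I \<in> star J \<and> sgn (l (V (apex J I))) = -1. weight \<Delta> I)"
    by (simp only: sum_subtractf of_int_sum sum.inter_filter[OF finite_star] if_distrib[of of_int] of_int_0)
  finally show ?thesis using 1 2 by simp
qed

end

end

section \<open>Cancellation of residues\<close>

lemma real_tau_independent:
  assumes "Im \<tau> > 0" "complex_of_real a + of_real b * \<tau> = of_real c + of_real d * \<tau>"
  shows "a = c" "b = d"
proof -
  have "Im (complex_of_real a + of_real b * \<tau>) = Im (of_real c + of_real d * \<tau>)"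
    using assms by simp
  then show "b = d" using assms(1) by simp
  then show "a = c" using assms(2) by simp
qed

text \<open>The base point is \<open>r\<close>, the direction \<open>v0\<close>. Membership of
  \<open>v0\<close> in \<open>lat_V\<close> makes all its facet coordinates integers, as
  quasi-periodicity in the line parameter requires. The assumption \<open>u_eq\<close> is the form
  in which vanishing of the Chern class is used.\<close>

locale genus_line = simplicial_multifan_with_edges \<Delta> V
  for \<Delta> :: "('i, 'v::euclidean_space) multifan" and V :: "'i \<Rightarrow> 'v" +
  fixes u :: "'v \<Rightarrow> real" and \<tau> \<sigma> :: complex and r v0 :: 'v
  assumes tau: "Im \<tau> > 0"
    and u_eq: "\<And>I x. I \<in> facets \<Delta> \<Longrightarrow> x \<in> lat \<Delta> \<Longrightarrow> (\<Sum>i\<in>I. dual_basis V I i x) = u x"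
    and v0: "v0 \<in> lat_V \<Delta> V" and r: "r \<in> span (lat \<Delta>)"
begin

text \<open>This is \<open>phi_arg\<close> with \<open>z v\<close> replaced by the point
  \<open>r + x v0\<close>, and with lattice vectors in place of classes so that different facets can
  be compared at the same vectors.\<close>

definition farg :: "'i set \<Rightarrow> 'i \<Rightarrow> 'v \<Rightarrow> 'v \<Rightarrow> complex \<Rightarrow> complex" where
  "farg I i x1 x2 x = - (of_real (U I i r) + x * of_real (U I i v0) - \<tau> * of_real (U I i x1) + of_real (U I i x2))"

definition summand :: "'i set \<Rightarrow> 'v \<Rightarrow> 'v \<Rightarrow> complex \<Rightarrow> complex" where
  "summand I x1 x2 x = (\<Prod>i\<in>I. cis2pi (of_real (U I i x1) * \<sigma>) * theta_quot \<tau> \<sigma> (farg I i x1 x2 x))"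

definition facet_part :: "'i set \<Rightarrow> complex \<Rightarrow> complex" where
  "facet_part I x = (\<Sum>(h1, h2) \<in> (coset (LI I) ` L) \<times> (coset (LI I) ` L). summand I (rep h1) (rep h2) x)
      / of_nat (order (H_I \<Delta> V I))"

definition genus :: "complex \<Rightarrow> complex" where
  "genus x = (\<Sum>I\<in>facets \<Delta>. of_int (weight \<Delta> I) * facet_part I x)"

lemma v0_L: "v0 \<in> L" using v0 lat_V_subset_L by blast

lemma U_v0:
  assumes "I \<in> facets \<Delta>" "i \<in> I" obtains k :: int where "U I i v0 = of_int k"
  using U_LI_Ints[OF assms, of v0] v0 lat_V_subset[OF assms(1)] by (blast elim: Ints_cases)

text \<open>Moving \<open>x1\<close> by \<open>k1\<close> times an edge vector shifts one argument
  by \<open>k1 \<tau>\<close>; the resulting power of \<open>\<zeta>\<close> cancels the change of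
  the explicit prefactor. Moving \<open>x2\<close> shifts by an integer only.\<close>

lemma summand_cong:
  assumes "I \<in> facets \<Delta>" "x1 \<in> L" "x2 \<in> L" "y1 \<in> L" "y2 \<in> L" "x1 - y1 \<in> LI I" "x2 - y2 \<in> LI I"
  shows "summand I x1 x2 x = summand I y1 y2 x"
  unfolding summand_def
proof (rule prod.cong)
  fix i assume i: "i \<in> I"
  obtain k1 k2 :: int where k: "U I i (x1 - y1) = of_int k1" "U I i (x2 - y2) = of_int k2"
    using U_LI_Ints[OF assms(1) i] assms(6,7) by (meson Ints_cases)
  have U: "U I i x1 = U I i y1 + of_int k1" "U I i x2 = U I i y2 + of_int k2"
    using k assms by (auto simp: U_diff L_span)
  have "farg I i x1 x2 x = (farg I i y1 y2 x + of_int k1 * \<tau>) + of_int (- k2)"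
    unfolding farg_def U by (simp add: algebra_simps)
  then have "theta_quot \<tau> \<sigma> (farg I i x1 x2 x) = theta_quot \<tau> \<sigma> (farg I i y1 y2 x) * cis2pi (- of_int k1 * \<sigma>)"
    by (simp only: theta_quot_periodic theta_quot_shift_of_int[OF tau])
  moreover have "cis2pi (of_real (U I i x1) * \<sigma>) * cis2pi (- of_int k1 * \<sigma>) = cis2pi (of_real (U I i y1) * \<sigma>)"
    unfolding cis2pi_add[symmetric] U by (simp add: algebra_simps)
  ultimately show "cis2pi (of_real (U I i x1) * \<sigma>) * theta_quot \<tau> \<sigma> (farg I i x1 x2 x)
     = cis2pi (of_real (U I i y1) * \<sigma>) * theta_quot \<tau> \<sigma> (farg I i y1 y2 x)"
    by (metis mult.assoc mult.commute)
qed simp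

lemma summand_add_1:
  assumes "I \<in> facets \<Delta>"
  shows "summand I x1 x2 (x + 1) = summand I x1 x2 x"
  unfolding summand_def
proof (intro prod.cong refl arg_cong2[of _ _ _ _ "(*)"])
  fix i assume i: "i \<in> I"
  obtain k :: int where k: "U I i v0 = of_int k" using U_v0[OF assms i] .
  have "farg I i x1 x2 (x + 1) = farg I i x1 x2 x + of_int (- k)"
    unfolding farg_def k by (simp add: algebra_simps)
  then show "theta_quot \<tau> \<sigma> (farg I i x1 x2 (x + 1)) = theta_quot \<tau> \<sigma> (farg I i x1 x2 x)"
    by (simp only: theta_quot_periodic)
qed

text \<open>The factors contribute \<open>\<zeta>\<close> to the powers \<open>U I i v0\<close>, and
  \<open>u_eq\<close> adds these up to the facet-independent exponent \<open>u v0\<close>.\<close>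

lemma summand_add_tau:
  assumes "I \<in> facets \<Delta>"
  shows "summand I x1 x2 (x + \<tau>) = cis2pi (of_real (u v0) * \<sigma>) * summand I x1 x2 x"
proof -
  have *: "theta_quot \<tau> \<sigma> (farg I i x1 x2 (x + \<tau>)) = cis2pi (of_real (U I i v0) * \<sigma>) * theta_quot \<tau> \<sigma> (farg I i x1 x2 x)"
    if i: "i \<in> I" for i
  proof -
    obtain k :: int where k: "U I i v0 = of_int k" using U_v0[OF assms i] .
    have "farg I i x1 x2 (x + \<tau>) = farg I i x1 x2 x + of_int (- k) * \<tau>"
      unfolding farg_def k by (simp add: algebra_simps)
    then have "theta_quot \<tau> \<sigma> (farg I i x1 x2 (x + \<tau>)) = theta_quot \<tau> \<sigma> (farg I i x1 x2 x) * cis2pi (- of_int (- k) * \<sigma>)"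
      by (simp only: theta_quot_shift_of_int[OF tau])
    then show ?thesis by (simp add: k)
  qed
  have "summand I x1 x2 (x + \<tau>) = (\<Prod>i\<in>I. cis2pi (of_real (U I i v0) * \<sigma>) * (cis2pi (of_real (U I i x1) * \<sigma>) * theta_quot \<tau> \<sigma> (farg I i x1 x2 x)))"
    unfolding summand_def by (intro prod.cong refl) (simp add: *)
  also have "\<dots> = (\<Prod>i\<in>I. cis2pi (of_real (U I i v0) * \<sigma>)) * summand I x1 x2 x"
    by (simp add: prod.distrib summand_def)
  also have "(\<Prod>i\<in>I. cis2pi (of_real (U I i v0) * \<sigma>)) = cis2pi (of_real (u v0) * \<sigma>)"
    using u_eq[OF assms v0_L] finite_facet[OF assms] by (simp add: cis2pi_sum[symmetric] sum_distrib_right[symmetric] of_real_sum[symmetric] del: of_real_sum)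
  finally show ?thesis .
qed

lemma genus_add_1: "genus (x + 1) = genus x"
  unfolding genus_def facet_part_def by (intro sum.cong refl) (simp add: summand_add_1)

lemma genus_add_tau: "genus (x + \<tau>) = cis2pi (of_real (u v0) * \<sigma>) * genus x"
proof -
  have "facet_part I (x + \<tau>) = cis2pi (of_real (u v0) * \<sigma>) * facet_part I x" if "I \<in> facets \<Delta>" for I
    using that by (simp add: facet_part_def summand_add_tau sum_distrib_left case_prod_unfold)
  then show ?thesis by (simp add: genus_def sum_distrib_left mult_ac)
qed

lemma genus_meromorphic: "genus meromorphic_on UNIV"
proof -
  have "(\<lambda>x. farg I i x1 x2 x) holomorphic_on UNIV" for I i x1 x2
    unfolding farg_def by (intro holomorphic_intros)
  then show ?thesis
    unfolding genus_def facet_part_def summand_def case_prod_unfold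
    by (intro meromorphic_intros theta_quot_meromorphic tau)
qed

lemma isCont_factor:
  assumes "farg I i x1 x2 p \<notin> poles \<tau>"
  shows "isCont (\<lambda>x. cis2pi (of_real (U I i x1) * \<sigma>) * theta_quot \<tau> \<sigma> (farg I i x1 x2 x)) p"
proof -
  have "(\<lambda>x. farg I i x1 x2 x) analytic_on {p}"
    unfolding farg_def by (intro analytic_intros)
  then have "(\<lambda>x. theta_quot \<tau> \<sigma> (farg I i x1 x2 x)) analytic_on {p}"
    using theta_quot_analytic[OF tau] assms by blast
  then show ?thesis
    by (intro continuous_intros analytic_at_imp_isCont)
qed

lemma isCont_summand:
  assumes "\<And>i. i \<in> I \<Longrightarrow> farg I i x1 x2 p \<notin> poles \<tau>"
  shows "isCont (summand I x1 x2) p"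
  unfolding summand_def by (intro continuous_prod isCont_factor assms)

lemma tendsto_0_of_isCont:
  fixes f :: "complex \<Rightarrow> complex"
  assumes "isCont f p"
  shows "((\<lambda>x. (x - p) * f x) \<longlongrightarrow> 0) (at p)"
proof -
  have "((\<lambda>x. (x - p) * f x) \<longlongrightarrow> (p - p) * f p) (at p)"
    using assms by (intro tendsto_intros) (auto simp: isCont_def)
  then show ?thesis by simp
qed

text \<open>A necessary condition for a pole of factor \<open>i\<close> at \<open>p\<close>.
  Rational instead of integral coefficients make it independent of the lattice vectors
  \<open>x1\<close> and \<open>x2\<close>.\<close>

definition polar :: "'i set \<Rightarrow> 'i \<Rightarrow> complex \<Rightarrow> bool" where
  "polar I i p \<longleftrightarrow> (\<exists>a\<in>\<rat>. \<exists>b\<in>\<rat>. of_real (U I i r) + p * of_real (U I i v0) = of_real a + of_real b * \<tau>)"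

lemma polarI:
  assumes "I \<in> facets \<Delta>" "i \<in> I" "x1 \<in> L" "x2 \<in> L" "farg I i x1 x2 p \<in> poles \<tau>"
  shows "polar I i p"
proof -
  obtain a b :: int where ab: "farg I i x1 x2 p = of_int a + of_int b * \<tau>"
    using assms(5) by (auto simp: poles_iff)
  then have "of_real (U I i r) + p * of_real (U I i v0) =
      of_real (- U I i x2 - of_int a) + of_real (U I i x1 - of_int b) * \<tau>"
    by (simp add: farg_def algebra_simps add_eq_0_iff)
  moreover have "- U I i x2 - of_int a \<in> \<rat>" "U I i x1 - of_int b \<in> \<rat>"
    using U_L_Rats[OF assms(1,2)] assms(3,4) by auto
  ultimately show ?thesis unfolding polar_def by blast
qed

lemma isCont_facet_part:
  assumes I: "I \<in> facets \<Delta>"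
    and "\<And>i x1 x2. i \<in> I \<Longrightarrow> x1 \<in> L \<Longrightarrow> x2 \<in> L \<Longrightarrow> farg I i x1 x2 p \<notin> poles \<tau>"
  shows "isCont (facet_part I) p"
proof -
  have "rep h \<in> L" if "h \<in> coset (LI I) ` L" for h
    using rep_H_I(1)[OF that] I by (simp add: facets_iff)
  then show ?thesis
    unfolding facet_part_def case_prod_unfold
    using order_H_I_pos[OF I]
    by (intro continuous_divide continuous_sum isCont_summand assms continuous_const) auto
qed

end

text \<open>\<open>gen1\<close> keeps the parameter 0 regular and excludes a factor that is singular
  all along the line; \<open>gen2\<close> keeps two factors of one facet from being polar
  together.\<close>

locale generic_genus_line = genus_line +
  assumes gen1: "\<And>I i. I \<in> facets \<Delta> \<Longrightarrow> i \<in> I \<Longrightarrow> dual_basis V I i r \<notin> \<rat>"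
    and gen2: "\<And>I i j. I \<in> facets \<Delta> \<Longrightarrow> i \<in> I \<Longrightarrow> j \<in> I \<Longrightarrow> i \<noteq> j \<Longrightarrow> dual_basis V I j v0 \<noteq> 0 \<Longrightarrow>
      dual_basis V I j v0 * dual_basis V I i r - dual_basis V I i v0 * dual_basis V I j r \<notin> \<rat>"
    and balanced: "\<And>J. J \<in> simplices \<Delta> \<Longrightarrow> pre_complete (projected \<Delta> J)"
begin

text \<open>With \<open>p = s + t \<tau>\<close>, both conditions make an expression in
  \<open>s\<close> rational. Eliminating \<open>s\<close> yields exactly the combination that
  \<open>gen2\<close> declares irrational.\<close>

lemma polar_unique:
  assumes I: "I \<in> facets \<Delta>" "i \<in> I" "j \<in> I" and p: "polar I i p" "polar I j p"
  shows "i = j"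
proof (rule ccontr)
  assume ne: "i \<noteq> j"
  obtain s t :: real where st: "p = of_real s + of_real t * \<tau>"
    using decompose_over_tau[OF tau] .
  have *: "\<exists>a\<in>\<rat>. U I k r + s * U I k v0 = a" if pk: "polar I k p" for k
  proof -
    obtain a b where ab: "a \<in> \<rat>" "of_real (U I k r) + p * of_real (U I k v0) = of_real a + of_real b * \<tau>"
      using pk by (auto simp: polar_def)
    have "complex_of_real (U I k r + s * U I k v0) + of_real (t * U I k v0) * \<tau> = of_real a + of_real b * \<tau>"
      using ab(2) by (simp add: st algebra_simps)
    from real_tau_independent(1)[OF tau this] ab(1) show ?thesis by blast
  qed
  obtain a a' where a: "a \<in> \<rat>" "U I i r + s * U I i v0 = a" and a': "a' \<in> \<rat>" "U I j r + s * U I j v0 = a'"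
    using *[OF p(1)] *[OF p(2)] by blast
  have "U I j v0 \<noteq> 0" using a' gen1[OF I(1,3)] by auto
  moreover have "U I j v0 * U I i r - U I i v0 * U I j r = U I j v0 * a - U I i v0 * a'"
    unfolding a(2)[symmetric] a'(2)[symmetric] by (simp add: algebra_simps)
  moreover have "U I j v0 * a - U I i v0 * a' \<in> \<rat>"
    using a(1) a'(1) U_L_Rats[OF I(1) _ v0_L] I by (intro Rats_diff Rats_mult) auto
  ultimately show False using gen2[OF I ne] by simp
qed

text \<open>The point \<open>r + p v0\<close> has height \<open>A \<tau> + B\<close> over the ridge.
  In each facet of the star only the apex factor can be singular there, and only for pairs of
  classes with representatives at heights \<open>A\<close> and \<open>- B\<close>; the other factors
  are determined by the ridge.\<close>

lemma ridge_residue: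
  assumes l: "ridge_functional J l"
    and AB: "of_real (l r) + p * of_real (l v0) = of_int A * \<tau> + of_int B"
  shows "\<exists>C. \<forall>I\<in>star J. ((\<lambda>x. (x - p) * facet_part I x) \<longlongrightarrow> of_real (sgn (l (V (apex J I)))) * C) (at p)"
proof -
  have J: "is_ridge J" using l by (rule ridge)
  have fJ: "finite J" using J by (simp add: is_ridge_def finite_simplex)
  note lin = linear_add[OF ridge_linear[OF l]] linear_diff[OF ridge_linear[OF l]] linear_scale[OF ridge_linear[OF l]]
  obtain s t :: real where st: "p = of_real s + of_real t * \<tau>"
    using decompose_over_tau[OF tau] .
  have "complex_of_real (l r + s * l v0) + of_real (t * l v0) * \<tau> = of_real (of_int B) + of_real (of_int A) * \<tau>"
    using AB by (simp add: st algebra_simps)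
  from real_tau_independent[OF tau this] have lst: "l r + s * l v0 = of_int B" "t * l v0 = of_int A" by auto
  obtain R where R: "((\<lambda>z. z * theta_quot \<tau> \<sigma> z) \<longlongrightarrow> R) (at 0)"
    using theta_quot_residue[OF tau] by blast
  have L_in_span: "v0 \<in> span L" using v0_L by (rule L_span)
  \<comment> \<open>Otherwise the apex coordinate of \<open>r\<close> would be a quotient of
    integers, against \<open>gen1\<close>.\<close>
  have lv0: "l v0 \<noteq> 0"
  proof
    assume 0: "l v0 = 0"
    obtain I where I: "I \<in> star J" using star_nonempty[OF J] by blast
    note I' = star_facet[OF I] apex[OF J I]
    have Vi: "l (V (apex J I)) \<in> \<rat>"
      using ridge_Ints[OF l V_facet_in_L[OF I'(1,4)]] Ints_subset_Rats by blast
    have "U I (apex J I) r = of_int B / l (V (apex J I))"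
      using U_apex[OF l I r] lst 0 by simp
    then have "U I (apex J I) r \<in> \<rat>" using Vi by simp
    then show False using gen1[OF I'(1,4)] by simp
  qed
  \<comment> \<open>For representatives at heights \<open>A\<close> and \<open>- B\<close> both
    vectors have height 0 and so lie in the span of the ridge. Thus \<open>- c j x1 x2\<close> is
    the argument of factor \<open>j\<close> at \<open>p\<close>, written without reference to a
    facet.\<close>
  define c where "c j x1 x2 = complex_of_real (representation (V ` J) (r + s *\<^sub>R v0 + x2) (V j))
      + \<tau> * of_real (representation (V ` J) (t *\<^sub>R v0 - x1) (V j))" for j x1 x2
  define S where "S = (\<Sum>c1\<in>fibre J l A. \<Sum>c2\<in>fibre J l (- B).
     cis2pi (of_real (u (rep c1)) * \<sigma>) * (\<Prod>j\<in>J. theta_quot \<tau> \<sigma> (- c j (rep c1) (rep c2))))"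
  \<comment> \<open>The apex factor has residue \<open>- m * R / l v0\<close>, the remaining factors
    sum to \<open>S\<close>, and the group order is
    \<open>\<bar>m\<bar> * card (fibre J l 0)\<close>; \<open>C\<close> is what is left when
    \<open>m / \<bar>m\<bar>\<close> is split off.\<close>
  define C where "C = - R * S / (of_real (l v0) * of_nat (card (fibre J l 0)))"
  have "((\<lambda>x. (x - p) * facet_part I x) \<longlongrightarrow> of_real (sgn (l (V (apex J I)))) * C) (at p)" if I: "I \<in> star J" for I
  proof -
    note I' = star_facet[OF I] apex[OF J I]
    have Is: "I \<in> simplices \<Delta>" using I'(1) by (simp add: facets_iff)
    define i where "i = apex J I"
    have i: "i \<notin> J" "I = insert i J" "i \<in> I" using I' by (auto simp: i_def)
    have Vi: "V i \<in> L" using V_facet_in_L[OF I'(1) i(3)] .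
    obtain m :: int where m: "l (V i) = of_int m" using ridge_Ints[OF l Vi] by (auto elim: Ints_cases)
    have m0: "m \<noteq> 0" using ridge_apex_nonzero[OF l I] m by (auto simp: i_def)
    have Ui: "U I i x = l x / of_int m" if "x \<in> span L" for x
      using U_apex[OF l I that] m by (simp add: i_def)
    have arg_i: "farg I i x1 x2 x = - (of_real (l r) + x * of_real (l v0) - \<tau> * of_real (l x1) + of_real (l x2)) / of_int m"
      if "x1 \<in> L" "x2 \<in> L" for x1 x2 x
      using that m0 by (simp add: farg_def Ui r L_in_span L_span field_simps)
    have polar_i: "polar I i p"
    proof -
      have "of_real (U I i r) + p * of_real (U I i v0) = of_real (of_int B / of_int m) + of_real (of_int A / of_int m) * \<tau>"
        using AB m0 by (simp add: Ui r L_in_span field_simps)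
      then show ?thesis unfolding polar_def by (metis Rats_divide Rats_of_int)
    qed
    have reg_j: "farg I j x1 x2 p \<notin> poles \<tau>" if "j \<in> J" "x1 \<in> L" "x2 \<in> L" for j x1 x2
    proof
      assume pole: "farg I j x1 x2 p \<in> poles \<tau>"
      have j: "j \<in> I" using that(1) i(2) by blast
      have "i = j"
        by (rule polar_unique[OF I'(1) i(3) j polar_i polarI[OF I'(1) j that(2,3) pole]])
      then show False using i(1) that(1) by blast
    qed
    \<comment> \<open>The elements of \<open>L / L_I\<close> that have some representative at height
      \<open>a\<close>; these are the images of \<open>fibre J l a\<close>.\<close>
    define Hit where "Hit a = {h \<in> coset (LI I) ` L. \<exists>x\<in>L. h = coset (LI I) x \<and> l x = of_int a}" for a
    have fin: "finite (coset (LI I) ` L)" by (rule finite_H_I[OF I'(1)])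
    have reg_i: "farg I i x1 x2 p \<notin> poles \<tau>"
      if x: "x1 \<in> L" "x2 \<in> L" and miss: "coset (LI I) x1 \<notin> Hit A \<or> coset (LI I) x2 \<notin> Hit (- B)" for x1 x2
    proof
      assume "farg I i x1 x2 p \<in> poles \<tau>"
      then obtain a b :: int where "farg I i x1 x2 p = of_int a + of_int b * \<tau>" by (auto simp: poles_iff)
      then have "- (of_int A * \<tau> + of_int B - \<tau> * of_real (l x1) + of_real (l x2)) = of_int m * (of_int a + of_int b * \<tau>)"
        using m0 by (simp add: arg_i[OF x] AB field_simps)
      then have "complex_of_real (- of_int B - l x2) + of_real (l x1 - of_int A) * \<tau> = of_real (of_int m * of_int a) + of_real (of_int m * of_int b) * \<tau>"
        by (simp add: algebra_simps)
      from real_tau_independent[OF tau this] have l12: "l x1 = of_int A + of_int m * of_int b" "l x2 = - of_int B - of_int m * of_int a"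
        by auto
      \<comment> \<open>A pole puts \<open>x1\<close> and \<open>x2\<close> at heights
        \<open>A + m b\<close> and \<open>- B - m a\<close>; subtracting \<open>b\<close> times,
        respectively adding \<open>a\<close> times, the apex edge vector corrects this within the
        same classes.\<close>
      have ViI: "V i \<in> LI I"
        unfolding lat_I_def using i finite_facet[OF I'(1)] by (intro int_span_base) auto
      have "of_int b *\<^sub>R V i \<in> LI I" "of_int (- a) *\<^sub>R V i \<in> LI I"
        using ViI unfolding lat_I_def by (auto intro: int_span_scale simp del: of_int_minus)
      then have "coset (LI I) x1 = coset (LI I) (x1 - of_int b *\<^sub>R V i)"
          "coset (LI I) x2 = coset (LI I) (x2 - of_int (- a) *\<^sub>R V i)"
        by (simp_all add: coset_LI_eq)
      moreover have "x1 - of_int b *\<^sub>R V i \<in> L" "x2 - of_int (- a) *\<^sub>R V i \<in> L"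
        by (intro L_diff L_scale x Vi)+
      moreover have "l (x1 - of_int b *\<^sub>R V i) = of_int A" "l (x2 - of_int (- a) *\<^sub>R V i) = of_int (- B)"
        by (simp_all add: lin l12 m)
      ultimately have "coset (LI I) x1 \<in> Hit A" "coset (LI I) x2 \<in> Hit (- B)"
        unfolding Hit_def by blast+
      then show False using miss by blast
    qed
    define rest where "rest = (coset (LI I) ` L) \<times> (coset (LI I) ` L) - Hit A \<times> Hit (- B)"
    have Hit_sub: "Hit A \<times> Hit (- B) \<subseteq> (coset (LI I) ` L) \<times> (coset (LI I) ` L)" by (auto simp: Hit_def)
    have rest0: "((\<lambda>x. (x - p) * (\<Sum>(h1, h2)\<in>rest. summand I (rep h1) (rep h2) x)) \<longlongrightarrow> 0) (at p)"
    proof (rule tendsto_0_of_isCont)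
      have "isCont (summand I (rep (fst h)) (rep (snd h))) p" if "h \<in> rest" for h
      proof (rule isCont_summand)
        fix k assume k: "k \<in> I"
        have h: "fst h \<in> coset (LI I) ` L" "snd h \<in> coset (LI I) ` L"
          "fst h \<notin> Hit A \<or> snd h \<notin> Hit (- B)" using that by (auto simp: rest_def)
        note rp = rep_H_I[OF h(1) Is] rep_H_I[OF h(2) Is]
        show "farg I k (rep (fst h)) (rep (snd h)) p \<notin> poles \<tau>"
        proof (cases "k = i")
          case True
          then show ?thesis using reg_i[OF rp(1,3)] h(3) rp(2,4) by simp
        next
          case False
          then show ?thesis using reg_j[OF _ rp(1,3)] k i by blast
        qed
      qed
      then show "isCont (\<lambda>x. \<Sum>(h1, h2)\<in>rest. summand I (rep h1) (rep h2) x) p"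
        unfolding case_prod_unfold by (intro continuous_sum)
    qed
    have residue: "((\<lambda>x. (x - p) * summand I (rep c1) (rep c2) x) \<longlongrightarrow>
        (- of_int m * R / of_real (l v0)) * (cis2pi (of_real (u (rep c1)) * \<sigma>) * (\<Prod>j\<in>J. theta_quot \<tau> \<sigma> (- c j (rep c1) (rep c2))))) (at p)"
      if c12: "c1 \<in> fibre J l A" "c2 \<in> fibre J l (- B)" for c1 c2
    proof -
      define x1 where "x1 = rep c1"
      define x2 where "x2 = rep c2"
      have x: "x1 \<in> L" "x2 \<in> L" "l x1 = of_int A" "l x2 = - of_int B"
        using rep_fibre[OF l c12(1)] rep_fibre[OF l c12(2)] by (auto simp: x1_def x2_def)
      have argj: "farg I j x1 x2 p = - c j x1 x2" if "j \<in> J" for j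
      proof -
        have 1: "r + s *\<^sub>R v0 + x2 \<in> span L" "t *\<^sub>R v0 - x1 \<in> span L"
          by (intro span_add span_diff span_scale r L_span v0_L x)+
        have 2: "l (r + s *\<^sub>R v0 + x2) = 0" "l (t *\<^sub>R v0 - x1) = 0"
          using lst x by (auto simp: lin)
        note k = ridge_kernel[OF l 1(1) 2(1)] ridge_kernel[OF l 1(2) 2(2)]
        have "c j x1 x2 = of_real (U I j (r + s *\<^sub>R v0 + x2)) + \<tau> * of_real (U I j (t *\<^sub>R v0 - x1))"
          unfolding c_def using U_ridge[OF l I that k(1)] U_ridge[OF l I that k(2)] by simp
        also have "U I j (r + s *\<^sub>R v0 + x2) = U I j r + s * U I j v0 + U I j x2"
          using I'(1) by (simp add: U_add U_scale r L_in_span span_add span_scale L_span x)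
        also have "U I j (t *\<^sub>R v0 - x1) = t * U I j v0 - U I j x1"
          using I'(1) by (simp add: U_diff U_scale r L_in_span span_scale L_span x)
        finally show ?thesis by (simp add: farg_def st algebra_simps)
      qed
      have factor_i: "((\<lambda>x. (x - p) * theta_quot \<tau> \<sigma> (farg I i x1 x2 x)) \<longlongrightarrow> (- of_int m / of_real (l v0)) * R) (at p)"
      proof -
        have arg_eq: "farg I i x1 x2 x = (x - p) * (- of_real (l v0) / of_int m)" for x
        proof -
          have lr: "of_real (l r) = of_int A * \<tau> + of_int B - p * of_real (l v0)"
            using AB by (simp add: algebra_simps)
          have "- (of_real (l r) + x * of_real (l v0) - \<tau> * of_real (l x1) + of_real (l x2)) = (x - p) * - of_real (l v0)"
            unfolding lr x(3,4) by (simp add: algebra_simps)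
          then show ?thesis unfolding arg_i[OF x(1,2)] by (simp only: times_divide_eq_right)
        qed
        have "filterlim (\<lambda>x. (x - p) * (- of_real (l v0) / of_int m)) (at 0) (at p)"
        proof (rule filterlim_atI)
          have "((\<lambda>x. (x - p) * (- of_real (l v0) / of_int m)) \<longlongrightarrow> (p - p) * (- of_real (l v0) / of_int m)) (at p)"
            by (intro tendsto_intros)
          then show "((\<lambda>x. (x - p) * (- of_real (l v0) / of_int m)) \<longlongrightarrow> 0) (at p)" by simp
          show "\<forall>\<^sub>F x in at p. (x - p) * (- of_real (l v0) / of_int m) \<noteq> 0"
            using lv0 m0 by (auto simp: eventually_at_filter)
        qed
        then have "((\<lambda>x. farg I i x1 x2 x * theta_quot \<tau> \<sigma> (farg I i x1 x2 x)) \<longlongrightarrow> R) (at p)"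
          unfolding arg_eq by (rule filterlim_compose[OF R])
        then have "((\<lambda>x. (- of_int m / of_real (l v0)) * (farg I i x1 x2 x * theta_quot \<tau> \<sigma> (farg I i x1 x2 x)))
            \<longlongrightarrow> (- of_int m / of_real (l v0)) * R) (at p)"
          by (intro tendsto_intros)
        moreover have "(- of_int m / of_real (l v0)) * (farg I i x1 x2 x * w) = (x - p) * w" for x w
          unfolding arg_eq using lv0 m0 by simp
        ultimately show ?thesis by simp
      qed
      \<comment> \<open>Here \<open>u_eq\<close> replaces a product over the facet by a quantity
        that depends on \<open>x1\<close> alone.\<close>
      have cis: "cis2pi (of_real (u x1) * \<sigma>) = cis2pi (of_real (U I i x1) * \<sigma>) * (\<Prod>j\<in>J. cis2pi (of_real (U I j x1) * \<sigma>))"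
      proof -
        have "u x1 = U I i x1 + (\<Sum>j\<in>J. U I j x1)"
          using u_eq[OF I'(1) x(1)] i fJ by simp
        then have "complex_of_real (u x1) * \<sigma> = of_real (U I i x1) * \<sigma> + (\<Sum>j\<in>J. of_real (U I j x1) * \<sigma>)"
          by (simp add: distrib_right sum_distrib_right)
        then show ?thesis by (simp add: cis2pi_add cis2pi_sum[OF fJ])
      qed
      have "((\<lambda>x. (cis2pi (of_real (U I i x1) * \<sigma>) * ((x - p) * theta_quot \<tau> \<sigma> (farg I i x1 x2 x))) *
          (\<Prod>j\<in>J. cis2pi (of_real (U I j x1) * \<sigma>) * theta_quot \<tau> \<sigma> (farg I j x1 x2 x))) \<longlongrightarrow>
          (cis2pi (of_real (U I i x1) * \<sigma>) * ((- of_int m / of_real (l v0)) * R)) *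
          (\<Prod>j\<in>J. cis2pi (of_real (U I j x1) * \<sigma>) * theta_quot \<tau> \<sigma> (farg I j x1 x2 p))) (at p)"
        using isCont_factor[OF reg_j[OF _ x(1,2)]] unfolding isCont_def
        by (intro tendsto_mult[OF tendsto_mult[OF tendsto_const factor_i]] tendsto_prod)
      moreover have "(cis2pi (of_real (U I i x1) * \<sigma>) * ((x - p) * theta_quot \<tau> \<sigma> (farg I i x1 x2 x))) *
          (\<Prod>j\<in>J. cis2pi (of_real (U I j x1) * \<sigma>) * theta_quot \<tau> \<sigma> (farg I j x1 x2 x)) = (x - p) * summand I x1 x2 x" for x
        unfolding summand_def i(2) using i(1) fJ by (simp add: mult_ac)
      moreover have "(cis2pi (of_real (U I i x1) * \<sigma>) * ((- of_int m / of_real (l v0)) * R)) *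
          (\<Prod>j\<in>J. cis2pi (of_real (U I j x1) * \<sigma>) * theta_quot \<tau> \<sigma> (farg I j x1 x2 p)) =
         (- of_int m * R / of_real (l v0)) * (cis2pi (of_real (u x1) * \<sigma>) * (\<Prod>j\<in>J. theta_quot \<tau> \<sigma> (- c j x1 x2)))"
        unfolding cis by (simp add: prod.distrib argj)
      ultimately show ?thesis unfolding x1_def[symmetric] x2_def[symmetric] by (simp only:)
    qed
    \<comment> \<open>Reindexing by the fibres; \<open>summand_cong\<close> then exchanges the
      representatives modulo \<open>LI I\<close> for those of the classes modulo
      \<open>LI J\<close>, which are common to all facets at the ridge.\<close>
    have hits: "(\<Sum>(h1, h2)\<in>Hit A \<times> Hit (- B). summand I (rep h1) (rep h2) x) =
        (\<Sum>c1\<in>fibre J l A. \<Sum>c2\<in>fibre J l (- B). summand I (rep c1) (rep c2) x)" for x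
    proof -
      have "(\<Sum>(h1, h2)\<in>Hit A \<times> Hit (- B). summand I (rep h1) (rep h2) x) = (\<Sum>h1\<in>Hit A. \<Sum>h2\<in>Hit (- B). summand I (rep h1) (rep h2) x)"
        by (simp add: sum.cartesian_product)
      also have "\<dots> = (\<Sum>c1\<in>fibre J l A. \<Sum>h2\<in>Hit (- B). summand I (rep (coset (LI I) (rep c1))) (rep h2) x)"
        unfolding Hit_def by (rule sum.reindex_bij_betw[OF bij_betw_fibre[OF l I], symmetric])
      also have "\<dots> = (\<Sum>c1\<in>fibre J l A. \<Sum>c2\<in>fibre J l (- B). summand I (rep (coset (LI I) (rep c1))) (rep (coset (LI I) (rep c2))) x)"
        unfolding Hit_def by (intro sum.cong refl sum.reindex_bij_betw[OF bij_betw_fibre[OF l I], symmetric])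
      also have "\<dots> = (\<Sum>c1\<in>fibre J l A. \<Sum>c2\<in>fibre J l (- B). summand I (rep c1) (rep c2) x)"
      proof (intro sum.cong refl)
        fix c1 c2 assume "c1 \<in> fibre J l A" "c2 \<in> fibre J l (- B)"
        then have "rep c1 \<in> L" "rep c2 \<in> L" using rep_fibre[OF l] by blast+
        moreover have "rep (coset (LI I) x) \<in> L" "rep (coset (LI I) x) - x \<in> LI I" if "x \<in> L" for x
          using that rep_H_I(1)[OF _ Is] rep_coset unfolding lat_I_def by blast+
        ultimately show "summand I (rep (coset (LI I) (rep c1))) (rep (coset (LI I) (rep c2))) x = summand I (rep c1) (rep c2) x"
          by (intro summand_cong I'(1)) auto
      qed
      finally show ?thesis .
    qed
    have "((\<lambda>x. (\<Sum>c1\<in>fibre J l A. \<Sum>c2\<in>fibre J l (- B). (x - p) * summand I (rep c1) (rep c2) x) +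
          (x - p) * (\<Sum>(h1, h2)\<in>rest. summand I (rep h1) (rep h2) x)) \<longlongrightarrow>
        (\<Sum>c1\<in>fibre J l A. \<Sum>c2\<in>fibre J l (- B). (- of_int m * R / of_real (l v0)) * (cis2pi (of_real (u (rep c1)) * \<sigma>) * (\<Prod>j\<in>J. theta_quot \<tau> \<sigma> (- c j (rep c1) (rep c2))))) + 0) (at p)"
      by (intro tendsto_add rest0 tendsto_sum residue)
    moreover have "(\<Sum>c1\<in>fibre J l A. \<Sum>c2\<in>fibre J l (- B). (x - p) * summand I (rep c1) (rep c2) x) +
          (x - p) * (\<Sum>(h1, h2)\<in>rest. summand I (rep h1) (rep h2) x) =
        (x - p) * (\<Sum>(h1, h2) \<in> (coset (LI I) ` L) \<times> (coset (LI I) ` L). summand I (rep h1) (rep h2) x)" for x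
    proof -
      have "(\<Sum>(h1, h2) \<in> (coset (LI I) ` L) \<times> (coset (LI I) ` L). summand I (rep h1) (rep h2) x) =
         (\<Sum>(h1, h2)\<in>rest. summand I (rep h1) (rep h2) x) + (\<Sum>(h1, h2)\<in>Hit A \<times> Hit (- B). summand I (rep h1) (rep h2) x)"
        unfolding rest_def using fin Hit_sub by (intro sum.subset_diff) auto
      then show ?thesis by (simp only: hits) (simp add: sum_distrib_left distrib_left)
    qed
    moreover have "(\<Sum>c1\<in>fibre J l A. \<Sum>c2\<in>fibre J l (- B). (- of_int m * R / of_real (l v0)) * (cis2pi (of_real (u (rep c1)) * \<sigma>) * (\<Prod>j\<in>J. theta_quot \<tau> \<sigma> (- c j (rep c1) (rep c2))))) + 0
       = (- of_int m * R / of_real (l v0)) * S"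
      unfolding S_def by (simp only: sum_distrib_left add_0_right)
    ultimately have "((\<lambda>x. (x - p) * (\<Sum>(h1, h2) \<in> (coset (LI I) ` L) \<times> (coset (LI I) ` L). summand I (rep h1) (rep h2) x))
        \<longlongrightarrow> (- of_int m * R / of_real (l v0)) * S) (at p)" by (simp only:)
    then have lim: "((\<lambda>x. (x - p) * (\<Sum>(h1, h2) \<in> (coset (LI I) ` L) \<times> (coset (LI I) ` L). summand I (rep h1) (rep h2) x) * inverse (of_nat (order (H_I \<Delta> V I))))
        \<longlongrightarrow> (- of_int m * R / of_real (l v0)) * S * inverse (of_nat (order (H_I \<Delta> V I)))) (at p)"
      by (rule tendsto_mult_right)
    \<comment> \<open>The absolute value of the apex height in the group order cancels the
      \<open>m\<close> of the residue up to sign.\<close>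
    have "of_nat (order (H_I \<Delta> V I)) = complex_of_real \<bar>l (V i)\<bar> * of_nat (card (fibre J l 0))"
      using arg_cong[OF order_H_I_star[OF l I], of complex_of_real] by (simp add: i_def)
    then have lim_value: "(- of_int m * R / of_real (l v0)) * S * inverse (of_nat (order (H_I \<Delta> V I))) = of_real (sgn (l (V i))) * C"
      unfolding C_def m using m0 lv0
      by (auto simp: sgn_if divide_simps)
    have "(x - p) * facet_part I x = (x - p) * (\<Sum>(h1, h2) \<in> (coset (LI I) ` L) \<times> (coset (LI I) ` L). summand I (rep h1) (rep h2) x) * inverse (of_nat (order (H_I \<Delta> V I)))" for x
      by (simp only: facet_part_def divide_inverse mult.assoc)
    then show ?thesis using lim unfolding i_def[symmetric] by (simp only: lim_value)
  qed
  then show ?thesis by blast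
qed

text \<open>Residues are collected by ridge instead of by facet; at each ridge they share the
  constant \<open>C J\<close>, whose total coefficient is the balanced sum of signed
  weights.\<close>

lemma genus_no_pole: "((\<lambda>x. (x - p) * genus x) \<longlongrightarrow> 0) (at p)"
proof -
  define l where "l J = (SOME l. ridge_functional J l)" for J
  have l: "ridge_functional J (l J)" if "is_ridge J" for J
    unfolding l_def using ridge_functional_exists[OF that] by (rule someI_ex)
  \<comment> \<open>The ridges at which \<open>ridge_residue\<close> applies for this
    \<open>p\<close>.\<close>
  define \<R> where "\<R> = {J. is_ridge J \<and> (\<exists>A B. of_real (l J r) + p * of_real (l J v0) = of_int A * \<tau> + of_int B)}"
  have fin: "finite \<R>"
    using finite_simplices by (rule rev_finite_subset) (auto simp: \<R>_def is_ridge_def)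
  have "\<exists>C. \<forall>I\<in>star J. ((\<lambda>x. (x - p) * facet_part I x) \<longlongrightarrow> of_real (sgn (l J (V (apex J I)))) * C) (at p)" if "J \<in> \<R>" for J
    using that ridge_residue[OF l, of J] by (auto simp: \<R>_def)
  then obtain C where C: "\<And>J I. J \<in> \<R> \<Longrightarrow> I \<in> star J \<Longrightarrow> ((\<lambda>x. (x - p) * facet_part I x) \<longlongrightarrow> of_real (sgn (l J (V (apex J I)))) * C J) (at p)"
    by metis
  have lim: "((\<lambda>x. (x - p) * facet_part I x) \<longlongrightarrow> (\<Sum>J | J \<in> \<R> \<and> J \<subseteq> I. of_real (sgn (l J (V (apex J I)))) * C J)) (at p)"
    if I: "I \<in> facets \<Delta>" for I
  proof (cases "\<exists>J\<in>\<R>. J \<subseteq> I")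
    case True
    then obtain J where J: "J \<in> \<R>" "J \<subseteq> I" by blast
    have polar: "polar I (apex K I) p" if K: "K \<in> \<R>" "K \<subseteq> I" for K
    proof -
      have rK: "is_ridge K" using K by (simp add: \<R>_def)
      have IK: "I \<in> star K" using I K by (simp add: star_def)
      obtain A B where AB: "of_real (l K r) + p * of_real (l K v0) = of_int A * \<tau> + of_int B"
        using K by (auto simp: \<R>_def)
      have "V (apex K I) \<in> L" using V_facet_in_L[OF I] apex[OF rK IK] by blast
      from ridge_Ints[OF l[OF rK] this] obtain m :: int where m: "l K (V (apex K I)) = of_int m" by (auto elim: Ints_cases)
      have m0: "m \<noteq> 0" using ridge_apex_nonzero[OF l[OF rK] IK] m by auto
      have "of_real (U I (apex K I) r) + p * of_real (U I (apex K I) v0) = of_real (of_int B / of_int m) + of_real (of_int A / of_int m) * \<tau>"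
        using AB m0 by (simp add: U_apex[OF l[OF rK] IK] r L_span v0_L m field_simps)
      then show ?thesis unfolding polar_def by (metis Rats_divide Rats_of_int)
    qed
    \<comment> \<open>\<open>polar_unique\<close> makes the apices equal, and a ridge of
      \<open>I\<close> is \<open>I\<close> without its apex. So the sum over ridges has a single
      term.\<close>
    have "{J. J \<in> \<R> \<and> J \<subseteq> I} = {J}"
    proof (intro equalityI subsetI)
      fix K assume "K \<in> {J. J \<in> \<R> \<and> J \<subseteq> I}"
      then have K: "K \<in> \<R>" "K \<subseteq> I" by auto
      have st: "is_ridge K" "is_ridge J" "I \<in> star K" "I \<in> star J"
        using K J I by (auto simp: \<R>_def star_def)
      have "apex K I = apex J I"
        using apex(3)[OF st(1,3)] apex(3)[OF st(2,4)] by (intro polar_unique[OF I _ _ polar[OF K] polar[OF J]])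
      then show "K \<in> {J}" using apex(1,2)[OF st(1,3)] apex(1,2)[OF st(2,4)]
        by (metis Diff_insert_absorb singletonI)
    qed (use J in auto)
    then show ?thesis using C[OF J(1)] I J(2) by (simp add: star_def)
  next
    case False
    then have "{J. J \<in> \<R> \<and> J \<subseteq> I} = {}" by blast
    moreover have "((\<lambda>x. (x - p) * facet_part I x) \<longlongrightarrow> 0) (at p)"
    proof (rule tendsto_0_of_isCont, rule isCont_facet_part[OF I])
      fix i x1 x2 assume i: "i \<in> I" and x: "x1 \<in> L" "x2 \<in> L"
      define K where "K = I - {i}"
      have K: "is_ridge K" "I \<in> star K" "apex K I = i"
        unfolding K_def by (rule ridge_of_facet[OF I i])+
      have Vi: "V i \<in> L" using V_facet_in_L[OF I i] .
      obtain m :: int where m: "l K (V i) = of_int m" using ridge_Ints[OF l[OF K(1)] Vi] by (auto elim: Ints_cases)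
      have m0: "m \<noteq> 0" using ridge_apex_nonzero[OF l[OF K(1)] K(2)] m by (auto simp: K)
      obtain a1 a2 :: int where a12: "l K x1 = of_int a1" "l K x2 = of_int a2"
        using ridge_Ints[OF l[OF K(1)] x(1)] ridge_Ints[OF l[OF K(1)] x(2)] by (meson Ints_cases)
      have Ui: "U I i y = l K y / of_int m" if "y \<in> span L" for y
        using U_apex[OF l[OF K(1)] K(2) that] m by (simp add: K)
      have arg_i: "farg I i x1 x2 p = - (of_real (l K r) + p * of_real (l K v0) - \<tau> * of_int a1 + of_int a2) / of_int m"
        using m0 by (simp add: farg_def Ui r L_span v0_L x a12 field_simps)
      show "farg I i x1 x2 p \<notin> poles \<tau>"
      proof
        assume "farg I i x1 x2 p \<in> poles \<tau>"
        then obtain a b :: int where "farg I i x1 x2 p = of_int a + of_int b * \<tau>" by (auto simp: poles_iff)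
        then have "- (of_real (l K r) + p * of_real (l K v0) - \<tau> * of_int a1 + of_int a2) = of_int m * (of_int a + of_int b * \<tau>)"
          using m0 arg_i by (simp add: field_simps)
        then have "of_real (l K r) + p * of_real (l K v0) = of_int (a1 - m * b) * \<tau> + of_int (- a2 - m * a)"
          by (simp add: algebra_simps add_eq_0_iff)
        then have "K \<in> \<R>" using K(1) unfolding \<R>_def by blast
        then show False using False K(2) by (auto simp: star_def)
      qed
    qed
    ultimately show ?thesis by (metis sum.empty)
  qed
  have "((\<lambda>x. \<Sum>I\<in>facets \<Delta>. of_int (weight \<Delta> I) * ((x - p) * facet_part I x)) \<longlongrightarrow>
     (\<Sum>I\<in>facets \<Delta>. of_int (weight \<Delta> I) * (\<Sum>J | J \<in> \<R> \<and> J \<subseteq> I. of_real (sgn (l J (V (apex J I)))) * C J))) (at p)"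
    by (intro tendsto_sum tendsto_mult[OF tendsto_const] lim)
  moreover have "(\<Sum>I\<in>facets \<Delta>. of_int (weight \<Delta> I) * (\<Sum>J | J \<in> \<R> \<and> J \<subseteq> I. of_real (sgn (l J (V (apex J I)))) * C J)) = 0"
  proof -
    have "(\<Sum>I\<in>facets \<Delta>. of_int (weight \<Delta> I) * (\<Sum>J | J \<in> \<R> \<and> J \<subseteq> I. of_real (sgn (l J (V (apex J I)))) * C J)) =
       (\<Sum>I\<in>facets \<Delta>. \<Sum>J | J \<in> \<R> \<and> J \<subseteq> I. of_int (weight \<Delta> I) * of_real (sgn (l J (V (apex J I)))) * C J)"
      by (simp add: sum_distrib_left mult.assoc)
    \<comment> \<open>Interchange of summation: for fixed \<open>J\<close> the facets containing it
      form \<open>star J\<close>.\<close>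
    also have "\<dots> = (\<Sum>J\<in>\<R>. \<Sum>I | I \<in> facets \<Delta> \<and> J \<subseteq> I. of_int (weight \<Delta> I) * of_real (sgn (l J (V (apex J I)))) * C J)"
      by (rule sum.swap_restrict[OF finite_facets fin])
    also have "\<dots> = (\<Sum>J\<in>\<R>. of_real (\<Sum>I\<in>star J. of_int (weight \<Delta> I) * sgn (l J (V (apex J I)))) * C J)"
      by (simp add: sum_distrib_right star_def)
    also have "\<dots> = 0"
    proof (rule sum.neutral, rule ballI)
      fix J assume "J \<in> \<R>"
      then have J: "is_ridge J" by (simp add: \<R>_def)
      then have "pre_complete (projected \<Delta> J)" by (intro balanced) (simp add: is_ridge_def)
      from ridge_weights_balanced[OF l[OF J] this]
      show "of_real (\<Sum>I\<in>star J. of_int (weight \<Delta> I) * sgn (l J (V (apex J I)))) * C J = 0" by simp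
    qed
    finally show ?thesis .
  qed
  moreover have "(\<Sum>I\<in>facets \<Delta>. of_int (weight \<Delta> I) * ((x - p) * facet_part I x)) = (x - p) * genus x" for x
    by (simp add: genus_def sum_distrib_left mult_ac)
  ultimately show ?thesis by simp
qed

text \<open>Parameter 0 is the point \<open>r\<close> itself; by \<open>gen1\<close> no factor is
  singular there, so continuity gives the value and not merely the limit.\<close>

lemma genus_eq_0:
  assumes "u v0 * Im \<sigma> / Im \<tau> \<notin> \<int>"
  shows "genus 0 = 0"
proof (rule quasi_periodic_eq_0[OF tau genus_meromorphic genus_no_pole genus_add_1 genus_add_tau assms])
  have "farg I i x1 x2 0 \<notin> poles \<tau>" if "I \<in> facets \<Delta>" "i \<in> I" "x1 \<in> L" "x2 \<in> L" for I i x1 x2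
  proof
    assume "farg I i x1 x2 0 \<in> poles \<tau>"
    from polarI[OF that this] obtain a b where "a \<in> \<rat>" "complex_of_real (U I i r) + of_real 0 * \<tau> = of_real a + of_real b * \<tau>"
      by (auto simp: polar_def)
    then have "U I i r \<in> \<rat>" using real_tau_independent(1)[OF tau] by blast
    then show False using gen1 that by blast
  qed
  then show "isCont genus 0"
    unfolding genus_def by (intro continuous_intros isCont_facet_part)
qed

end

section \<open>Vanishing of the genus\<close>

lemma dual_lattice_add:
  "w \<in> dual_lattice L \<Longrightarrow> x \<in> L \<Longrightarrow> y \<in> L \<Longrightarrow> w (x + y) = w x + w y"
  by (auto simp: dual_lattice_def hom_def additive_group_def integer_group_def)

text \<open>Additivity on \<open>L\<close> forces integer linearity, so the values on a lattice
  basis determine both \<open>w\<close> and its linear extension.\<close>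

lemma dual_lattice_linear_extension:
  fixes L :: "'v::euclidean_space set"
  assumes "is_lattice L" "w \<in> dual_lattice L"
  obtains f :: "'v \<Rightarrow> real" where "linear f" "\<And>x. x \<in> L \<Longrightarrow> f x = of_int (w x)"
proof -
  obtain B where B: "finite B" "independent B" "L = int_span B"
    using assms by (auto simp: is_lattice_def)
  note add = dual_lattice_add[OF assms(2), unfolded B(3)]
  have 0: "w 0 = 0" using add[of 0 0] int_span_0 by auto
  have minus: "w (- x) = - w x" if "x \<in> int_span B" for x
    using add[OF that int_span_minus[OF that]] 0 by simp
  have scale: "w (of_int k *\<^sub>R x) = k * w x" if "x \<in> int_span B" for k x
  proof (induction k rule: int_induct[of _ 0])
    case (step1 i)
    then show ?case
      using add[OF int_span_scale[OF that] that, of i] by (simp add: algebra_simps)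
  next
    case (step2 i)
    then show ?case
      using add[OF int_span_scale[OF that] int_span_minus[OF that], of i] minus[OF that] by (simp add: algebra_simps)
  qed (simp add: 0)
  have sum: "w (\<Sum>b\<in>A. of_int (c b) *\<^sub>R b) = (\<Sum>b\<in>A. c b * w b) \<and> (\<Sum>b\<in>A. of_int (c b) *\<^sub>R b) \<in> int_span B" if "A \<subseteq> B" for A c
    using finite_subset[OF that B(1)] that
  proof (induction A rule: finite_induct)
    case (insert b A)
    have "b \<in> int_span B" using B(1) insert.prems by (intro int_span_base) auto
    then show ?case
      using insert add[of "of_int (c b) *\<^sub>R b" "\<Sum>b\<in>A. of_int (c b) *\<^sub>R b"]
      by (simp add: int_span_scale int_span_add scale)
  qed (simp add: 0 int_span_0)
  obtain f :: "'v \<Rightarrow> real" where f: "linear f" "\<forall>b\<in>B. f b = of_int (w b)"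
    using linear_independent_extend[OF B(2), of "\<lambda>b. of_int (w b)"] by blast
  have "f x = of_int (w x)" if "x \<in> L" for x
  proof -
    have "x \<in> int_span B" using that B(3) by simp
    then obtain c where c: "x = (\<Sum>b\<in>B. of_int (c b) *\<^sub>R b)"
      by (auto simp: int_span_def)
    have "f x = (\<Sum>b\<in>B. of_int (c b) * f b)"
      unfolding c by (simp add: linear_sum[OF f(1)] linear_scale[OF f(1)])
    also have "\<dots> = of_int (w x)"
      unfolding c using sum[of B c] f(2) by (simp cong: sum.cong)
    finally show ?thesis .
  qed
  then show ?thesis using that f(1) by blast
qed

text \<open>The identity of the quotient is the subgroup of images of functionals. The coset
  \<open>c1\<close> contains \<open>c1T\<close>, as the zero functional embeds as 0, so
  \<open>c1T\<close> is itself such an image and its coefficients can be compared.\<close>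

lemma c1_eq_0D:
  assumes "finite (vertices \<Delta>)" and V: "\<And>i. i \<in> vertices \<Delta> \<Longrightarrow> V i \<in> lat \<Delta>"
    and add: "\<And>x y. x \<in> lat \<Delta> \<Longrightarrow> y \<in> lat \<Delta> \<Longrightarrow> x + y \<in> lat \<Delta>"
    and "c1 \<Delta> V = \<one>\<^bsub>H2_quotient \<Delta> V\<^esub>"
  obtains w where "w \<in> dual_lattice (lat \<Delta>)" "\<And>i. i \<in> vertices \<Delta> \<Longrightarrow> w (V i) = 1"
proof -
  let ?L = "lat \<Delta>"
  define z where "z = restrict (\<lambda>x. 0::int) ?L"
  have z: "z \<in> dual_lattice ?L"
    by (auto simp: dual_lattice_def hom_def additive_group_def integer_group_def z_def add)
  have "z (V i) = 0" if "i \<in> vertices \<Delta>" for i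
    using that V by (simp add: z_def)
  then have dz: "dual_embedding \<Delta> V z = 0"
    by (simp add: dual_embedding_def)
  have "0 + c1T \<Delta> \<in> c1 \<Delta> V"
    unfolding c1_def r_coset_def H2T_def free_Abelian_group_def using z dz
    by (auto intro!: bexI[of _ z])
  then have "c1T \<Delta> \<in> dual_embedding \<Delta> V ` dual_lattice ?L"
    using assms(4) by (simp add: H2_quotient_def FactGroup_def)
  then obtain w where w: "w \<in> dual_lattice ?L" "c1T \<Delta> = dual_embedding \<Delta> V w" by blast
  have "w (V i) = 1" if "i \<in> vertices \<Delta>" for i
  proof -
    have "Poly_Mapping.lookup (c1T \<Delta>) i = Poly_Mapping.lookup (dual_embedding \<Delta> V w) i"
      using w(2) by simp
    then show ?thesis
      using that assms(1) by (simp add: c1T_def dual_embedding_def lookup_sum if_distrib[of "\<lambda>x. _ * x"] cong: if_cong)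
  qed
  then show ?thesis using that w(1) by blast
qed

context simplicial_multifan_with_edges
begin

lemma lattice: "is_lattice L"
  using multifan by (simp add: simplicial_multifan_def)

lemma sum_dual_basis:
  assumes "linear f" "\<And>i. i \<in> vertices \<Delta> \<Longrightarrow> f (V i) = 1" "I \<in> facets \<Delta>" "x \<in> span L"
  shows "(\<Sum>i\<in>I. U I i x) = f x"
proof -
  have "f x = f (\<Sum>i\<in>I. U I i x *\<^sub>R V i)"
    by (rule arg_cong[OF U_expansion[OF assms(3,4)]])
  also have "\<dots> = (\<Sum>i\<in>I. U I i x * f (V i))"
    by (simp add: linear_sum[OF assms(1)] linear_scale[OF assms(1)])
  also have "\<dots> = (\<Sum>i\<in>I. U I i x)"
    using assms(2,3) simplex_vertices by (intro sum.cong) (auto simp: facets_iff)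
  finally show ?thesis by simp
qed

lemma subspace_U_kernel:
  assumes "I \<in> facets \<Delta>"
  shows "subspace {x \<in> span L. a * U I i x - b * U I j x = 0}"
  using assms by (auto simp: subspace_def U_add U_scale U_0 span_add span_scale span_zero algebra_simps)

lemma genus_at_eq:
  assumes "Im \<tau> > 0"
  shows "genus_at \<Delta> V v z \<tau> \<sigma> = (\<Sum>I\<in>facets \<Delta>. of_int (weight \<Delta> I) / of_nat (order (H_I \<Delta> V I)) *
        (\<Sum>(h1, h2) \<in> (coset (LI I) ` L) \<times> (coset (LI I) ` L). \<Prod>i\<in>I. cis2pi (of_real (U I i (rep h1)) * \<sigma>) *
                  theta_quot \<tau> \<sigma> (phi_arg V I i h1 h2 v z \<tau>)))"
  unfolding genus_at_def carrier_H_I phi_eq_theta_quot[OF assms] ..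

text \<open>Two perturbations: \<open>z v\<close> is moved to a generic point \<open>z v + s y\<close>, and \<open>\<sigma>\<close> to a value for which
  the exponent in \<open>quasi_periodic_eq_0\<close> is not an integer.\<close>

lemma genus_at_eq_0:
  fixes z :: real and f :: "'v \<Rightarrow> real"
  assumes complete: "complete_multifan \<Delta>" and n: "mf_rank \<Delta> \<ge> 1"
    and f: "linear f" "\<And>i. i \<in> vertices \<Delta> \<Longrightarrow> f (V i) = 1"
    and v: "v \<in> lat_V \<Delta> V" and \<tau>: "Im \<tau> > 0" and reg: "regular_point \<Delta> V v (of_real z) \<tau>"
  shows "genus_at \<Delta> V v (of_real z) \<tau> \<sigma> = 0"
proof -
  have vL: "v \<in> L" using v lat_V_subset_L by blast
  obtain I0 where I0: "I0 \<in> facets \<Delta>" using facets_nonempty by blast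
  then have "I0 \<noteq> {}" using n by (auto simp: facets_iff)
  then obtain i0 where i0: "i0 \<in> I0" by blast
  have i0v: "i0 \<in> vertices \<Delta>" using I0 i0 simplex_vertices by (auto simp: facets_iff)
  obtain k where k: "k > (0::nat)" "real k *\<^sub>R V i0 \<in> lat_V \<Delta> V"
    using multiple_in_lat_V[OF V_in_L[OF i0v]] .
  \<comment> \<open>An edge vector scaled into \<open>lat_V\<close>; since \<open>f\<close> is 1 on
    edge vectors, the exponent \<open>f v0 = k\<close> is positive whatever \<open>v\<close>
    is.\<close>
  define v0 where "v0 = real k *\<^sub>R V i0"
  have v0: "v0 \<in> lat_V \<Delta> V" using k by (simp add: v0_def)
  have fv0: "f v0 = real k" using f(2)[OF i0v] by (simp add: v0_def linear_scale[OF f(1)])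
  \<comment> \<open>A tuple encodes the linear form \<open>a U_i - b U_j\<close>. The pair
    \<open>(1, 0)\<close> with \<open>i = j\<close> stands for \<open>gen1\<close>, the other pair
    for \<open>gen2\<close>. Each form has the nonzero value \<open>a\<close> at \<open>V i\<close>,
    so its kernel does not contain \<open>L\<close>.\<close>
  define \<I> where "\<I> = {(I, i, j, a, b) | I i j a b. I \<in> facets \<Delta> \<and> i \<in> I \<and> j \<in> I \<and>
      (a, b) \<in> {(1, 0), (U I j v0, U I i v0)} \<and> (i = j \<and> (a, b) = (1, 0) \<or> i \<noteq> j \<and> a \<noteq> 0)}"
  have fin\<I>: "finite \<I>"
  proof (rule finite_subset)
    show "\<I> \<subseteq> (\<Union>I\<in>facets \<Delta>. \<Union>i\<in>I. \<Union>j\<in>I. {(I, i, j, 1, 0), (I, i, j, U I j v0, U I i v0)})"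
      by (auto simp: \<I>_def)
    show "finite (\<Union>I\<in>facets \<Delta>. \<Union>i\<in>I. \<Union>j\<in>I. {(I, i, j, 1::real, 0::real), (I, i, j, U I j v0, U I i v0)})"
      using finite_facets finite_facet by blast
  qed
  define \<g> where "\<g> = (\<lambda>(I, i, j, a, b) x. a * U I i x - b * U I j x)"
  have g_facet: "\<exists>I i j a b. p = (I, i, j, a, b) \<and> I \<in> facets \<Delta> \<and> i \<in> I \<and> j \<in> I \<and> \<g> p (V i) \<noteq> 0"
    if "p \<in> \<I>" for p
    using that by (auto simp: \<I>_def \<g>_def U_V split: if_splits)
  obtain y where y: "y \<in> L" "\<And>p. p \<in> \<I> \<Longrightarrow> \<g> p y \<noteq> 0"
  proof -
    have "\<exists>y\<in>L. \<forall>S\<in>(\<lambda>p. {x \<in> span L. \<g> p x = 0}) ` \<I>. y \<notin> S"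
    proof (rule exists_avoiding_subspaces)
      fix S assume "S \<in> (\<lambda>p. {x \<in> span L. \<g> p x = 0}) ` \<I>"
      then obtain p where p: "p \<in> \<I>" "S = {x \<in> span L. \<g> p x = 0}" by blast
      obtain I i j a b where pp: "p = (I, i, j, a, b)" "I \<in> facets \<Delta>" "i \<in> I" "j \<in> I" "\<g> p (V i) \<noteq> 0"
        using g_facet[OF p(1)] by blast
      have "subspace S" unfolding p(2) using subspace_U_kernel[OF pp(2), of a i b j] by (simp add: pp(1) \<g>_def)
      moreover have "V i \<in> L - S" using pp p(2) V_facet_in_L by auto
      ultimately show "subspace S \<and> \<not> L \<subseteq> S" by blast
    qed (use fin\<I> in \<open>auto intro: L_0 L_add\<close>)
    then obtain y where y: "y \<in> L" "\<forall>p\<in>\<I>. y \<notin> {x \<in> span L. \<g> p x = 0}"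
      by (auto simp only: ball_simps)
    show thesis
      by (rule that[OF y(1)]) (use y(2) L_span[OF y(1)] in simp)
  qed
  \<comment> \<open>This is \<open>farg\<close> at parameter 0 with base point
    \<open>z v + s y\<close>; the term with factor 0 is kept so that \<open>G\<close> coincides with
    \<open>genus 0\<close> by unfolding.\<close>
  define P where "P I h1 h2 s i = - (of_real (U I i (z *\<^sub>R v + s *\<^sub>R y)) + 0 * of_real (U I i v0) - \<tau> * of_real (U I i (rep h1)) + of_real (U I i (rep h2)))"
    for I h1 h2 i and s :: real
  define G where "G \<sigma> s = (\<Sum>I\<in>facets \<Delta>. of_int (weight \<Delta> I) * ((\<Sum>(h1, h2) \<in> (coset (LI I) ` L) \<times> (coset (LI I) ` L). \<Prod>i\<in>I. cis2pi (of_real (U I i (rep h1)) * \<sigma>) *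
                  theta_quot \<tau> \<sigma> (P I h1 h2 s i)) / of_nat (order (H_I \<Delta> V I))))" for \<sigma> s
  have U_affine: "U I i (z *\<^sub>R v + s *\<^sub>R y) = z * U I i v + s * U I i y" if "I \<in> facets \<Delta>" for I i s
    using that by (simp add: U_add U_scale span_scale L_span vL y)
  have P0: "P I h1 h2 0 i = phi_arg V I i h1 h2 v (of_real z) \<tau>" if "I \<in> facets \<Delta>" for I h1 h2 i
    using U_affine[OF that, of i 0] by (simp add: P_def phi_arg_def)
  have goal_G: "genus_at \<Delta> V v (of_real z) \<tau> \<sigma> = G \<sigma> 0" for \<sigma>
    unfolding genus_at_eq[OF \<tau>] G_def by (intro sum.cong refl) (simp add: P0 case_prod_unfold)
  have P0_reg: "P I h1 h2 0 i \<notin> poles \<tau>"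
    if "I \<in> facets \<Delta>" "h1 \<in> coset (LI I) ` L" "h2 \<in> coset (LI I) ` L" "i \<in> I" for I h1 h2 i
    using reg that unfolding regular_point_def carrier_H_I poles_iff P0[OF that(1)] by blast
  have cont_s: "isCont (G \<sigma>) 0" for \<sigma>
  proof -
    have "isCont (\<lambda>s. theta_quot \<tau> \<sigma> (P I h1 h2 s i)) 0"
      if h: "I \<in> facets \<Delta>" "h1 \<in> coset (LI I) ` L" "h2 \<in> coset (LI I) ` L" "i \<in> I" for I h1 h2 i
    proof (rule isCont_o2[where f = "\<lambda>s. P I h1 h2 s i" and g = "theta_quot \<tau> \<sigma>"])
      show "isCont (\<lambda>s. P I h1 h2 s i) 0"
        unfolding P_def U_affine[OF h(1)] by (intro continuous_intros)
      show "isCont (theta_quot \<tau> \<sigma>) (P I h1 h2 0 i)"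
        using theta_quot_analytic[OF \<tau>, of "\<lambda>x. x" "P I h1 h2 0 i" \<sigma>] P0_reg[OF h]
        by (intro analytic_at_imp_isCont) auto
    qed
    then show ?thesis
      unfolding G_def case_prod_unfold using order_H_I_pos
      by (intro continuous_sum continuous_mult continuous_divide continuous_prod continuous_const) auto
  qed
  have cont_\<sigma>: "isCont (\<lambda>\<sigma>. G \<sigma> 0) \<sigma>" for \<sigma>
  proof -
    have "isCont (\<lambda>\<sigma>. cis2pi (of_real a * \<sigma>)) \<sigma>" for a
      unfolding cis2pi_def by (intro continuous_intros)
    then show ?thesis
      unfolding G_def case_prod_unfold using order_H_I_pos
      by (intro continuous_sum continuous_mult continuous_divide continuous_prod continuous_const isCont_theta_quot_param \<tau>) auto
  qed
  have generic_zero: "G \<sigma> s = 0"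
    if \<sigma>: "real k * Im \<sigma> / Im \<tau> \<notin> \<int>" and s: "\<And>p. p \<in> \<I> \<Longrightarrow> \<g> p (z *\<^sub>R v + s *\<^sub>R y) \<notin> \<rat>" for \<sigma> s
  proof -
    interpret generic_genus_line \<Delta> V f \<tau> \<sigma> "z *\<^sub>R v + s *\<^sub>R y" v0
    proof unfold_locales
      show "z *\<^sub>R v + s *\<^sub>R y \<in> span L" by (intro span_add span_scale L_span vL y)
      show "pre_complete (projected \<Delta> J)" if "J \<in> simplices \<Delta>" for J
        using complete that by (simp add: complete_multifan_def)
      show "U I i (z *\<^sub>R v + s *\<^sub>R y) \<notin> \<rat>" if "I \<in> facets \<Delta>" "i \<in> I" for I i
        using s[of "(I, i, i, 1, 0)"] that by (simp add: \<I>_def \<g>_def)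
      show "U I j v0 * U I i (z *\<^sub>R v + s *\<^sub>R y) - U I i v0 * U I j (z *\<^sub>R v + s *\<^sub>R y) \<notin> \<rat>"
        if "I \<in> facets \<Delta>" "i \<in> I" "j \<in> I" "i \<noteq> j" "U I j v0 \<noteq> 0" for I i j
        using s[of "(I, i, j, U I j v0, U I i v0)"] that by (simp add: \<I>_def \<g>_def)
    qed (use \<tau> v0 sum_dual_basis[OF f] L_span in auto)
    have "genus 0 = 0" using \<sigma> by (intro genus_eq_0) (simp add: fv0)
    moreover have "genus 0 = G \<sigma> s"
      unfolding genus_def facet_part_def summand_def farg_def G_def P_def ..
    ultimately show ?thesis by simp
  qed
  have zero_s: "G \<sigma> 0 = 0" if \<sigma>: "real k * Im \<sigma> / Im \<tau> \<notin> \<int>" for \<sigma>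
  proof (rule ccontr)
    assume "G \<sigma> 0 \<noteq> 0"
    then have "eventually (\<lambda>s. G \<sigma> s \<noteq> 0) (at 0)"
      using cont_s[of \<sigma>] unfolding isCont_def by (rule tendsto_imp_eventually_ne[rotated])
    then obtain e where e: "e > 0" "\<And>s. s \<noteq> 0 \<Longrightarrow> dist s 0 < e \<Longrightarrow> G \<sigma> s \<noteq> 0"
      by (auto simp: eventually_at)
    \<comment> \<open>Each form is affine in \<open>s\<close> with nonzero slope
      \<open>\<g> p y\<close>, so it takes rational values for only countably many \<open>s\<close>;
      every interval to the right of 0 contains a good \<open>s\<close>.\<close>
    define bad where "bad = (\<Union>p\<in>\<I>. (\<lambda>q. (q - z * \<g> p v) / \<g> p y) ` \<rat>)"
    have "countable bad"
      unfolding bad_def using fin\<I> by (intro countable_UN countable_image countable_rat countable_finite)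
    moreover have "uncountable {0<..<e}" using e(1) by (simp add: uncountable_open_interval)
    ultimately obtain s where s: "s \<in> {0<..<e}" "s \<notin> bad"
      by (metis countable_subset subsetI)
    have "\<g> p (z *\<^sub>R v + s *\<^sub>R y) \<notin> \<rat>" if p: "p \<in> \<I>" for p
    proof
      assume *: "\<g> p (z *\<^sub>R v + s *\<^sub>R y) \<in> \<rat>"
      obtain I i j a b where pp: "p = (I, i, j, a, b)" "I \<in> facets \<Delta>"
        using g_facet[OF p] by blast
      have "\<g> p (z *\<^sub>R v + s *\<^sub>R y) = z * \<g> p v + s * \<g> p y"
        unfolding pp(1) \<g>_def prod.case U_affine[OF pp(2)] by (simp add: algebra_simps)
      then have "s = (\<g> p (z *\<^sub>R v + s *\<^sub>R y) - z * \<g> p v) / \<g> p y"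
        using y(2)[OF p] by (simp add: field_simps)
      then have "s \<in> bad" unfolding bad_def using p * by blast
      then show False using s(2) by simp
    qed
    from generic_zero[OF \<sigma> this] e(2)[of s] s(1) show False by (auto simp: dist_real_def)
  qed
  have "G \<sigma> 0 = 0"
  proof (rule ccontr)
    assume "G \<sigma> 0 \<noteq> 0"
    then have "eventually (\<lambda>\<sigma>'. G \<sigma>' 0 \<noteq> 0) (at \<sigma>)"
      using cont_\<sigma>[of \<sigma>] unfolding isCont_def by (rule tendsto_imp_eventually_ne[rotated])
    then obtain e where e: "e > 0" "\<And>\<sigma>'. \<sigma>' \<noteq> \<sigma> \<Longrightarrow> dist \<sigma>' \<sigma> < e \<Longrightarrow> G \<sigma>' 0 \<noteq> 0"
      by (auto simp: eventually_at)
    \<comment> \<open>The upward shifts \<open>d\<close> of \<open>\<sigma>\<close> for which the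
      exponent would be the integer \<open>m\<close>.\<close>
    have "countable ((\<lambda>m. m * Im \<tau> / real k - Im \<sigma>) ` \<int>)"
      using countable_subset[OF Ints_subset_Rats countable_rat] by (rule countable_image)
    moreover have "uncountable {0<..<e}" using e(1) by (simp add: uncountable_open_interval)
    ultimately obtain d where d: "d \<in> {0<..<e}" "d \<notin> (\<lambda>m. m * Im \<tau> / real k - Im \<sigma>) ` \<int>"
      by (metis countable_subset subsetI)
    have "real k * Im (\<sigma> + \<i> * of_real d) / Im \<tau> \<notin> \<int>"
    proof
      assume m: "real k * Im (\<sigma> + \<i> * of_real d) / Im \<tau> \<in> \<int>"
      have "d = (real k * Im (\<sigma> + \<i> * of_real d) / Im \<tau>) * Im \<tau> / real k - Im \<sigma>"
        using k(1) \<tau> by simp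
      then show False using d(2) m by blast
    qed
    from zero_s[OF this] e(2)[of "\<sigma> + \<i> * of_real d"] d(1) show False
      by (auto simp: dist_norm norm_mult complex_eq_iff)
  qed
  then show ?thesis by (simp add: goal_G)
qed

end

section \<open>Uniqueness of the power series\<close>

text \<open>The value \<open>q = 0\<close> is not of the form \<open>cis2pi \<tau>\<close>, so
  nothing is known there. Multiplying the series by \<open>q\<close> makes it sum to 0 at the centre
  too, and the identity theorem applies to the shifted coefficients \<open>b\<close>.\<close>

lemma powser_eq_0_punctured:
  fixes a :: "nat \<Rightarrow> complex"
  assumes "\<And>q. q \<noteq> 0 \<Longrightarrow> norm q < 1 \<Longrightarrow> (\<lambda>m. a m * q ^ m) sums 0"
  shows "a m = 0"
proof (rule ccontr)
  assume m: "a m \<noteq> 0"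
  define b where "b = (\<lambda>n. case n of 0 \<Rightarrow> 0 | Suc n \<Rightarrow> a n)"
  have "(\<lambda>n. b n * (q - 0) ^ n) sums 0" if "norm (q - 0) < 1" for q
  proof (cases "q = 0")
    case True
    have "(\<lambda>n. b n * (q - 0) ^ n) = (\<lambda>_. 0)"
      unfolding b_def True by (auto simp: fun_eq_iff split: nat.split)
    then show ?thesis by simp
  next
    case False
    have "(\<lambda>n. q * (a n * q ^ n)) sums (q * 0)"
      using assms[OF False] that by (intro sums_mult) simp
    then have "(\<lambda>n. b (Suc n) * (q - 0) ^ Suc n) sums 0"
      by (simp add: b_def mult_ac)
    then show ?thesis by (subst (asm) sums_Suc_iff) (simp add: b_def)
  qed
  moreover have "b (Suc m) \<noteq> 0" using m by (simp add: b_def)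
  ultimately obtain s :: real where "s > 0" "\<And>z. z \<in> cball 0 s - {0::complex} \<Longrightarrow> (0::complex) \<noteq> 0"
    using powser_0_nonzero[of 1 0 b "\<lambda>_. 0" "Suc m"] by (metis zero_less_Suc zero_less_one)
  then have "of_real s \<notin> cball 0 s - {0::complex}" by blast
  then show False using \<open>s > 0\<close> by simp
qed

text \<open>Multiplication by the \<open>M\<close>-th power of \<open>cis2pi z\<close> clears
  negative exponents, since \<open>M\<close> bounds every \<open>\<bar>e k\<bar>\<close>. A
  polynomial with infinitely many roots results, and injectivity of \<open>e\<close> keeps its
  coefficients apart.\<close>

lemma characters_independent:
  fixes a :: "'k \<Rightarrow> complex" and e :: "'k \<Rightarrow> int"
  assumes K: "finite K" "inj_on e K" and S: "infinite (cis2pi ` S)"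
    and zero: "\<And>z. z \<in> S \<Longrightarrow> (\<Sum>k\<in>K. a k * cis2pi (of_int (e k) * z)) = 0" and k: "k \<in> K"
  shows "a k = 0"
proof -
  define M where "M = (\<Sum>k\<in>K. \<bar>e k\<bar>)"
  have M: "e k + M \<ge> 0" if "k \<in> K" for k
  proof -
    have "\<bar>e k\<bar> \<le> M" unfolding M_def using K(1) that by (intro member_le_sum) auto
    then show ?thesis by linarith
  qed
  define p where "p = (\<Sum>k\<in>K. monom (a k) (nat (e k + M)))"
  have "poly p (cis2pi z) = 0" if "z \<in> S" for z
  proof -
    have "poly p (cis2pi z) = (\<Sum>k\<in>K. a k * cis2pi z ^ nat (e k + M))"
      by (simp add: p_def poly_sum poly_monom)
    also have "\<dots> = (\<Sum>k\<in>K. a k * cis2pi (of_int (e k) * z) * cis2pi (of_int M * z))"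
    proof (intro sum.cong refl)
      fix k assume "k \<in> K"
      then have "of_nat (nat (e k + M)) = (of_int (e k + M) :: complex)"
        using M by (metis of_int_of_nat_eq nat_0_le)
      then have "cis2pi z ^ nat (e k + M) = cis2pi (of_int (e k + M) * z)"
        by (metis cis2pi_of_nat_mult)
      then show "a k * cis2pi z ^ nat (e k + M) = a k * cis2pi (of_int (e k) * z) * cis2pi (of_int M * z)"
        by (simp add: distrib_right cis2pi_add)
    qed
    also have "\<dots> = 0" using zero[OF that] by (simp add: sum_distrib_right[symmetric])
    finally show ?thesis .
  qed
  then have "cis2pi ` S \<subseteq> {x. poly p x = 0}" by blast
  then have "p = 0" using S poly_roots_finite finite_subset by blast
  then have "0 = coeff p (nat (e k + M))" by simp
  also have "\<dots> = (\<Sum>j\<in>K. if j = k then a j else 0)"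
    unfolding p_def coeff_sum
  proof (intro sum.cong refl)
    fix j assume "j \<in> K"
    then have "nat (e j + M) = nat (e k + M) \<longleftrightarrow> j = k"
      using M[of j] M[OF k] inj_onD[OF K(2), of j k] k by auto
    then show "coeff (monom (a j) (nat (e j + M))) (nat (e k + M)) = (if j = k then a j else 0)"
      by (simp add: coeff_monom)
  qed
  also have "\<dots> = a k" using K(1) k by simp
  finally show ?thesis by simp
qed

text \<open>Irrational real \<open>z\<close> are regular for every \<open>\<tau>\<close> at once;
  this provides enough points on the unit circle to separate characters.\<close>

lemma infinite_cis2pi_irrationals: "infinite (cis2pi ` complex_of_real ` ({0<..<1} - \<rat>))"
proof -
  have "inj_on (\<lambda>x. cis2pi (complex_of_real x)) ({0<..<1} - \<rat>)"
  proof (rule inj_onI)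
    fix x y :: real assume xy: "x \<in> {0<..<1} - \<rat>" "y \<in> {0<..<1} - \<rat>"
      and "cis2pi (complex_of_real x) = cis2pi (complex_of_real y)"
    then obtain k :: int where "complex_of_real x = of_real y + of_int k"
      by (auto simp: cis2pi_eq_iff)
    then have k: "x = y + of_int k"
      by (metis of_real_add of_real_eq_iff of_real_of_int_eq)
    then have "\<bar>real_of_int k\<bar> < 1" using xy by auto
    then have "k = 0" by linarith
    then show "x = y" using k by simp
  qed
  moreover have "infinite ({0<..<1::real} - \<rat>)"
  proof
    assume "finite ({0<..<1::real} - \<rat>)"
    then have "countable (({0<..<1::real} - \<rat>) \<union> \<rat>)"
      by (intro countable_Un countable_finite countable_rat)
    then have "countable {0<..<1::real}" by (rule countable_subset[rotated]) auto
    then show False using uncountable_open_interval[of 0 "1::real"] by simp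
  qed
  ultimately show ?thesis by (auto simp: image_image dest: finite_imageD)
qed

text \<open>Substituting \<open>\<sigma> = r z\<close> turns the fractional powers of
  \<open>\<zeta>\<close> into integral characters.\<close>

lemma laurent_value_eq_0:
  assumes "r > 0" "\<And>\<sigma>. laurent_value r p \<sigma> = 0"
  shows "p = 0"
proof -
  have inf: "infinite (range cis2pi)"
  proof
    assume "finite (range cis2pi)"
    moreover have "UNIV - {0} \<subseteq> range cis2pi" using surj_cis2pi by blast
    ultimately have "finite (UNIV - {0::complex})" by (rule rev_finite_subset)
    then show False by (simp add: infinite_UNIV_char_0)
  qed
  have zero: "of_int (Poly_Mapping.lookup p k) = (0::complex)" if "k \<in> Poly_Mapping.keys p" for k
  proof (rule characters_independent[of "Poly_Mapping.keys p" "\<lambda>k. k" UNIV "\<lambda>k. of_int (Poly_Mapping.lookup p k)"])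
    fix z :: complex
    have "of_int k * (of_nat r * z) / of_nat r = of_int k * z" for k :: int
      using assms(1) by simp
    then show "(\<Sum>k\<in>Poly_Mapping.keys p. of_int (Poly_Mapping.lookup p k) * cis2pi (of_int k * z)) = 0"
      using assms(2)[of "of_nat r * z"] by (simp add: laurent_value_def)
  qed (use that inf in auto)
  have "Poly_Mapping.lookup p k = 0" for k
    using zero[of k] by (cases "k \<in> Poly_Mapping.keys p") (auto simp: in_keys_iff)
  then show ?thesis by (intro poly_mapping_eqI) simp
qed

context simplicial_multifan_with_edges
begin

lemma lat_V_add: "x \<in> lat_V \<Delta> V \<Longrightarrow> y \<in> lat_V \<Delta> V \<Longrightarrow> x + y \<in> lat_V \<Delta> V"
  by (auto simp: lat_V_def lat_I_def intro: int_span_add)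

lemma lat_V_0: "0 \<in> lat_V \<Delta> V"
  by (auto simp: lat_V_def lat_I_def intro: int_span_0)

text \<open>A subspace containing \<open>lat_V\<close> contains a positive multiple of every lattice
  vector, hence the vector.\<close>

lemma lat_V_not_subset:
  assumes "subspace S" "\<not> L \<subseteq> S"
  shows "\<not> lat_V \<Delta> V \<subseteq> S"
proof
  assume sub: "lat_V \<Delta> V \<subseteq> S"
  have "x \<in> S" if x: "x \<in> L" for x
  proof -
    obtain k :: nat where k: "k > 0" "real k *\<^sub>R x \<in> lat_V \<Delta> V" using multiple_in_lat_V[OF x] .
    then have "inverse (real k) *\<^sub>R (real k *\<^sub>R x) \<in> S"
      using sub by (intro subspace_scale[OF assms(1), of "real k *\<^sub>R x"]) auto
    then show ?thesis using k(1) by simp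
  qed
  then show False using assms(2) by blast
qed

lemma U_generic_nonzero:
  assumes "generic \<Delta> v" "I \<in> facets \<Delta>" "i \<in> I"
  shows "U I i v \<noteq> 0"
proof
  assume 0: "U I i v = 0"
  have v: "v \<in> span L" using assms(1) by (simp add: generic_def)
  have ridge: "is_ridge (I - {i})" by (rule ridge_of_facet[OF assms(2,3)])
  then have J: "I - {i} \<in> simplices \<Delta>" by (simp add: is_ridge_def)
  have "dim (cone_of \<Delta> (I - {i})) < mf_rank \<Delta>"
    using ridge dim_simplex[OF J] span_cone[OF J] dim_span
    by (metis is_ridge_def lessI)
  then have "v \<notin> span (V ` (I - {i}))"
    using assms(1) J span_cone[OF J] by (auto simp: generic_def)
  moreover have "v = (\<Sum>j\<in>I - {i}. U I j v *\<^sub>R V j)"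
    using U_expansion[OF assms(2) v] 0 finite_facet[OF assms(2)] assms(3) by (simp add: sum.remove[of I i])
  moreover have "(\<Sum>j\<in>I - {i}. U I j v *\<^sub>R V j) \<in> span (V ` (I - {i}))"
    by (intro span_sum span_scale span_base imageI)
  ultimately show False by metis
qed

text \<open>At a singular point the coefficients of 1 in the basis \<open>1, \<tau>\<close> can be
  compared; genericity permits division by \<open>U I i v\<close>, and \<open>z\<close> comes out
  rational.\<close>

lemma regular_irrational:
  fixes z :: real
  assumes "generic \<Delta> v" "v \<in> lat_V \<Delta> V" "z \<notin> \<rat>" "Im \<tau> > 0"
  shows "regular_point \<Delta> V v (of_real z) \<tau>"
  unfolding regular_point_def carrier_H_I
proof (intro ballI allI notI)
  fix I h1 h2 i and a b :: int
  assume I: "I \<in> facets \<Delta>" and h: "h1 \<in> coset (LI I) ` L" "h2 \<in> coset (LI I) ` L" and i: "i \<in> I"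
    and eq: "phi_arg V I i h1 h2 v (of_real z) \<tau> = of_int a + of_int b * \<tau>"
  have "rep h2 \<in> L" using rep_H_I(1)[OF h(2)] I by (simp add: facets_iff)
  then have Q: "U I i (rep h2) \<in> \<rat>" by (rule U_L_Rats[OF I i])
  have "v \<in> L" using assms(2) lat_V_subset_L by blast
  then have Qv: "U I i v \<in> \<rat>" by (rule U_L_Rats[OF I i])
  have "complex_of_real (- (z * U I i v + U I i (rep h2))) + of_real (U I i (rep h1)) * \<tau> = of_real (of_int a) + of_real (of_int b) * \<tau>"
    using eq by (simp add: phi_arg_def algebra_simps)
  from real_tau_independent(1)[OF assms(4) this]
  have "z * U I i v = - of_int a - U I i (rep h2)" by simp
  then have "z = (- of_int a - U I i (rep h2)) / U I i v"
    using U_generic_nonzero[OF assms(1) I i] by (simp add: field_simps)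
  moreover have "(- of_int a - U I i (rep h2)) / U I i v \<in> \<rat>"
    using Q Qv by (intro Rats_divide Rats_diff) auto
  ultimately show False using assms(3) by simp
qed

text \<open>Genericity excludes finitely many spans of cones, separation finitely many kernels of
  differences \<open>f u - f u'\<close>; none of these subspaces contains \<open>L\<close>.\<close>

lemma separating_generic_vector:
  assumes "finite K" "K \<subseteq> dual_lattice L"
  obtains v where "v \<in> lat_V \<Delta> V" "generic \<Delta> v" "inj_on (\<lambda>u. u v) K"
proof -
  have "\<exists>f. linear f \<and> (\<forall>x\<in>L. f x = real_of_int (u x))" if "u \<in> K" for u
  proof -
    have u: "u \<in> dual_lattice L" using assms(2) that by blast
    obtain f :: "'v \<Rightarrow> real" where "linear f" "\<And>x. x \<in> L \<Longrightarrow> f x = of_int (u x)"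
      using dual_lattice_linear_extension[OF lattice u] by blast
    then show ?thesis by (intro exI[of _ f]) simp
  qed
  then obtain f where f: "\<And>u. u \<in> K \<Longrightarrow> linear (f u)" "\<And>u x. u \<in> K \<Longrightarrow> x \<in> L \<Longrightarrow> f u x = real_of_int (u x)"
    by metis
  define \<S> where "\<S> = (\<lambda>J. span (cone_of \<Delta> J)) ` {J \<in> simplices \<Delta>. dim (cone_of \<Delta> J) < mf_rank \<Delta>}
    \<union> (\<lambda>(u, u'). {x. f u x - f u' x = 0}) ` {(u, u') \<in> K \<times> K. u \<noteq> u'}"
  have "\<exists>v\<in>lat_V \<Delta> V. \<forall>S\<in>\<S>. v \<notin> S"
  proof (rule exists_avoiding_subspaces)
    show "finite \<S>"
      unfolding \<S>_def using finite_simplices assms(1)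
      by (intro finite_UnI finite_imageI) (auto intro: finite_subset[of _ "K \<times> K"])
    fix S assume "S \<in> \<S>"
    then consider J where "J \<in> simplices \<Delta>" "dim (cone_of \<Delta> J) < mf_rank \<Delta>" "S = span (cone_of \<Delta> J)"
      | u u' where "u \<in> K" "u' \<in> K" "u \<noteq> u'" "S = {x. f u x - f u' x = 0}"
      by (auto simp: \<S>_def)
    then have "subspace S \<and> \<not> L \<subseteq> S"
    proof cases
      case 1
      have "\<not> L \<subseteq> S"
      proof
        assume "L \<subseteq> S"
        then have "dim L \<le> dim (cone_of \<Delta> J)" using 1(3) dim_subset[of L S] by (simp add: dim_span)
        then show False using 1(2) by (simp add: mf_rank_def)
      qed
      then show ?thesis using 1(3) by simp
    next
      case 2
      have "linear (\<lambda>x. f u x - f u' x)" using f(1) 2 by (intro linear_compose_sub)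
      then have "subspace S" unfolding 2(4) by (rule linear_subspace_kernel)
      moreover have "\<not> L \<subseteq> S"
      proof
        assume "L \<subseteq> S"
        \<comment> \<open>Agreement on \<open>L\<close> already means equality, because elements of
          the dual lattice are extensional.\<close>
        then have "u x = u' x" if "x \<in> L" for x
          using that f(2)[OF 2(1) that] f(2)[OF 2(2) that] 2(4) by auto
        moreover have "u \<in> extensional L" "u' \<in> extensional L"
          using assms(2) 2 by (auto simp: dual_lattice_def)
        ultimately show False using extensionalityI 2(3) by blast
      qed
      ultimately show ?thesis by blast
    qed
    then show "subspace S \<and> \<not> lat_V \<Delta> V \<subseteq> S" using lat_V_not_subset by blast
  qed (auto intro: lat_V_0 lat_V_add)
  then obtain v where v: "v \<in> lat_V \<Delta> V" "\<And>S. S \<in> \<S> \<Longrightarrow> v \<notin> S" by blast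
  have vL: "v \<in> L" using v(1) lat_V_subset_L by blast
  have "generic \<Delta> v"
    unfolding generic_def using v(2) L_span[OF vL] by (auto simp: \<S>_def)
  moreover have "inj_on (\<lambda>u. u v) K"
  proof (rule inj_onI, rule ccontr)
    fix u u' assume u: "u \<in> K" "u' \<in> K" "u v = u' v" "u \<noteq> u'"
    then have "v \<notin> {x. f u x - f u' x = 0}" by (intro v(2)) (auto simp: \<S>_def)
    then show False using u f(2)[OF _ vL] by simp
  qed
  ultimately show ?thesis using that v(1) by blast
qed

lemma root_denom_pos: "root_denom \<Delta> V > 0"
proof -
  have "0 \<notin> (\<lambda>I. order (H_I \<Delta> V I)) ` facets \<Delta>" using order_H_I_pos by fastforce
  then have "root_denom \<Delta> V \<noteq> 0"
    unfolding root_denom_def using finite_facets by (subst Lcm_0_iff) auto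
  then show ?thesis by simp
qed

text \<open>For fixed irrational \<open>z\<close> and fixed \<open>\<sigma>\<close>, varying
  \<open>\<tau>\<close> fills the punctured disc in \<open>q\<close> and kills every coefficient.
  Varying \<open>z\<close> then separates the characters along a suitable \<open>v\<close>, and
  varying \<open>\<sigma>\<close> the powers of \<open>\<zeta>\<close>.\<close>

lemma genus_series_unique:
  assumes \<Phi>: "is_orbifold_elliptic_genus \<Delta> V \<Phi>"
    and zero: "\<And>v (z::real) \<tau> \<sigma>. v \<in> lat_V \<Delta> V \<Longrightarrow> Im \<tau> > 0 \<Longrightarrow> regular_point \<Delta> V v (of_real z) \<tau> \<Longrightarrow>
      genus_at \<Delta> V v (of_real z) \<tau> \<sigma> = 0"
  shows "\<Phi> = 0"
proof (rule fps_ext)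
  fix m
  define c where "c = fps_nth \<Phi> m"
  have keys: "Poly_Mapping.keys c \<subseteq> dual_lattice L"
    using \<Phi> by (auto simp: is_orbifold_elliptic_genus_def c_def)
  obtain v where v: "v \<in> lat_V \<Delta> V" "generic \<Delta> v" "inj_on (\<lambda>u. u v) (Poly_Mapping.keys c)"
    using separating_generic_vector[OF finite_keys keys] by blast
  have char0: "character_value (root_denom \<Delta> V) c v (of_real z) \<sigma> = 0" if z: "z \<notin> \<rat>" for z :: real and \<sigma>
  proof -
    define a where "a j = cis2pi (- of_nat (mf_rank \<Delta>) * \<sigma> / 2) *
      character_value (root_denom \<Delta> V) (fps_nth \<Phi> j) v (of_real z) \<sigma>" for j
    have "a m = 0"
    proof (rule powser_eq_0_punctured)
      fix q :: complex assume q: "q \<noteq> 0" "norm q < 1"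
      obtain \<tau> where \<tau>: "cis2pi \<tau> = q" using surj_cis2pi[OF q(1)] .
      have "exp (- 2 * pi * Im \<tau>) < exp 0" using q(2) unfolding \<tau>[symmetric] norm_cis2pi by simp
      then have im: "Im \<tau> > 0" by (simp add: zero_less_mult_iff)
      have reg: "regular_point \<Delta> V v (of_real z) \<tau>" by (rule regular_irrational[OF v(2,1) z im])
      have "(\<lambda>j. a j * cis2pi \<tau> ^ j) sums genus_at \<Delta> V v (of_real z) \<tau> \<sigma>"
        unfolding a_def using \<Phi> v(1,2) im reg by (simp add: is_orbifold_elliptic_genus_def)
      then show "(\<lambda>j. a j * q ^ j) sums 0" using zero[OF v(1) im reg] \<tau> by simp
    qed
    then show ?thesis by (simp add: a_def c_def)
  qed
  have "Poly_Mapping.lookup c u = 0" if u: "u \<in> Poly_Mapping.keys c" for u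
  proof (rule laurent_value_eq_0[OF root_denom_pos])
    fix \<sigma>
    show "laurent_value (root_denom \<Delta> V) (Poly_Mapping.lookup c u) \<sigma> = 0"
    proof (rule characters_independent[OF finite_keys v(3) infinite_cis2pi_irrationals _ u])
      fix z assume "z \<in> complex_of_real ` ({0<..<1} - \<rat>)"
      then obtain x where x: "z = of_real x" "x \<notin> \<rat>" by blast
      show "(\<Sum>u\<in>Poly_Mapping.keys c. laurent_value (root_denom \<Delta> V) (Poly_Mapping.lookup c u) \<sigma> * cis2pi (of_int (u v) * z)) = 0"
        using char0[OF x(2), of \<sigma>] by (simp add: character_value_def x(1))
    qed
  qed
  then have "c = 0" by (metis in_keys_iff poly_mapping_eqI lookup_zero)
  then show "fps_nth \<Phi> m = fps_nth 0 m" by (simp add: c_def)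
qed

end

theorem theorem3p4:
  fixes \<Delta> :: "('i, 'v::euclidean_space) multifan" and V :: "'i \<Rightarrow> 'v" and n :: nat
  assumes "simplicial_multifan \<Delta>" and "mf_rank \<Delta> = n" and "n \<ge> 1"
    and "complete_multifan \<Delta>"
    and "edge_vectors \<Delta> V"
    and "c1 \<Delta> V = \<one>\<^bsub>H2_quotient \<Delta> V\<^esub>"
  shows "orbifold_elliptic_genus \<Delta> V = 0"
proof -
  interpret simplicial_multifan_with_edges \<Delta> V
    using assms by unfold_locales
  obtain w where w: "w \<in> dual_lattice L" "\<And>i. i \<in> vertices \<Delta> \<Longrightarrow> w (V i) = 1"
    using c1_eq_0D[OF finite_vertices V_in_L L_add assms(6)] by blast
  obtain f :: "'v \<Rightarrow> real" where f: "linear f" "\<And>x. x \<in> L \<Longrightarrow> f x = of_int (w x)"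
    using dual_lattice_linear_extension[OF lattice w(1)] by blast
  have f1: "f (V i) = 1" if "i \<in> vertices \<Delta>" for i
    using f(2)[OF V_in_L[OF that]] w(2)[OF that] by simp
  note zero = genus_at_eq_0[OF assms(4) _ f(1) f1]
  have n: "mf_rank \<Delta> \<ge> 1" using assms by simp
  show ?thesis
    unfolding orbifold_elliptic_genus_def
  \<comment> \<open>The definite description needs both halves: the zero series represents the
    vanishing genus, and no other series does.\<close>
  proof (rule the_equality)
    show "is_orbifold_elliptic_genus \<Delta> V 0"
      using zero[OF n] by (auto simp: is_orbifold_elliptic_genus_def character_value_def)
    show "\<Phi> = 0" if "is_orbifold_elliptic_genus \<Delta> V \<Phi>" for \<Phi>
      using that by (rule genus_series_unique) (rule zero[OF n])
  qed
qed

end
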